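(* Let $G$ be a nontrivial finite group. If the derived subgroup of $G$ is nilpotent, then $$e(G)-e(G,g)\leq 11$$ for every $g\in G$.
   Context: For a nontrivial finite group $G$ and a subset $Y\subseteq G$, let $(x_n)_{n\geq 1}$ be a sequence of independent, uniformly distributed $G$-valued random variables, and let $\tau_{G,Y}=\min\{n\geq 1\mid \langle Y,x_1,\dots,x_n\rangle=G\}\in[0,+\infty]$. Define $e(G,Y)$ to be the expectation of $\tau_{G,Y}$. Write $e(G)=e(G,\emptyset)$ and $e(G,g)=e(G,\{g\})$ for $g\in G$. *)

theory Defs
  imports "HOL-Probability.Probability" "HOL-Algebra.Generated_Groups"
begin

text \<open>The stopping time \<open>\<tau>\<close> along a single sequence \<open>x\<close>, with terms indexed from 1.
  At least one term is always drawn, even if \<open>Y\<close> already generates the group, and the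
  value is \<open>\<infinity>\<close> if no finite initial segment suffices.\<close>

definition generation_time ::
  "('a, 'b) monoid_scheme \<Rightarrow> 'a set \<Rightarrow> (nat \<Rightarrow> 'a) \<Rightarrow> enat" where
  "generation_time G Y x =
     Inf {enat n | n. 1 \<le> n \<and> generate G (Y \<union> x ` {1..n}) = carrier G}"

text \<open>The expectation is an extended real, so that differences of expectations are genuine
  (not truncated) and a bound such as \<open>a - b \<le> 11\<close> with \<open>b \<ge> 0\<close> fails for \<open>a = \<infinity>\<close>.
  The product measure is the law of an i.i.d. uniform sequence; by the lemma
  \<open>expected_generation_time_eq\<close> below, any other i.i.d. uniform sequence gives the same value.\<close>

definition uniform_sequence_measure ::
  "('a, 'b) monoid_scheme \<Rightarrow> (nat \<Rightarrow> 'a) measure" where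
  "uniform_sequence_measure G = (\<Pi>\<^sub>M n\<in>{1..}. uniform_count_measure (carrier G))"

definition expected_generation_time ::
  "('a, 'b) monoid_scheme \<Rightarrow> 'a set \<Rightarrow> ereal" where
  "expected_generation_time G Y =
     enn2ereal (\<integral>\<^sup>+ x. ennreal_of_enat (generation_time G Y x) \<partial>uniform_sequence_measure G)"

primrec lower_central_series :: "('a, 'b) monoid_scheme \<Rightarrow> nat \<Rightarrow> 'a set" where
  "lower_central_series G 0 = carrier G"
| "lower_central_series G (Suc n) =
     generate G (\<Union>h \<in> carrier G. \<Union>k \<in> lower_central_series G n.
       {h \<otimes>\<^bsub>G\<^esub> k \<otimes>\<^bsub>G\<^esub> inv\<^bsub>G\<^esub> h \<otimes>\<^bsub>G\<^esub> inv\<^bsub>G\<^esub> k})"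

definition nilpotent_group :: "('a, 'b) monoid_scheme \<Rightarrow> bool" where
  "nilpotent_group G \<longleftrightarrow> group G \<and> (\<exists>n. lower_central_series G n = {\<one>\<^bsub>G\<^esub>})"

lemma measurable_generation_time:
  assumes fin: "finite (carrier G)"
  shows "generation_time G Y \<in> measurable (uniform_sequence_measure G) (count_space UNIV)"
proof -
  let ?U = "uniform_count_measure (carrier G)"
  let ?P = "\<lambda>n x. generate G (Y \<union> x ` {1..n}) = carrier G"
  have P: "Measurable.pred (uniform_sequence_measure G) (?P n)" for n
  proof -
    have r: "(\<lambda>x. restrict x {1..n}) \<in> measurable (uniform_sequence_measure G)
        (count_space (PiE {1..n} (\<lambda>_. carrier G)))"
    proof -
      have "sets (uniform_sequence_measure G) = sets (PiM {1..} (\<lambda>_. count_space (carrier G)))"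
        unfolding uniform_sequence_measure_def
        by (intro sets_PiM_cong) (simp_all add: sets_uniform_count_measure_count_space)
      then have "(\<lambda>x. restrict x {1..n}) \<in> measurable (uniform_sequence_measure G)
          (PiM {1..n} (\<lambda>_. count_space (carrier G)))"
        using measurable_restrict_subset[of "{1..n}" "{1..}" "\<lambda>_. count_space (carrier G)"]
          measurable_cong_sets[OF _ refl] by (metis atLeastAtMost_iff atLeast_iff subsetI)
      then show ?thesis
        using fin by (simp add: count_space_PiM_finite countable_finite)
    qed
    have "Measurable.pred (uniform_sequence_measure G) (\<lambda>x. ?P n (restrict x {1..n}))"
      by (rule measurable_compose[OF r]) simp
    moreover have "?P n (restrict x {1..n}) = ?P n x" for x
      by (simp add: image_restrict_eq)
    ultimately show ?thesis by simp
  qed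
  have "generation_time G Y x = (INF n. if 1 \<le> n \<and> ?P n x then enat n else \<infinity>)" for x
    unfolding generation_time_def
  proof (rule antisym)
    show "Inf {enat n | n. 1 \<le> n \<and> ?P n x} \<le> (INF n. if 1 \<le> n \<and> ?P n x then enat n else \<infinity>)"
      by (rule INF_greatest) (auto intro!: Inf_lower)
    show "(INF n. if 1 \<le> n \<and> ?P n x then enat n else \<infinity>) \<le> Inf {enat n | n. 1 \<le> n \<and> ?P n x}"
    proof (rule Inf_greatest)
      fix t assume "t \<in> {enat n | n. 1 \<le> n \<and> ?P n x}"
      then obtain n where n: "t = enat n" "1 \<le> n \<and> ?P n x" by blast
      show "(INF n. if 1 \<le> n \<and> ?P n x then enat n else \<infinity>) \<le> t"
        by (rule INF_lower2[of n]) (use n in simp_all)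
    qed
  qed
  then have eq: "generation_time G Y = (\<lambda>x. INF n. if 1 \<le> n \<and> ?P n x then enat n else \<infinity>)"
    by (rule ext)
  show ?thesis
    unfolding eq using P by measurable
qed

lemma expected_generation_time_eq:
  fixes G :: "('a, 'b) monoid_scheme" and x :: "nat \<Rightarrow> 'w \<Rightarrow> 'a"
  assumes M: "prob_space M" and fin: "finite (carrier G)"
    and indep: "prob_space.indep_vars M (\<lambda>_. count_space (carrier G)) x {1..}"
    and unif: "\<And>n. 1 \<le> n \<Longrightarrow> distr M (count_space (carrier G)) (x n) = uniform_count_measure (carrier G)"
  shows "expected_generation_time G Y =
    enn2ereal (\<integral>\<^sup>+ \<omega>. ennreal_of_enat (generation_time G Y (\<lambda>n. x n \<omega>)) \<partial>M)"
proof -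
  interpret prob_space M by fact
  let ?C = "count_space (carrier G)"
  let ?X = "\<lambda>\<omega>. \<lambda>n\<in>{1..}. x n \<omega>"
  have rv: "random_variable ?C (x n)" if "n \<in> {1..}" for n
    using indep that unfolding indep_vars_def by blast
  have "distr M (PiM {1..} (\<lambda>_. ?C)) ?X = PiM {1..} (\<lambda>n. distr M ?C (x n))"
    by (rule iffD1[OF indep_vars_iff_distr_eq_PiM' indep]) (simp, rule rv)
  also have "\<dots> = uniform_sequence_measure G"
    unfolding uniform_sequence_measure_def using unif by (intro PiM_cong) auto
  finally have law: "uniform_sequence_measure G = distr M (PiM {1..} (\<lambda>_. ?C)) ?X" ..
  have X: "?X \<in> measurable M (PiM {1..} (\<lambda>_. ?C))"
    using rv by (intro measurable_restrict) auto
  have "generation_time G Y \<in> measurable (PiM {1..} (\<lambda>_. ?C)) (count_space UNIV)"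
    using measurable_generation_time[OF fin, of Y] unfolding law by simp
  then have T: "(\<lambda>y. ennreal_of_enat (generation_time G Y y))
      \<in> borel_measurable (PiM {1..} (\<lambda>_. ?C))"
    by (rule measurable_compose) simp
  have restr: "generation_time G Y (?X \<omega>) = generation_time G Y (\<lambda>n. x n \<omega>)" for \<omega>
  proof -
    have "?X \<omega> ` {1..n} = (\<lambda>n. x n \<omega>) ` {1..n}" for n
      by (rule image_cong) auto
    then show ?thesis
      unfolding generation_time_def by simp
  qed
  show ?thesis
    unfolding expected_generation_time_def law
    by (subst nn_integral_distr[OF X]) (use T in simp, simp only: restr)
qed

end

theory Submission
  imports Defs "HOL-Algebra.Multiplicative_Group"
begin

text \<open>
  Write \<open>P(Y, n)\<close> for the probability that \<open>Y\<close> and \<open>n\<close> uniform elements generate \<open>G\<close>. Then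
  \<open>e(G) - e(G, g)\<close> is the sum over \<open>n\<close> of \<open>P({g}, n) - P({}, n)\<close>, and the idea is to compare
  \<open>P({g}, n)\<close> with \<open>P({}, n + 1)\<close>, after which the sum telescopes.

  Let \<open>A\<close> be the derived subgroup. Modulo the Frattini subgroup \<open>A\<close> is a semisimple module with
  a complement \<open>H\<close>. Write \<open>g = h a\<close>, let \<open>B\<close> be the submodule generated by \<open>a\<close> and let
  \<open>E\<close> be a complement of \<open>B\<close> in \<open>A\<close>. By Gaschuetz, passing from \<open>N\<close> to \<open>M\<close> for a
  chief factor \<open>N / M\<close> below \<open>E\<close> with \<open>q\<close> elements and \<open>c\<close> complements, \<open>c'\<close> of them
  containing \<open>g\<close>, multiplies \<open>P({}, n + 1)\<close> by \<open>1 - c / q ^ (n + 1)\<close> and \<open>P({g}, n)\<close> by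
  \<open>1 - c' / q ^ n\<close>. Since \<open>H B\<close> contains \<open>g\<close>, some complement does, and as the
  complements form a torsor this forces \<open>c \<le> q c'\<close>. Hence
  \<open>P({g}, n) \<le> P({}, n + 1) + (1 - P(E, n + 1))\<close>.

  The error term is at most the sum of \<open>|G : L| ^ (- n - 1)\<close> over the maximal subgroups \<open>L\<close>
  containing \<open>E\<close>. If \<open>G\<close> is generated by \<open>d\<close> elements, at most \<open>k ^ d\<close> maximal subgroups of
  index \<open>k\<close> contain \<open>A\<close>. The others come from the simple quotients of order \<open>k\<close> of the
  module \<open>A / E\<close>, each accounting for at most \<open>k\<close> of them. As \<open>A / E\<close> is cyclic over a
  commutative ring, \<open>t\<close> such quotients give a quotient of order \<open>k ^ t\<close>; it is generated by the
  conjugates of \<open>a\<close>, of which there are at most \<open>(k - 1) ^ d\<close> modulo the kernel, so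
  \<open>t \<le> (k - 1) ^ d\<close>. The resulting bound is summable for \<open>n \<ge> d + 3\<close>.
\<close>

text \<open>Nilpotency enters once, in \<open>frattini_section_nilpotent_derived\<close>: a maximal
  subgroup not containing \<open>A\<close> meets it in a normal subgroup of \<open>G\<close> and
  contains every commutator of \<open>A\<close>. With \<open>R\<close> the intersection of
  \<open>A\<close> and the Frattini subgroup, this is what makes \<open>A / R\<close> an abelian
  group and a semisimple module. Quotient modules are not formed: a submodule is a normal subgroup
  of \<open>G\<close> between \<open>R\<close> and \<open>A\<close>, and identities hold modulo
  \<open>R\<close>.

  The comparison cannot be run through all of \<open>A\<close>. If \<open>g\<close> lies in
  \<open>A\<close> but not in \<open>R\<close>, no complement of \<open>A\<close> modulo
  \<open>R\<close> contains \<open>g\<close>; when \<open>A / R\<close> is a chief factor, this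
  means \<open>c' = 0\<close> while \<open>c > 0\<close>, and the factor belonging to
  \<open>g\<close> is the larger one. So the descent starts at \<open>E\<close>, and the error term
  is the price. Cyclicity of \<open>A / E\<close> keeps that price low, because it makes distinct
  simple quotients independent.\<close>

section \<open>Lattice of subgroups\<close>

context group
begin

lemma inv_mult_cancel [simp]:
  assumes "x \<in> carrier G" "y \<in> carrier G"
  shows "inv x \<otimes> (x \<otimes> y) = y" "x \<otimes> (inv x \<otimes> y) = y"
  using assms by (simp_all flip: m_assoc)

text \<open>The convention of \<open>derived\<close> and \<open>lower_central_series\<close>, whose
  generators are thus literally of this form.\<close>

abbreviation comm :: "'a \<Rightarrow> 'a \<Rightarrow> 'a" where
  "comm x y \<equiv> x \<otimes> y \<otimes> inv x \<otimes> inv y"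

text \<open>With the simp rules \<open>inv_mult_cancel\<close>, these rewrite a product to a
  right-bracketed reduced word, which settles the commutator identities below.\<close>

lemmas word_simps = m_assoc inv_mult_group

lemma subgroup_mult_mem:
  assumes "subgroup H G" "x \<in> H" "y \<in> carrier G"
  shows "x \<otimes> y \<in> H \<longleftrightarrow> y \<in> H" "y \<otimes> x \<in> H \<longleftrightarrow> y \<in> H"
proof -
  have x: "x \<in> carrier G" using assms subgroup.subset by blast
  show "x \<otimes> y \<in> H \<longleftrightarrow> y \<in> H"
    using inv_mult_cancel(1)[OF x assms(3)] assms subgroup.m_closed[OF assms(1)]
      subgroup.m_inv_closed[OF assms(1)] by metis
  have "y \<otimes> x \<otimes> inv x = y" using x assms(3) by (simp add: m_assoc)
  then show "y \<otimes> x \<in> H \<longleftrightarrow> y \<in> H"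
    using assms subgroup.m_closed[OF assms(1)] subgroup.m_inv_closed[OF assms(1)] by metis
qed

lemma mem_set_mult: "x \<in> U <#> V \<longleftrightarrow> (\<exists>u\<in>U. \<exists>v\<in>V. x = u \<otimes> v)"
  unfolding set_mult_def by auto

lemma normal_conj:
  assumes "N \<lhd> G" "x \<in> carrier G" "n \<in> N"
  shows "x \<otimes> n \<otimes> inv x \<in> N" "inv x \<otimes> n \<otimes> x \<in> N" "x \<otimes> (n \<otimes> inv x) \<in> N" "inv x \<otimes> (n \<otimes> x) \<in> N"
  using normal.inv_op_closed1[OF assms] normal.inv_op_closed2[OF assms]
    subgroup.mem_carrier[OF normal_imp_subgroup[OF assms(1)] assms(3)] assms(2)
  by (simp_all add: m_assoc)

lemma subgroup_set_mult_normal: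
  assumes H: "subgroup H G" and N: "N \<lhd> G"
  shows "subgroup (H <#> N) G"
proof (rule subgroupI)
  note Ns = normal_imp_subgroup[OF N]
  note c = subgroup.mem_carrier[OF H] subgroup.mem_carrier[OF Ns]
  show "H <#> N \<subseteq> carrier G"
    using c by (auto simp: mem_set_mult)
  have "\<one> \<otimes> \<one> \<in> H <#> N"
    unfolding mem_set_mult using subgroup.one_closed[OF H] subgroup.one_closed[OF Ns] by blast
  then show "H <#> N \<noteq> {}" by blast
  fix a assume "a \<in> H <#> N"
  then obtain h n where a: "h \<in> H" "n \<in> N" "a = h \<otimes> n" unfolding mem_set_mult by blast
  have "inv a = inv h \<otimes> (h \<otimes> inv n \<otimes> inv h)"
    using a c by (simp add: word_simps)
  moreover have "h \<otimes> inv n \<otimes> inv h \<in> N"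
    by (intro normal_conj(1)[OF N] c(1) subgroup.m_inv_closed[OF Ns] a)
  ultimately show "inv a \<in> H <#> N"
    unfolding mem_set_mult using subgroup.m_inv_closed[OF H a(1)] by blast
  fix b assume "b \<in> H <#> N"
  then obtain h' n' where b: "h' \<in> H" "n' \<in> N" "b = h' \<otimes> n'" unfolding mem_set_mult by blast
  have "a \<otimes> b = (h \<otimes> h') \<otimes> ((inv h' \<otimes> n \<otimes> h') \<otimes> n')"
    using a b c by (simp add: word_simps)
  moreover have "(inv h' \<otimes> n \<otimes> h') \<otimes> n' \<in> N"
    by (intro subgroup.m_closed[OF Ns] normal_conj(2)[OF N] c(1) a b)
  ultimately show "a \<otimes> b \<in> H <#> N"
    unfolding mem_set_mult using subgroup.m_closed[OF H a(1) b(1)] by blast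
qed

lemma normal_set_mult:
  assumes M: "M \<lhd> G" and N: "N \<lhd> G"
  shows "M <#> N \<lhd> G"
proof (rule normal_invI)
  show "subgroup (M <#> N) G"
    by (rule subgroup_set_mult_normal[OF normal_imp_subgroup[OF M] N])
  fix x h assume x: "x \<in> carrier G" and "h \<in> M <#> N"
  then obtain m n where h: "m \<in> M" "n \<in> N" "h = m \<otimes> n" unfolding mem_set_mult by blast
  then have "x \<otimes> h \<otimes> inv x = (x \<otimes> m \<otimes> inv x) \<otimes> (x \<otimes> n \<otimes> inv x)"
    using x subgroup.mem_carrier[OF normal_imp_subgroup[OF M]]
      subgroup.mem_carrier[OF normal_imp_subgroup[OF N]] by (simp add: word_simps)
  then show "x \<otimes> h \<otimes> inv x \<in> M <#> N"
    unfolding mem_set_mult using normal_conj[OF M x h(1)] normal_conj[OF N x h(2)] by blast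
qed

lemma normal_Int:
  assumes "M \<lhd> G" "N \<lhd> G" shows "M \<inter> N \<lhd> G"
  using normal_subgroup_intersect[OF assms] .

lemma subset_set_mult:
  assumes "subgroup H G" "subgroup K G"
  shows "H \<subseteq> H <#> K" "K \<subseteq> H <#> K"
proof -
  have "x = x \<otimes> \<one>" "x = \<one> \<otimes> x" if "x \<in> H \<union> K" for x
    using assms that subgroup.mem_carrier[OF assms(1)] subgroup.mem_carrier[OF assms(2)] by auto
  then show "H \<subseteq> H <#> K" "K \<subseteq> H <#> K"
    unfolding mem_set_mult subset_iff
    using subgroup.one_closed[OF assms(1)] subgroup.one_closed[OF assms(2)] by blast+
qed

lemma set_mult_subset:
  assumes "subgroup K G" "U \<subseteq> K" "V \<subseteq> K"
  shows "U <#> V \<subseteq> K"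
  using assms(2,3) by (auto simp: mem_set_mult intro!: subgroup.m_closed[OF assms(1)])

end

lemma card_eq_fibres:
  assumes "finite A" "f ` A = B" "\<And>b. b \<in> B \<Longrightarrow> card {a \<in> A. f a = b} = k"
  shows "card A = card B * k"
proof -
  have B: "finite B" using assms by blast
  have "card A = (\<Sum>b\<in>B. card {a \<in> A. f a = b})"
    using card_eq_sum sum.group[OF assms(1) B, of f "\<lambda>_. 1::nat"] assms(2) by simp
  then show ?thesis using assms(3) by simp
qed

locale finite_group = group +
  assumes fin [simp]: "finite (carrier G)"
begin

lemma finite_sub: "H \<subseteq> carrier G \<Longrightarrow> finite H"
  using finite_subset fin by blast

lemma finite_subgroup: "subgroup H G \<Longrightarrow> finite H"
  using finite_sub subgroup.subset by blast

lemma card_subgroup_pos: "subgroup H G \<Longrightarrow> card H > 0"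
  using finite_subgroup subgroup.one_closed by (metis card_gt_0_iff empty_iff)

lemma subgroup_of_mult_closed:
  assumes "H \<subseteq> carrier G" "H \<noteq> {}" "\<And>x y. x \<in> H \<Longrightarrow> y \<in> H \<Longrightarrow> x \<otimes> y \<in> H"
  shows "subgroup H G"
proof (rule subgroupI)
  fix a assume a: "a \<in> H"
  then have ac: "a \<in> carrier G" using assms by blast
  have pow: "a [^] Suc n \<in> H" for n
    using assms a ac by (induction n) auto
  \<comment> \<open>\<open>pow\<close> only reaches positive exponents, and the factor 2 keeps this
    exponent positive in the trivial group.\<close>
  have "inv a = a [^] (Coset.order G * 2 - 1)"
  proof -
    have "Coset.order G > 0" using order_gt_0_iff_finite by simp
    then have "Coset.order G * 2 = Suc (Coset.order G * 2 - 1)" by simp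
    then have "a [^] (Coset.order G * 2 - 1) \<otimes> a = a [^] (Coset.order G * 2)"
      using ac by (metis nat_pow_Suc)
    also have "\<dots> = \<one>" using nat_pow_pow[OF ac, of "Coset.order G" 2] pow_order_eq_1[OF ac] by simp
    finally show ?thesis using ac by (metis inv_equality nat_pow_closed)
  qed
  also have "\<dots> \<in> H"
  proof -
    have "Coset.order G > 0" using order_gt_0_iff_finite by simp
    then have "Coset.order G * 2 - 1 = Suc (Coset.order G * 2 - 2)" by simp
    then show ?thesis using pow by metis
  qed
  finally show "inv a \<in> H" .
qed (use assms in auto)

text \<open>The pairs with product \<open>h \<otimes> k\<close> are exactly the
  \<open>(h \<otimes> d, inv d \<otimes> k)\<close> with \<open>d\<close> in
  \<open>H \<inter> K\<close>.\<close>

lemma card_set_mult: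
  assumes H: "subgroup H G" and K: "subgroup K G"
  shows "card H * card K = card (H <#> K) * card (H \<inter> K)"
proof -
  note c = subgroup.mem_carrier[OF H] subgroup.mem_carrier[OF K]
  have "card (H \<times> K) = card (H <#> K) * card (H \<inter> K)"
  proof (rule card_eq_fibres[where f = "\<lambda>(h, k). h \<otimes> k"])
    show "finite (H \<times> K)" using H K finite_subgroup by simp
    show "(\<lambda>(h, k). h \<otimes> k) ` (H \<times> K) = H <#> K" unfolding set_mult_def by auto
    fix b assume "b \<in> H <#> K"
    then obtain h k where b: "h \<in> H" "k \<in> K" "b = h \<otimes> k" unfolding mem_set_mult by blast
    let ?f = "\<lambda>d. (h \<otimes> d, inv d \<otimes> k)"
    have "{a \<in> H \<times> K. (case a of (h, k) \<Rightarrow> h \<otimes> k) = b} = ?f ` (H \<inter> K)"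
    proof (intro equalityI subsetI)
      fix a assume "a \<in> {a \<in> H \<times> K. (case a of (h, k) \<Rightarrow> h \<otimes> k) = b}"
      then obtain h' k' where a: "a = (h', k')" "h' \<in> H" "k' \<in> K" "h' \<otimes> k' = h \<otimes> k" using b by auto
      note cc = c(1)[OF a(2)] c(1)[OF b(1)] c(2)[OF a(3)] c(2)[OF b(2)]
      have "inv h \<otimes> h' = inv h \<otimes> (h' \<otimes> k' \<otimes> inv k')" using cc by (simp add: m_assoc)
      also have "\<dots> = k \<otimes> inv k'" unfolding a(4) using cc by (simp add: word_simps)
      finally have e: "inv h \<otimes> h' = k \<otimes> inv k'" .
      then have "inv h \<otimes> h' \<in> H \<inter> K"
        using subgroup.m_closed[OF H subgroup.m_inv_closed[OF H b(1)] a(2)]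
          subgroup.m_closed[OF K b(2) subgroup.m_inv_closed[OF K a(3)]] by simp
      moreover have "?f (inv h \<otimes> h') = a"
        unfolding a(1) using cc by (subst (2) e) (simp add: word_simps)
      ultimately show "a \<in> ?f ` (H \<inter> K)" by (intro image_eqI[where x = "inv h \<otimes> h'"]) simp_all
    next
      fix a assume "a \<in> ?f ` (H \<inter> K)"
      then obtain d where d: "d \<in> H" "d \<in> K" "a = (h \<otimes> d, inv d \<otimes> k)" by (elim imageE IntE)
      then show "a \<in> {a \<in> H \<times> K. (case a of (h, k) \<Rightarrow> h \<otimes> k) = b}"
        using c(1)[OF b(1)] c(2)[OF b(2)] c(1)[OF d(1)] b
          subgroup.m_closed[OF H b(1) d(1)]
          subgroup.m_closed[OF K subgroup.m_inv_closed[OF K d(2)] b(2)]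
        by (simp add: word_simps)
    qed
    moreover have "inj_on ?f (H \<inter> K)"
    proof (rule inj_onI)
      fix d d' assume "d \<in> H \<inter> K" "d' \<in> H \<inter> K" "?f d = ?f d'"
      then show "d = d'" using c(1)[OF b(1)] c(1)[of d] c(1)[of d'] by simp
    qed
    ultimately show "card {a \<in> H \<times> K. (case a of (h, k) \<Rightarrow> h \<otimes> k) = b} = card (H \<inter> K)"
      by (simp add: card_image)
  qed
  then show ?thesis by (simp add: card_cartesian_product)
qed

subsection \<open>Maximal subgroups\<close>

definition maximal_subgroup :: "'a set \<Rightarrow> bool" where
  "maximal_subgroup L \<longleftrightarrow> subgroup L G \<and> L \<noteq> carrier G \<and>
     (\<forall>K. subgroup K G \<longrightarrow> L \<subseteq> K \<longrightarrow> K = L \<or> K = carrier G)"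

lemma maximal_subgroupD:
  assumes "maximal_subgroup L"
  shows "subgroup L G" "L \<noteq> carrier G"
    "subgroup K G \<Longrightarrow> L \<subseteq> K \<Longrightarrow> K \<noteq> L \<Longrightarrow> K = carrier G"
  using assms unfolding maximal_subgroup_def by blast+

lemma finite_maximal_subgroups: "finite {L. maximal_subgroup L \<and> P L}"
  by (rule finite_subset[of _ "Pow (carrier G)"])
     (auto dest!: maximal_subgroupD(1) subgroup.subset)

lemma maximal_subgroup_index:
  assumes L: "maximal_subgroup L"
  shows "\<exists>k\<in>{2..card (carrier G)}. card (carrier G) = k * card L"
proof -
  note Ls = maximal_subgroupD(1)[OF L]
  have k: "card (carrier G) = card (rcosets L) * card L"
    using lagrange[OF Ls] by (simp add: Coset.order_def)
  have "card L < card (carrier G)"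
    using maximal_subgroupD(2)[OF L] subgroup.subset[OF Ls] by (intro psubset_card_mono) auto
  then have "1 * card L < card (rcosets L) * card L" using k by simp
  then have "2 \<le> card (rcosets L)" using mult_less_cancel2[of 1 "card L"] by simp
  moreover have "card (rcosets L) \<le> card (carrier G)" using k card_subgroup_pos[OF Ls] by simp
  ultimately show ?thesis using k by (intro bexI[of _ "card (rcosets L)"]) simp_all
qed

lemma exists_maximal_subgroup:
  assumes "subgroup K G" "K \<noteq> carrier G"
  shows "\<exists>L. maximal_subgroup L \<and> K \<subseteq> L"
proof -
  let ?F = "{L. subgroup L G \<and> L \<noteq> carrier G \<and> K \<subseteq> L}"
  have fF: "finite ?F" by (rule finite_subset[of _ "Pow (carrier G)"]) (auto dest: subgroup.subset)
  have nF: "?F \<noteq> {}" using assms by blast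
  obtain L where L: "L \<in> ?F" "\<forall>K\<in>?F. L \<subseteq> K \<longrightarrow> L = K"
    by (rule bexE[OF finite_has_maximal[OF fF nF]]) (rule that)
  have "maximal_subgroup L" unfolding maximal_subgroup_def
  proof (intro conjI allI impI)
    show "subgroup L G" "L \<noteq> carrier G" using L(1) by simp_all
    fix K' assume "subgroup K' G" "L \<subseteq> K'"
    then show "K' = L \<or> K' = carrier G" using L by auto
  qed
  then show ?thesis using L(1) by blast
qed

lemma maximal_set_mult:
  assumes L: "maximal_subgroup L" and N: "N \<lhd> G" "\<not> N \<subseteq> L"
  shows "L <#> N = carrier G"
proof (rule maximal_subgroupD(3)[OF L])
  note Ls = maximal_subgroupD(1)[OF L]
  show "subgroup (L <#> N) G" by (rule subgroup_set_mult_normal[OF Ls N(1)])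
  show "L \<subseteq> L <#> N" "L <#> N \<noteq> L"
    using subset_set_mult[OF Ls normal_imp_subgroup[OF N(1)]] N by auto
qed

end

section \<open>Complements of abelian chief factors\<close>

context finite_group
begin

text \<open>For normal \<open>M \<subseteq> N\<close> these are the preimages of the complements of
  \<open>N / M\<close> in \<open>G / M\<close>.\<close>

definition complements :: "'a set \<Rightarrow> 'a set \<Rightarrow> 'a set set" where
  "complements M N = {C. subgroup C G \<and> C \<inter> N = M \<and> C <#> N = carrier G}"

lemma complementsD:
  assumes "C \<in> complements M N"
  shows "subgroup C G" "C \<inter> N = M" "C <#> N = carrier G" "M \<subseteq> C"
  using assms unfolding complements_def by blast+

lemma finite_complements [simp]: "finite (complements M N)"
  by (rule finite_subset[of _ "Pow (carrier G)"])
     (auto simp: complements_def dest: subgroup.subset)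

lemma complement_transversal:
  assumes "N \<lhd> G" "C \<in> complements M N" "x \<in> carrier G"
  obtains c where "c \<in> C" "c \<otimes> inv x \<in> N" "inv x \<otimes> c \<in> N"
proof -
  have "x \<in> C <#> N" using complementsD(3)[OF assms(2)] assms(3) by simp
  then obtain c n where c: "c \<in> C" "n \<in> N" "x = c \<otimes> n" unfolding mem_set_mult by blast
  note Ns = normal_imp_subgroup[OF assms(1)]
  note cc = subgroup.mem_carrier[OF complementsD(1)[OF assms(2)] c(1)] subgroup.mem_carrier[OF Ns c(2)]
  have i: "inv n \<in> N" by (rule subgroup.m_inv_closed[OF Ns c(2)])
  have "inv x \<otimes> c = inv n" "c \<otimes> inv x = c \<otimes> inv n \<otimes> inv c"
    unfolding c(3) using cc by (simp_all add: word_simps)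
  then show ?thesis
    using that[OF c(1)] i normal_conj(1)[OF assms(1) cc(1) i] by simp
qed

text \<open>If \<open>c\<close> is an element of \<open>C\<close> congruent to \<open>y\<close>
  modulo \<open>N\<close>, the solutions \<open>v\<close> form the coset of \<open>M\<close> through
  \<open>inv y \<otimes> c\<close>.\<close>

lemma card_coset_Int_complement:
  assumes N: "N \<lhd> G" and C: "C \<in> complements M N" and y: "y \<in> carrier G"
  shows "card {v \<in> N. y \<otimes> v \<in> C} = card M"
proof -
  note Ns = normal_imp_subgroup[OF N] and Cs = complementsD(1)[OF C]
  note cN = subgroup.mem_carrier[OF Ns]
  have MN: "M \<subseteq> N" using complementsD(2)[OF C] by blast
  obtain c where c: "c \<in> C" "c \<otimes> inv y \<in> N" "inv y \<otimes> c \<in> N"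
    by (rule complement_transversal[OF N C y])
  have cc: "c \<in> carrier G" using subgroup.mem_carrier[OF Cs c(1)] .
  let ?f = "\<lambda>m. inv y \<otimes> c \<otimes> m"
  have "{v \<in> N. y \<otimes> v \<in> C} = ?f ` M"
  proof (intro equalityI subsetI)
    fix v assume v: "v \<in> {v \<in> N. y \<otimes> v \<in> C}"
    have vc: "v \<in> carrier G" using cN v by blast
    let ?m = "inv c \<otimes> (y \<otimes> v)"
    have "?m \<in> C" using subgroup.m_closed[OF Cs subgroup.m_inv_closed[OF Cs c(1)]] v by blast
    moreover have "inv (inv y \<otimes> c) \<otimes> v = ?m" using y cc vc by (simp add: word_simps)
    then have "?m \<in> N" using subgroup.m_closed[OF Ns subgroup.m_inv_closed[OF Ns c(3)], of v] v by simp
    ultimately have "?m \<in> M" using complementsD(2)[OF C] by blast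
    moreover have "v = ?f ?m" using y cc vc by (simp add: word_simps)
    ultimately show "v \<in> ?f ` M" by blast
  next
    fix v assume "v \<in> ?f ` M"
    then obtain m where m: "m \<in> M" "v = ?f m" by blast
    have mc: "m \<in> carrier G" using MN m(1) cN by blast
    have "v \<in> N" unfolding m(2) by (rule subgroup.m_closed[OF Ns c(3)]) (use MN m in blast)
    moreover have "y \<otimes> v = c \<otimes> m" using y cc mc m by (simp add: word_simps)
    ultimately show "v \<in> {v \<in> N. y \<otimes> v \<in> C}"
      using subgroup.m_closed[OF Cs c(1), of m] complementsD(4)[OF C] m(1) by auto
  qed
  moreover have "inj_on ?f M"
  proof (rule inj_onI)
    fix m m' assume "m \<in> M" "m' \<in> M" "?f m = ?f m'"
    moreover from this have "m \<in> carrier G" "m' \<in> carrier G" using MN cN by blast+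
    ultimately show "m = m'" using y cc by simp
  qed
  ultimately show ?thesis by (simp add: card_image)
qed

text \<open>The torsor structure of the set of complements, without derivations: if \<open>C\<close>,
  \<open>C1\<close>, \<open>C0\<close> correspond to derivations \<open>d\<close>, \<open>d1\<close>, \<open>d0\<close>, then \<open>twist N C C1 C0\<close>
  corresponds to \<open>d - d1 + d0\<close>.\<close>

definition twist :: "'a set \<Rightarrow> 'a set \<Rightarrow> 'a set \<Rightarrow> 'a set \<Rightarrow> 'a set" where
  "twist N C C1 C0 = {c \<otimes> inv c1 \<otimes> c0 | c c1 c0.
     c \<in> C \<and> c1 \<in> C1 \<and> c0 \<in> C0 \<and> c \<otimes> inv c1 \<in> N \<and> inv c1 \<otimes> c0 \<in> N}"

lemma mem_twist:
  "x \<in> twist N C C1 C0 \<longleftrightarrow> (\<exists>c c1 c0. c \<in> C \<and> c1 \<in> C1 \<and> c0 \<in> C0 \<and> c \<otimes> inv c1 \<in> N \<and>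
     inv c1 \<otimes> c0 \<in> N \<and> x = c \<otimes> inv c1 \<otimes> c0)"
  unfolding twist_def by blast

context
  fixes M N
  assumes M: "M \<lhd> G" and N: "N \<lhd> G" and MN: "M \<subseteq> N"
    and comm: "\<And>u v. u \<in> N \<Longrightarrow> v \<in> N \<Longrightarrow> comm u v \<in> M"
begin

text \<open>Closure under products is where \<open>N / M\<close> has to be abelian: bringing
  \<open>x \<otimes> y\<close> into the required shape moves \<open>inv c1 \<otimes> c0\<close> past
  \<open>d \<otimes> inv d1\<close>, at the cost of a commutator \<open>k\<close> in
  \<open>M\<close>. The factor from \<open>C\<close> absorbs \<open>k\<close> because
  \<open>M \<subseteq> C\<close>.\<close>

lemma twist_complement:
  assumes C: "C \<in> complements M N" and C1: "C1 \<in> complements M N" and C0: "C0 \<in> complements M N"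
  shows "twist N C C1 C0 \<in> complements M N"
proof -
  note Cs = complementsD(1)[OF C] and C1s = complementsD(1)[OF C1] and C0s = complementsD(1)[OF C0]
  note Ns = normal_imp_subgroup[OF N] and Ms = normal_imp_subgroup[OF M]
  note cC = subgroup.mem_carrier[OF Cs] and cC1 = subgroup.mem_carrier[OF C1s]
    and cC0 = subgroup.mem_carrier[OF C0s] and cN = subgroup.mem_carrier[OF Ns]
  let ?T = "twist N C C1 C0"
  have T: "subgroup ?T G"
  proof (rule subgroup_of_mult_closed)
    show "?T \<subseteq> carrier G" unfolding subset_iff mem_twist using cC cC1 cC0 by auto
    have "\<one> \<otimes> inv \<one> \<otimes> \<one> \<in> ?T"
      unfolding mem_twist using subgroup.one_closed[OF Cs] subgroup.one_closed[OF C1s]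
        subgroup.one_closed[OF C0s] subgroup.one_closed[OF Ns]
      by (intro exI[of _ \<one>]) simp
    then show "?T \<noteq> {}" by blast
    fix x y assume "x \<in> ?T" "y \<in> ?T"
    then obtain c c1 c0 d d1 d0 where
      x: "c \<in> C" "c1 \<in> C1" "c0 \<in> C0" "c \<otimes> inv c1 \<in> N" "inv c1 \<otimes> c0 \<in> N" "x = c \<otimes> inv c1 \<otimes> c0" and
      y: "d \<in> C" "d1 \<in> C1" "d0 \<in> C0" "d \<otimes> inv d1 \<in> N" "inv d1 \<otimes> d0 \<in> N" "y = d \<otimes> inv d1 \<otimes> d0"
      unfolding mem_twist by blast
    note car = cC[OF x(1)] cC1[OF x(2)] cC0[OF x(3)] cC[OF y(1)] cC1[OF y(2)] cC0[OF y(3)]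
    define u where "u = inv c1 \<otimes> c0"
    define w where "w = d \<otimes> inv d1"
    define k where "k = comm u w"
    have u: "u \<in> N" "u \<in> carrier G" and w: "w \<in> N" "w \<in> carrier G"
      using x y car by (simp_all add: u_def w_def)
    have kM: "k \<in> M" unfolding k_def by (rule comm[OF u(1) w(1)])
    then have k: "k \<in> C" "k \<in> N" "k \<in> carrier G"
      using complementsD(4)[OF C] MN cC by auto
    have uw: "u \<otimes> w = k \<otimes> w \<otimes> u" using u w by (simp add: k_def word_simps)
    have "x \<otimes> y = c \<otimes> (u \<otimes> w) \<otimes> d0"
      using car by (simp add: x y u_def w_def word_simps)
    also have "\<dots> = (c \<otimes> k \<otimes> d) \<otimes> inv (c1 \<otimes> d1) \<otimes> (c0 \<otimes> d0)"
      unfolding uw using car k(3) by (simp add: u_def w_def word_simps)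
    finally have xy: "x \<otimes> y = (c \<otimes> k \<otimes> d) \<otimes> inv (c1 \<otimes> d1) \<otimes> (c0 \<otimes> d0)" .
    have "(c \<otimes> k \<otimes> d) \<otimes> inv (c1 \<otimes> d1) = (c \<otimes> inv c1) \<otimes> (c1 \<otimes> (k \<otimes> w) \<otimes> inv c1)"
      using car k(3) by (simp add: w_def word_simps)
    moreover have "(c \<otimes> inv c1) \<otimes> (c1 \<otimes> (k \<otimes> w) \<otimes> inv c1) \<in> N"
      by (intro subgroup.m_closed[OF Ns] normal_conj(1)[OF N] x k w car)
    ultimately have n1: "(c \<otimes> k \<otimes> d) \<otimes> inv (c1 \<otimes> d1) \<in> N" by simp
    have "inv (c1 \<otimes> d1) \<otimes> (c0 \<otimes> d0) = (inv d1 \<otimes> u \<otimes> d1) \<otimes> (inv d1 \<otimes> d0)"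
      using car by (simp add: u_def word_simps)
    moreover have "(inv d1 \<otimes> u \<otimes> d1) \<otimes> (inv d1 \<otimes> d0) \<in> N"
      by (intro subgroup.m_closed[OF Ns] normal_conj(2)[OF N] u y car)
    ultimately have n2: "inv (c1 \<otimes> d1) \<otimes> (c0 \<otimes> d0) \<in> N" by simp
    have m: "c \<otimes> k \<otimes> d \<in> C" "c1 \<otimes> d1 \<in> C1" "c0 \<otimes> d0 \<in> C0"
      by (intro subgroup.m_closed[OF Cs] subgroup.m_closed[OF C1s] subgroup.m_closed[OF C0s] x y k)+
    show "x \<otimes> y \<in> ?T" unfolding mem_twist using m n1 n2 xy by blast
  qed
  have "?T \<inter> N = M"
  proof (intro equalityI subsetI)
    fix x assume "x \<in> ?T \<inter> N"
    then have "x \<in> ?T" and xN: "x \<in> N" by blast+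
    then obtain c c1 c0 where
      x: "c \<in> C" "c1 \<in> C1" "c0 \<in> C0" "c \<otimes> inv c1 \<in> N" "inv c1 \<otimes> c0 \<in> N" "x = c \<otimes> inv c1 \<otimes> c0" "x \<in> N"
      unfolding mem_twist by blast
    note car = cC[OF x(1)] cC1[OF x(2)] cC0[OF x(3)]
    have 0: "c0 \<in> N"
      using subgroup_mult_mem(1)[OF Ns x(4), of c0] x(6,7) car by simp
    then have "inv c1 \<in> N"
      using subgroup_mult_mem(2)[OF Ns 0, of "inv c1"] x(5) car by simp
    then have 1: "c1 \<in> N" using subgroup.m_inv_closed[OF Ns] car by (metis inv_inv)
    have "c \<in> N" using subgroup_mult_mem(2)[OF Ns \<open>inv c1 \<in> N\<close>, of c] x(4) car by simp
    then have "c \<in> M" "c1 \<in> M" "c0 \<in> M"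
      using 0 1 x complementsD(2)[OF C] complementsD(2)[OF C1] complementsD(2)[OF C0] by blast+
    then show "x \<in> M"
      unfolding x(6) by (intro subgroup.m_closed[OF Ms] subgroup.m_inv_closed[OF Ms])
  next
    fix x assume x: "x \<in> M"
    then have "x \<in> C" "x \<in> N" "x \<in> carrier G" using complementsD(4)[OF C] MN cN by blast+
    then have "x \<in> ?T"
      unfolding mem_twist using subgroup.one_closed[OF C1s]
        subgroup.one_closed[OF C0s] subgroup.one_closed[OF Ns]
      by (intro exI[of _ x] exI[of _ \<one>]) simp
    then show "x \<in> ?T \<inter> N" using \<open>x \<in> N\<close> by blast
  qed
  moreover have "?T <#> N = carrier G"
  proof
    show "?T <#> N \<subseteq> carrier G"
      by (rule subgroup.subset[OF subgroup_set_mult_normal[OF T N]])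
    show "carrier G \<subseteq> ?T <#> N"
    proof
      fix x assume x: "x \<in> carrier G"
      obtain c where c: "c \<in> C" "c \<otimes> inv x \<in> N" "inv x \<otimes> c \<in> N"
        by (rule complement_transversal[OF N C x])
      obtain c1 where c1: "c1 \<in> C1" "c1 \<otimes> inv x \<in> N" "inv x \<otimes> c1 \<in> N"
        by (rule complement_transversal[OF N C1 x])
      obtain c0 where c0: "c0 \<in> C0" "c0 \<otimes> inv x \<in> N" "inv x \<otimes> c0 \<in> N"
        by (rule complement_transversal[OF N C0 x])
      note car = cC[OF c(1)] cC1[OF c1(1)] cC0[OF c0(1)] x
      have "c \<otimes> inv c1 = (c \<otimes> inv x) \<otimes> inv (c1 \<otimes> inv x)"
        using car by (simp add: word_simps)
      moreover have "(c \<otimes> inv x) \<otimes> inv (c1 \<otimes> inv x) \<in> N"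
        by (intro subgroup.m_closed[OF Ns] subgroup.m_inv_closed[OF Ns] c c1)
      ultimately have n1: "c \<otimes> inv c1 \<in> N" by simp
      have "inv c1 \<otimes> c0 = inv (inv x \<otimes> c1) \<otimes> (inv x \<otimes> c0)"
        using car by (simp add: word_simps)
      moreover have "inv (inv x \<otimes> c1) \<otimes> (inv x \<otimes> c0) \<in> N"
        by (intro subgroup.m_closed[OF Ns] subgroup.m_inv_closed[OF Ns] c0 c1)
      ultimately have n2: "inv c1 \<otimes> c0 \<in> N" by simp
      let ?t = "c \<otimes> inv c1 \<otimes> c0"
      have t: "?t \<in> ?T" unfolding mem_twist using c c1 c0 n1 n2 by blast
      have "inv ?t \<otimes> x = inv (inv x \<otimes> c \<otimes> (inv c1 \<otimes> c0))"
        using car by (simp add: word_simps)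
      moreover have "inv (inv x \<otimes> c \<otimes> (inv c1 \<otimes> c0)) \<in> N"
        by (intro subgroup.m_closed[OF Ns] subgroup.m_inv_closed[OF Ns] n2 c)
      ultimately have "inv ?t \<otimes> x \<in> N" by simp
      moreover have "x = ?t \<otimes> (inv ?t \<otimes> x)" using car by simp
      ultimately show "x \<in> ?T <#> N" unfolding mem_set_mult using t by blast
    qed
  qed
  ultimately show ?thesis using T unfolding complements_def by blast
qed

text \<open>For derivations this is (d - d1 + d0) - d0 + d1 = d. The second twist may pick a
  representative from \<open>C0\<close> other than the one used by the first; the two differ by an
  element of \<open>C0 \<inter> N = M\<close>, and such elements do no harm since
  \<open>M \<subseteq> C\<close>.\<close>

lemma twist_twist:
  assumes C: "C \<in> complements M N" and C1: "C1 \<in> complements M N" and C0: "C0 \<in> complements M N"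
  shows "twist N (twist N C C1 C0) C0 C1 = C"
proof (intro equalityI subsetI)
  note Cs = complementsD(1)[OF C] and C1s = complementsD(1)[OF C1] and C0s = complementsD(1)[OF C0]
  note Ns = normal_imp_subgroup[OF N] and Ms = normal_imp_subgroup[OF M]
  note cC = subgroup.mem_carrier[OF Cs] and cC1 = subgroup.mem_carrier[OF C1s]
    and cC0 = subgroup.mem_carrier[OF C0s]
  {
    fix x assume "x \<in> twist N (twist N C C1 C0) C0 C1"
    then obtain t d0 d1 where
      t: "t \<in> twist N C C1 C0" "d0 \<in> C0" "d1 \<in> C1" "t \<otimes> inv d0 \<in> N" "inv d0 \<otimes> d1 \<in> N"
        "x = t \<otimes> inv d0 \<otimes> d1"
      unfolding mem_twist[of x] by blast
    obtain c c1 c0 where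
      c: "c \<in> C" "c1 \<in> C1" "c0 \<in> C0" "c \<otimes> inv c1 \<in> N" "inv c1 \<otimes> c0 \<in> N" "t = c \<otimes> inv c1 \<otimes> c0"
      using t(1) unfolding mem_twist[of t] by blast
    note car = cC[OF c(1)] cC1[OF c(2)] cC0[OF c(3)] cC1[OF t(3)] cC0[OF t(2)]
    define m where "m = c0 \<otimes> inv d0"
    have "m = inv (c \<otimes> inv c1) \<otimes> (t \<otimes> inv d0)"
      using car by (simp add: c(6) m_def word_simps)
    moreover have "inv (c \<otimes> inv c1) \<otimes> (t \<otimes> inv d0) \<in> N"
      by (intro subgroup.m_closed[OF Ns] subgroup.m_inv_closed[OF Ns] c t)
    ultimately have "m \<in> N" by simp
    moreover have "m \<in> C0" unfolding m_def
      by (intro subgroup.m_closed[OF C0s] subgroup.m_inv_closed[OF C0s] c t)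
    ultimately have m: "m \<in> M" using complementsD(2)[OF C0] by blast
    have mc: "m \<in> carrier G" using subgroup.mem_carrier[OF Ms m] .
    have "inv c1 \<otimes> d1 = (inv c1 \<otimes> c0) \<otimes> (inv d0 \<otimes> inv m \<otimes> d0) \<otimes> (inv d0 \<otimes> d1)"
      using car by (simp add: m_def word_simps)
    moreover have "(inv c1 \<otimes> c0) \<otimes> (inv d0 \<otimes> inv m \<otimes> d0) \<otimes> (inv d0 \<otimes> d1) \<in> N"
      by (intro subgroup.m_closed[OF Ns] subgroup.m_inv_closed[OF Ns] normal_conj(2)[OF N] c t
          \<open>m \<in> N\<close> car)
    ultimately have "inv c1 \<otimes> d1 \<in> N" by simp
    moreover have "inv c1 \<otimes> d1 \<in> C1"
      by (intro subgroup.m_closed[OF C1s] subgroup.m_inv_closed[OF C1s] c t)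
    ultimately have n: "inv c1 \<otimes> d1 \<in> M" using complementsD(2)[OF C1] by blast
    have "x = c \<otimes> ((inv c1 \<otimes> m \<otimes> c1) \<otimes> (inv c1 \<otimes> d1))"
      using car by (simp add: t(6) c(6) m_def word_simps)
    moreover have "(inv c1 \<otimes> m \<otimes> c1) \<otimes> (inv c1 \<otimes> d1) \<in> M"
      by (intro subgroup.m_closed[OF Ms] normal_conj(2)[OF M] car m n)
    ultimately show "x \<in> C"
      using complementsD(4)[OF C] subgroup.m_closed[OF Cs c(1)] by blast
  }
  fix c assume c: "c \<in> C"
  obtain c1 where c1: "c1 \<in> C1" "c1 \<otimes> inv c \<in> N" "inv c \<otimes> c1 \<in> N"
    by (rule complement_transversal[OF N C1 cC[OF c]])
  obtain c0 where c0: "c0 \<in> C0" "c0 \<otimes> inv c \<in> N" "inv c \<otimes> c0 \<in> N"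
    by (rule complement_transversal[OF N C0 cC[OF c]])
  note car = cC[OF c] cC1[OF c1(1)] cC0[OF c0(1)]
  have n1: "c \<otimes> inv c1 \<in> N" using subgroup.m_inv_closed[OF Ns c1(2)] car by (simp add: word_simps)
  have n2: "c \<otimes> inv c0 \<in> N" using subgroup.m_inv_closed[OF Ns c0(2)] car by (simp add: word_simps)
  have n3: "inv c1 \<otimes> c0 \<in> N"
    using subgroup.m_closed[OF Ns subgroup.m_inv_closed[OF Ns c1(3)] c0(3)] car
    by (simp add: word_simps)
  have n4: "inv c0 \<otimes> c1 \<in> N"
    using subgroup.m_inv_closed[OF Ns n3] car by (simp add: word_simps)
  define t where "t = c \<otimes> inv c1 \<otimes> c0"
  have t: "t \<in> twist N C C1 C0" unfolding mem_twist t_def using c c1 c0 n1 n3 by blast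
  have "t \<otimes> inv c0 = c \<otimes> inv c1" "c = t \<otimes> inv c0 \<otimes> c1"
    unfolding t_def using car by (simp_all add: word_simps)
  then show "c \<in> twist N (twist N C C1 C0) C0 C1"
    unfolding mem_twist[of c] using t c1(1) c0(1) n1 n4 by metis
qed

text \<open>Count the pairs of a complement \<open>C\<close> and some \<open>v\<close> in
  \<open>N\<close> with \<open>g \<otimes> v \<in> C\<close>. Every \<open>C\<close> occurs
  \<open>card M\<close> times. If a complement \<open>C1\<close> contains
  \<open>g \<otimes> v\<close>, twisting by \<open>C1\<close> and \<open>C0\<close> embeds the
  complements through \<open>g \<otimes> v\<close> into those through \<open>g\<close>, so each
  \<open>v\<close> occurs at most as often as there are complements through
  \<open>g\<close>.\<close>

lemma card_complements_le:
  assumes C0: "C0 \<in> complements M N" and g: "g \<in> C0"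
  shows "card (complements M N) * card M \<le> card N * card {C \<in> complements M N. g \<in> C}"
proof -
  note Ns = normal_imp_subgroup[OF N] and Ms = normal_imp_subgroup[OF M]
  note C0s = complementsD(1)[OF C0]
  have gc: "g \<in> carrier G" using subgroup.mem_carrier[OF C0s g] .
  let ?c = "\<lambda>x. {C \<in> complements M N. x \<in> C}"
  have le: "card (?c (g \<otimes> v)) \<le> card (?c g)" if v: "v \<in> N" for v
  proof (cases "?c (g \<otimes> v) = {}")
    case False
    then obtain C1 where C1: "C1 \<in> complements M N" "g \<otimes> v \<in> C1" by blast
    have vc: "v \<in> carrier G" using subgroup.mem_carrier[OF Ns v] .
    show ?thesis
    proof (rule card_inj_on_le[where f = "\<lambda>C. twist N C C1 C0"])
      show "inj_on (\<lambda>C. twist N C C1 C0) (?c (g \<otimes> v))"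
        by (rule inj_on_inverseI[where g = "\<lambda>T. twist N T C0 C1"])
           (use twist_twist[OF _ C1(1) C0] in blast)
      show "(\<lambda>C. twist N C C1 C0) ` ?c (g \<otimes> v) \<subseteq> ?c g"
      proof
        fix T assume "T \<in> (\<lambda>C. twist N C C1 C0) ` ?c (g \<otimes> v)"
        then obtain C where C: "C \<in> complements M N" "g \<otimes> v \<in> C" "T = twist N C C1 C0" by blast
        have "inv (g \<otimes> v) \<otimes> g = inv v" using gc vc by (simp add: word_simps)
        then have "inv (g \<otimes> v) \<otimes> g \<in> N" using subgroup.m_inv_closed[OF Ns v] by simp
        moreover have "(g \<otimes> v) \<otimes> inv (g \<otimes> v) \<in> N"
          using gc vc subgroup.one_closed[OF Ns] by simp
        moreover have "g = (g \<otimes> v) \<otimes> inv (g \<otimes> v) \<otimes> g" using gc vc by simp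
        ultimately have "g \<in> T" unfolding C(3) mem_twist using C C1 g by blast
        then show "T \<in> ?c g" using twist_complement[OF C(1) C1(1) C0] C(3) by blast
      qed
    qed simp
  next
    case True
    then show ?thesis by (simp only: card.empty)
  qed
  have fib: "card {v \<in> N. g \<otimes> v \<in> C} = card M" if "C \<in> complements M N" for C
    by (rule card_coset_Int_complement[OF N that gc])
  have "card (complements M N) * card M = (\<Sum>C\<in>complements M N. card {v \<in> N. g \<otimes> v \<in> C})"
    using fib by simp
  also have "\<dots> = (\<Sum>C\<in>complements M N. \<Sum>v\<in>N. if g \<otimes> v \<in> C then 1 else 0)"
    using finite_subgroup[OF Ns] by (simp add: sum.If_cases Int_def)
  also have "\<dots> = (\<Sum>v\<in>N. \<Sum>C\<in>complements M N. if g \<otimes> v \<in> C then 1 else 0)"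
    by (rule sum.swap)
  also have "\<dots> = (\<Sum>v\<in>N. card (?c (g \<otimes> v)))"
    by (simp add: sum.If_cases Int_def)
  also have "\<dots> \<le> (\<Sum>v\<in>N. card (?c g))" by (rule sum_mono) (rule le)
  finally show ?thesis by simp
qed

end

end

section \<open>Counting generating tuples\<close>

context finite_group
begin

definition generating_tuples :: "nat set \<Rightarrow> 'a set \<Rightarrow> (nat \<Rightarrow> 'a) set" where
  "generating_tuples I Y =
     {x \<in> I \<rightarrow>\<^sub>E carrier G. generate G (Y \<union> x ` I) = carrier G}"

definition generation_prob :: "nat set \<Rightarrow> 'a set \<Rightarrow> real" where
  "generation_prob I Y = card (generating_tuples I Y) / card (carrier G) ^ card I"

lemma card_carrier_pos: "card (carrier G) > 0"
  using card_subgroup_pos[OF subgroup_self] .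

lemma tuple_image: "x \<in> I \<rightarrow>\<^sub>E carrier G \<Longrightarrow> x ` I \<subseteq> carrier G"
  by auto

lemma generating_tuplesD:
  assumes "x \<in> generating_tuples I Y"
  shows "x \<in> I \<rightarrow>\<^sub>E carrier G" "generate G (Y \<union> x ` I) = carrier G"
  using assms unfolding generating_tuples_def by blast+

lemma generating_tuplesI:
  assumes "x \<in> I \<rightarrow>\<^sub>E carrier G" "generate G (Y \<union> x ` I) = carrier G"
  shows "x \<in> generating_tuples I Y"
  using assms unfolding generating_tuples_def by blast

lemma generate_eq_carrierI:
  assumes "S \<subseteq> carrier G" "\<And>K. subgroup K G \<Longrightarrow> S \<subseteq> K \<Longrightarrow> K = carrier G"
  shows "generate G S = carrier G"
  using assms(2)[OF generate_is_subgroup[OF assms(1)]] generate.incl[of _ S G] by blast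

lemma generate_eq_carrierD:
  assumes "generate G S = carrier G" "subgroup K G" "S \<subseteq> K"
  shows "K = carrier G"
  using generate_subgroup_incl[OF assms(3,2)] assms(1) subgroup.subset[OF assms(2)] by blast

context
  fixes I :: "nat set"
  assumes I [simp]: "finite I"
begin

lemma finite_tuples [simp]: "finite (I \<rightarrow>\<^sub>E carrier G)"
  by (simp add: finite_PiE)

lemma finite_generating_tuples [simp]: "finite (generating_tuples I Y)"
  unfolding generating_tuples_def by simp

lemma generation_prob_bounds: "0 \<le> generation_prob I Y" "generation_prob I Y \<le> 1"
proof -
  show "0 \<le> generation_prob I Y" unfolding generation_prob_def by simp
  have "card (generating_tuples I Y) \<le> card (I \<rightarrow>\<^sub>E carrier G)"
    by (rule card_mono) (auto simp: generating_tuples_def)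
  also have "\<dots> = card (carrier G) ^ card I" by (simp add: card_PiE)
  finally show "generation_prob I Y \<le> 1"
    unfolding generation_prob_def using card_carrier_pos
    by (simp add: divide_le_eq_1 flip: of_nat_power)
qed

text \<open>A tuple that fails to generate together with \<open>Y\<close> lies with \<open>Y\<close>
  in some maximal subgroup, which contains \<open>R\<close> as well.\<close>

lemma generation_prob_cong_frattini:
  assumes R: "R \<subseteq> carrier G" "\<And>L. maximal_subgroup L \<Longrightarrow> R \<subseteq> L" and Y: "Y \<subseteq> carrier G"
  shows "generation_prob I (R \<union> Y) = generation_prob I Y"
proof -
  have "generate G (R \<union> Y \<union> x ` I) = carrier G \<longleftrightarrow> generate G (Y \<union> x ` I) = carrier G"
    (is "?a \<longleftrightarrow> ?b") if x: "x \<in> I \<rightarrow>\<^sub>E carrier G" for x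
  proof
    have s: "Y \<union> x ` I \<subseteq> carrier G" using Y tuple_image[OF x] by blast
    show ?b if a: ?a
    proof (rule ccontr)
      assume "\<not> ?b"
      then obtain L where L: "maximal_subgroup L" "generate G (Y \<union> x ` I) \<subseteq> L"
        using exists_maximal_subgroup[OF generate_is_subgroup[OF s]] by blast
      have "R \<union> Y \<union> x ` I \<subseteq> L"
        using R(2)[OF L(1)] L(2) generate.incl[of _ "Y \<union> x ` I" G] by blast
      then show False
        using generate_eq_carrierD[OF a maximal_subgroupD(1)[OF L(1)]] maximal_subgroupD(2)[OF L(1)]
        by blast
    qed
    show ?a if b: ?b
      by (rule generate_eq_carrierI) (use R(1) s generate_eq_carrierD[OF b] in auto)
  qed
  then have "generating_tuples I (R \<union> Y) = generating_tuples I Y"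
    unfolding generating_tuples_def by blast
  then show ?thesis unfolding generation_prob_def by simp
qed

lemma generation_prob_union_bound:
  assumes Y: "Y \<subseteq> carrier G"
  shows "1 - generation_prob I Y \<le>
    (\<Sum>L | maximal_subgroup L \<and> Y \<subseteq> L. (card L / card (carrier G)) ^ card I)"
proof -
  let ?A = "I \<rightarrow>\<^sub>E carrier G" and ?M = "{L. maximal_subgroup L \<and> Y \<subseteq> L}"
  have fM: "finite ?M" by (rule finite_maximal_subgroups)
  have sub: "?A - generating_tuples I Y \<subseteq> (\<Union>L\<in>?M. I \<rightarrow>\<^sub>E L)"
  proof
    fix x assume x: "x \<in> ?A - generating_tuples I Y"
    have s: "Y \<union> x ` I \<subseteq> carrier G" using Y tuple_image x by blast
    obtain L where L: "maximal_subgroup L" "generate G (Y \<union> x ` I) \<subseteq> L"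
      using exists_maximal_subgroup[OF generate_is_subgroup[OF s]] x
      unfolding generating_tuples_def by blast
    have "Y \<union> x ` I \<subseteq> L" using L(2) generate.incl[of _ "Y \<union> x ` I" G] by blast
    then have "x \<in> I \<rightarrow>\<^sub>E L" "Y \<subseteq> L" using x by (auto simp: PiE_iff)
    then show "x \<in> (\<Union>L\<in>?M. I \<rightarrow>\<^sub>E L)" using L(1) by blast
  qed
  have "card (carrier G) ^ card I = card ?A" by (simp add: card_PiE)
  also have "\<dots> = card (?A - generating_tuples I Y) + card (generating_tuples I Y)"
    using card_Diff_subset[OF finite_generating_tuples, of Y ?A]
      card_mono[OF finite_tuples, of "generating_tuples I Y"] generating_tuplesD(1) by fastforce
  also have "card (?A - generating_tuples I Y) \<le> card (\<Union>L\<in>?M. I \<rightarrow>\<^sub>E L)"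
    by (rule card_mono[OF _ sub])
       (use fM in \<open>auto intro!: finite_PiE finite_subgroup dest: maximal_subgroupD(1)\<close>)
  also have "\<dots> \<le> (\<Sum>L\<in>?M. card (I \<rightarrow>\<^sub>E L))" by (rule card_UN_le[OF fM])
  also have "\<dots> = (\<Sum>L\<in>?M. card L ^ card I)" by (simp add: card_PiE)
  finally have "real (card (carrier G) ^ card I) \<le>
      real ((\<Sum>L\<in>?M. card L ^ card I) + card (generating_tuples I Y))"
    by (simp only: of_nat_le_iff)
  then have "real (card (carrier G) ^ card I) / card (carrier G) ^ card I \<le>
      ((\<Sum>L\<in>?M. real (card L) ^ card I) + card (generating_tuples I Y)) / card (carrier G) ^ card I"
    by (intro divide_right_mono) simp_all
  moreover have "real (card (carrier G) ^ card I) / card (carrier G) ^ card I = 1"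
    using card_carrier_pos by (metis divide_self_if of_nat_eq_0_iff of_nat_power power_not_zero less_irrefl)
  ultimately show ?thesis
    by (simp add: generation_prob_def add_divide_distrib sum_divide_distrib power_divide)
qed

text \<open>Gaschuetz's count: a generating tuple modulo \<open>N\<close> generates modulo \<open>M\<close> unless it
  generates a complement, and each complement meets the \<open>N\<close>-cosets of every tuple equally often.\<close>

lemma card_generating_tuples_complement:
  assumes M: "M \<lhd> G" and N: "N \<lhd> G" and MN: "M \<subseteq> N" and Y: "Y \<subseteq> carrier G"
    and C: "C \<in> complements M N"
  shows "card {x \<in> generating_tuples I (N \<union> Y). x ` I \<subseteq> C} * card N ^ card I =
    card (generating_tuples I (N \<union> Y)) * card M ^ card I"
proof -
  note Ns = normal_imp_subgroup[OF N] and Ms = normal_imp_subgroup[OF M]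
  note Cs = complementsD(1)[OF C]
  note cN = subgroup.mem_carrier[OF Ns] and cC = subgroup.mem_carrier[OF Cs]
    and cM = subgroup.mem_carrier[OF Ms]
  let ?T = "generating_tuples I (N \<union> Y)"
  let ?D = "{x \<in> ?T. x ` I \<subseteq> C}"
  let ?f = "\<lambda>(x, m). \<lambda>i\<in>I. x i \<otimes> inv (m i)"
  have shift: "(\<lambda>i\<in>I. x i \<otimes> m i) \<in> ?T" if x: "x \<in> ?T" and m: "m \<in> I \<rightarrow>\<^sub>E N" for x m
  proof -
    let ?y = "\<lambda>i\<in>I. x i \<otimes> m i"
    have xc: "x i \<in> carrier G" and mN: "m i \<in> N" if "i \<in> I" for i
      using generating_tuplesD(1)[OF x] m that by auto
    have y: "?y \<in> I \<rightarrow>\<^sub>E carrier G" using xc mN cN by auto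
    moreover have "generate G (N \<union> Y \<union> ?y ` I) = carrier G"
    proof (rule generate_eq_carrierI)
      show "N \<union> Y \<union> ?y ` I \<subseteq> carrier G" using cN Y tuple_image[OF y] by blast
      fix K assume K: "subgroup K G" "N \<union> Y \<union> ?y ` I \<subseteq> K"
      have "x i \<in> K" if i: "i \<in> I" for i
      proof -
        have "x i \<otimes> m i \<in> ?y ` I" using i by (intro image_eqI[of _ _ i]) simp_all
        then have "x i \<otimes> m i \<in> K" "m i \<in> K" using K(2) mN[OF i] by blast+
        then show ?thesis using subgroup_mult_mem(2)[OF K(1), of "m i" "x i"] xc[OF i] by simp
      qed
      then have "N \<union> Y \<union> x ` I \<subseteq> K" using K(2) by blast
      then show "K = carrier G"
        by (rule generate_eq_carrierD[OF generating_tuplesD(2)[OF x] K(1)])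
    qed
    ultimately show ?thesis by (rule generating_tuplesI)
  qed
  \<comment> \<open>Pairs of a tuple in \<open>C\<close> and a tuple in \<open>N\<close> map onto
    all of \<open>?T\<close> by division. The fibre over \<open>y\<close> is given by the tuples
    \<open>m\<close> in \<open>N\<close> with \<open>y i \<otimes> m i \<in> C\<close>, and
    \<open>card_coset_Int_complement\<close> leaves \<open>card M\<close> choices for every
    entry.\<close>
  have "card (?D \<times> (I \<rightarrow>\<^sub>E N)) = card ?T * card M ^ card I"
  proof (rule card_eq_fibres[where f = ?f])
    show "finite (?D \<times> (I \<rightarrow>\<^sub>E N))"
      using finite_subgroup[OF Ns] by (simp add: finite_PiE)
    have fib: "{a \<in> ?D \<times> (I \<rightarrow>\<^sub>E N). ?f a = y} =
        (\<lambda>m. (\<lambda>i\<in>I. y i \<otimes> m i, m)) ` (\<Pi>\<^sub>E i\<in>I. {m \<in> N. y i \<otimes> m \<in> C})"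
      if y: "y \<in> ?T" for y
    proof (intro equalityI subsetI)
      have yc: "y \<in> I \<rightarrow>\<^sub>E carrier G" using y by (rule generating_tuplesD)
      {
        fix a assume "a \<in> {a \<in> ?D \<times> (I \<rightarrow>\<^sub>E N). ?f a = y}"
        then obtain x m where a: "a = (x, m)" "x \<in> ?D" "m \<in> I \<rightarrow>\<^sub>E N"
          "(\<lambda>i\<in>I. x i \<otimes> inv (m i)) = y" by auto
        have xE: "x \<in> I \<rightarrow>\<^sub>E carrier G" using a(2) generating_tuplesD(1) by blast
        have yi: "x i = y i \<otimes> m i" if "i \<in> I" for i
        proof -
          have "y i = x i \<otimes> inv (m i)" using a(4) that by (metis restrict_apply')
          moreover have "x i \<in> carrier G" "m i \<in> carrier G" using xE a(3) cN that by auto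
          ultimately show ?thesis by (simp add: word_simps)
        qed
        have "x = (\<lambda>i\<in>I. y i \<otimes> m i)"
          using xE yi by (intro extensionalityI[of _ "I"]) (auto simp: PiE_iff)
        moreover have "m \<in> (\<Pi>\<^sub>E i\<in>I. {m \<in> N. y i \<otimes> m \<in> C})"
        proof -
          have "x i \<in> C" if "i \<in> I" for i using a(2) that by blast
          then have "y i \<otimes> m i \<in> C" if "i \<in> I" for i using yi that by simp
          then show ?thesis using a(3) by (auto simp: PiE_iff)
        qed
        ultimately show "a \<in> (\<lambda>m. (\<lambda>i\<in>I. y i \<otimes> m i, m)) `
            (\<Pi>\<^sub>E i\<in>I. {m \<in> N. y i \<otimes> m \<in> C})"
          unfolding a(1) by blast
      }
      fix a assume "a \<in> (\<lambda>m. (\<lambda>i\<in>I. y i \<otimes> m i, m)) `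
            (\<Pi>\<^sub>E i\<in>I. {m \<in> N. y i \<otimes> m \<in> C})"
      then obtain m where m: "m \<in> (\<Pi>\<^sub>E i\<in>I. {m \<in> N. y i \<otimes> m \<in> C})"
        "a = (\<lambda>i\<in>I. y i \<otimes> m i, m)" by blast
      let ?x = "\<lambda>i\<in>I. y i \<otimes> m i"
      have mi: "m i \<in> N" "y i \<otimes> m i \<in> C" if "i \<in> I" for i using m(1) that by auto
      have mE: "m \<in> I \<rightarrow>\<^sub>E N" using m(1) by (auto simp: PiE_iff)
      have "?x \<in> ?D" using shift[OF y mE] mi by auto
      moreover have "(\<lambda>i\<in>I. ?x i \<otimes> inv (m i)) = y"
      proof (rule extensionalityI[of _ "I"])
        fix i assume i: "i \<in> I"
        have "y i \<in> carrier G" "m i \<in> carrier G" using yc mi i cN by auto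
        then show "(\<lambda>i\<in>I. ?x i \<otimes> inv (m i)) i = y i" using i by (simp add: word_simps)
      qed (use yc in \<open>auto simp: PiE_iff\<close>)
      ultimately show "a \<in> {a \<in> ?D \<times> (I \<rightarrow>\<^sub>E N). ?f a = y}" unfolding m(2) using mE by simp
    qed
    show cardfib: "card {a \<in> ?D \<times> (I \<rightarrow>\<^sub>E N). ?f a = y} = card M ^ card I" if y: "y \<in> ?T" for y
    proof -
      have "y i \<in> carrier G" if "i \<in> I" for i
        using generating_tuplesD(1)[OF y] that by auto
      then have "card (\<Pi>\<^sub>E i\<in>I. {m \<in> N. y i \<otimes> m \<in> C}) = card M ^ card I"
        by (simp add: card_PiE card_coset_Int_complement[OF N C])
      then show ?thesis unfolding fib[OF y] by (subst card_image) (auto intro!: inj_onI)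
    qed
    show "?f ` (?D \<times> (I \<rightarrow>\<^sub>E N)) = ?T"
    proof (intro equalityI subsetI)
      fix y assume "y \<in> ?f ` (?D \<times> (I \<rightarrow>\<^sub>E N))"
      then obtain x m where y: "y = (\<lambda>i\<in>I. x i \<otimes> inv (m i))" and x: "x \<in> ?T" and m: "m \<in> I \<rightarrow>\<^sub>E N" by auto
      have "(\<lambda>i\<in>I. inv (m i)) \<in> I \<rightarrow>\<^sub>E N"
        using m subgroup.m_inv_closed[OF Ns] by (auto simp: PiE_iff)
      from shift[OF x this] have "(\<lambda>i\<in>I. x i \<otimes> (\<lambda>i\<in>I. inv (m i)) i) \<in> ?T" .
      moreover have "(\<lambda>i\<in>I. x i \<otimes> (\<lambda>i\<in>I. inv (m i)) i) = y"
        unfolding y by (rule restrict_ext) simp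
      ultimately show "y \<in> ?T" by simp
    next
      fix y assume y: "y \<in> ?T"
      \<comment> \<open>Surjectivity is read off from the fibre size: a fibre with a positive number
        of elements is not empty.\<close>
      have "card M ^ card I > 0" using card_subgroup_pos[OF Ms] by simp
      then have "card {a \<in> ?D \<times> (I \<rightarrow>\<^sub>E N). ?f a = y} \<noteq> 0" using cardfib[OF y] by simp
      then have "{a \<in> ?D \<times> (I \<rightarrow>\<^sub>E N). ?f a = y} \<noteq> {}" by (metis card.empty)
      then show "y \<in> ?f ` (?D \<times> (I \<rightarrow>\<^sub>E N))" by blast
    qed
  qed
  then show ?thesis by (simp add: card_cartesian_product card_PiE)
qed

lemma generation_prob_chief:
  assumes M: "M \<lhd> G" and N: "N \<lhd> G" and MN: "M \<subset> N" and Y: "Y \<subseteq> carrier G"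
    and comm: "\<And>u v. u \<in> N \<Longrightarrow> v \<in> N \<Longrightarrow> comm u v \<in> M"
    and chief: "\<And>K. K \<lhd> G \<Longrightarrow> M \<subseteq> K \<Longrightarrow> K \<subseteq> N \<Longrightarrow> K = M \<or> K = N"
  shows "generation_prob I (M \<union> Y) = generation_prob I (N \<union> Y) *
    (1 - card {C \<in> complements M N. Y \<subseteq> C} * (card M / card N) ^ card I)"
proof -
  note Ns = normal_imp_subgroup[OF N] and Ms = normal_imp_subgroup[OF M]
  note cN = subgroup.mem_carrier[OF Ns] and cM = subgroup.mem_carrier[OF Ms]
  let ?K = "{C \<in> complements M N. Y \<subseteq> C}"
  let ?T = "generating_tuples I (N \<union> Y)" and ?S = "generating_tuples I (M \<union> Y)"
  let ?D = "\<lambda>C. {x \<in> ?T. x ` I \<subseteq> C}"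
  \<comment> \<open>This makes the sets \<open>?D C\<close> disjoint: a common tuple would, with
    \<open>M\<close> and \<open>Y\<close>, generate a complement contained in two others, hence
    equal to both.\<close>
  have C_eq: "C = C'" if C: "C \<in> complements M N" and C': "C' \<in> complements M N" and "C \<subseteq> C'" for C C'
  proof (intro equalityI subsetI)
    fix x assume x: "x \<in> C'"
    note C's = complementsD(1)[OF C']
    have xc: "x \<in> carrier G" using subgroup.mem_carrier[OF C's x] .
    obtain c where c: "c \<in> C" "c \<otimes> inv x \<in> N" "inv x \<otimes> c \<in> N"
      by (rule complement_transversal[OF N C xc])
    have "inv x \<otimes> c \<in> C'"
      using subgroup.m_closed[OF C's subgroup.m_inv_closed[OF C's x], of c] c(1) that by blast
    then have "inv x \<otimes> c \<in> C"
      using c(3) complementsD(2)[OF C'] complementsD(4)[OF C] by blast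
    then have "inv (inv x \<otimes> c) \<in> C" using subgroup.m_inv_closed[OF complementsD(1)[OF C]] by blast
    then have "c \<otimes> inv (inv x \<otimes> c) \<in> C" using subgroup.m_closed[OF complementsD(1)[OF C] c(1)] by blast
    moreover have "c \<otimes> inv (inv x \<otimes> c) = x"
      using xc subgroup.mem_carrier[OF complementsD(1)[OF C] c(1)] by (simp add: word_simps)
    ultimately show "x \<in> C" by simp
  qed (use that in blast)
  have gen: "generate G (M \<union> Y \<union> x ` I) \<in> complements M N"
    if x: "x \<in> ?T" and ns: "generate G (M \<union> Y \<union> x ` I) \<noteq> carrier G" for x
  proof -
    let ?C = "generate G (M \<union> Y \<union> x ` I)"
    have sub: "M \<union> Y \<union> x ` I \<subseteq> carrier G"
      using cM Y tuple_image[OF generating_tuplesD(1)[OF x]] by blast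
    have Cs: "subgroup ?C G" by (rule generate_is_subgroup[OF sub])
    have inC: "M \<subseteq> ?C" "Y \<subseteq> ?C" "x ` I \<subseteq> ?C"
      using generate.incl[of _ "M \<union> Y \<union> x ` I" G] by blast+
    have gT: "generate G (N \<union> Y \<union> x ` I) = carrier G"
      using x by (rule generating_tuplesD)
    have CN: "?C <#> N = carrier G"
      by (rule generate_eq_carrierD[OF gT subgroup_set_mult_normal[OF Cs N]])
         (use subset_set_mult[OF Cs Ns] inC in blast)
    \<comment> \<open>The subgroup \<open>?C\<close> normalizes its intersection with
      \<open>N\<close>, and \<open>N\<close> does so because \<open>N / M\<close> is abelian and
      \<open>M \<subseteq> ?C\<close>; together they give the whole group. By \<open>chief\<close>
      the intersection is then \<open>M\<close> or \<open>N\<close>.\<close>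
    have "?C \<inter> N \<lhd> G"
    proof (rule normal_invI)
      show "subgroup (?C \<inter> N) G" by (rule subgroups_Inter_pair[OF Cs Ns])
      fix z h assume z: "z \<in> carrier G" and h: "h \<in> ?C \<inter> N"
      obtain c n where cn: "c \<in> ?C" "n \<in> N" "z = c \<otimes> n" using z unfolding CN[symmetric] mem_set_mult by blast
      have car: "c \<in> carrier G" "n \<in> carrier G" "h \<in> carrier G"
        using cn h cN subgroup.mem_carrier[OF Cs] by blast+
      have "comm n h \<in> ?C" using comm[of n h] cn(2) h inC(1) by blast
      then have "comm n h \<otimes> h \<in> ?C"
        by (rule subgroup.m_closed[OF Cs]) (use h in blast)
      then have "n \<otimes> h \<otimes> inv n \<in> ?C" using car by (simp add: word_simps)
      then have "c \<otimes> (n \<otimes> h \<otimes> inv n) \<otimes> inv c \<in> ?C"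
        by (rule subgroup.m_closed[OF Cs subgroup.m_closed[OF Cs cn(1)] subgroup.m_inv_closed[OF Cs cn(1)]])
      moreover have "c \<otimes> (n \<otimes> h \<otimes> inv n) \<otimes> inv c = z \<otimes> h \<otimes> inv z"
        using car by (simp add: cn(3) word_simps)
      ultimately show "z \<otimes> h \<otimes> inv z \<in> ?C \<inter> N" using normal_conj(1)[OF N z, of h] h by simp
    qed
    then consider "?C \<inter> N = M" | "?C \<inter> N = N" using chief[of "?C \<inter> N"] inC MN by blast
    then have "?C \<inter> N = M"
    proof cases
      case 2
      then have "N \<union> Y \<union> x ` I \<subseteq> ?C" using inC by blast
      then show ?thesis using generate_eq_carrierD[OF gT Cs] ns by blast
    qed
    then show ?thesis unfolding complements_def using Cs CN by blast
  qed
  have subTS: "?S \<subseteq> ?T"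
  proof
    fix x assume x: "x \<in> ?S"
    then have xc: "x \<in> I \<rightarrow>\<^sub>E carrier G" and g: "generate G (M \<union> Y \<union> x ` I) = carrier G"
      unfolding generating_tuples_def by blast+
    have "generate G (N \<union> Y \<union> x ` I) = carrier G"
    proof (rule generate_eq_carrierI)
      show "N \<union> Y \<union> x ` I \<subseteq> carrier G" using tuple_image[OF xc] cN Y by blast
      fix K assume K: "subgroup K G" "N \<union> Y \<union> x ` I \<subseteq> K"
      show "K = carrier G" by (rule generate_eq_carrierD[OF g K(1)]) (use K(2) MN in blast)
    qed
    then show "x \<in> ?T" using xc unfolding generating_tuples_def by blast
  qed
  have diff: "?T - ?S = (\<Union>C\<in>?K. ?D C)"
  proof (intro equalityI subsetI)
    fix x assume x: "x \<in> ?T - ?S"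
    then have "generate G (M \<union> Y \<union> x ` I) \<in> complements M N"
      by (intro gen) (auto simp: generating_tuples_def)
    moreover have "Y \<subseteq> generate G (M \<union> Y \<union> x ` I)" "x ` I \<subseteq> generate G (M \<union> Y \<union> x ` I)"
      using generate.incl[of _ "M \<union> Y \<union> x ` I" G] by blast+
    ultimately show "x \<in> (\<Union>C\<in>?K. ?D C)" using x by blast
  next
    fix x assume "x \<in> (\<Union>C\<in>?K. ?D C)"
    then obtain C where C: "C \<in> complements M N" "Y \<subseteq> C" "x \<in> ?T" "x ` I \<subseteq> C" by blast
    have "C \<noteq> carrier G" using complementsD(2)[OF C(1)] MN cN by blast
    then have "generate G (M \<union> Y \<union> x ` I) \<noteq> carrier G"
      using generate_eq_carrierD[OF _ complementsD(1)[OF C(1)]] complementsD(4)[OF C(1)] C by blast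
    then show "x \<in> ?T - ?S" using C(3) unfolding generating_tuples_def by blast
  qed
  have neC: "C \<noteq> carrier G" if C: "C \<in> complements M N" for C
    using complementsD(2)[OF C] MN cN by blast
  have disj: "?D C \<inter> ?D C' = {}" if C: "C \<in> ?K" and C': "C' \<in> ?K" and ne: "C \<noteq> C'" for C C'
  proof (rule ccontr)
    assume "?D C \<inter> ?D C' \<noteq> {}"
    then obtain x where x: "x \<in> ?D C" "x \<in> ?D C'" by blast
    let ?g = "generate G (M \<union> Y \<union> x ` I)"
    have sub: "?g \<subseteq> B" if B: "B \<in> ?K" "x \<in> ?D B" for B
    proof (rule generate_subgroup_incl)
      have Bc: "B \<in> complements M N" using B(1) by blast
      show "subgroup B G" "M \<union> Y \<union> x ` I \<subseteq> B"
        using complementsD(1,4)[OF Bc] B by blast+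
    qed
    have Cc: "C \<in> complements M N" "C' \<in> complements M N" using C C' by blast+
    have "?g \<noteq> carrier G"
      using sub[OF C x(1)] neC[OF Cc(1)] subgroup.subset[OF complementsD(1)[OF Cc(1)]] by blast
    then have g: "?g \<in> complements M N" using gen x(1) by blast
    have "?g = C" "?g = C'"
      using C_eq[OF g Cc(1) sub[OF C x(1)]] C_eq[OF g Cc(2) sub[OF C' x(2)]] by simp_all
    then show False using ne by simp
  qed
  have "card (?T - ?S) = (\<Sum>C\<in>?K. card (?D C))"
    unfolding diff by (rule card_UN_disjoint) (use disj in auto)
  then have "real (card (?T - ?S)) = (\<Sum>C\<in>?K. real (card (?D C)))" by simp
  moreover have "real (card (?T - ?S)) = real (card ?T) - card ?S"
    using card_Diff_subset[OF finite_generating_tuples subTS] card_mono[OF finite_generating_tuples subTS]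
    by (simp add: of_nat_diff)
  ultimately have "real (card ?T) - card ?S = (\<Sum>C\<in>?K. real (card (?D C)))" by simp
  also have "\<dots> = (\<Sum>C\<in>?K. card ?T * (card M / card N) ^ card I)"
  proof (rule sum.cong[OF refl])
    fix C assume "C \<in> ?K"
    then have "card (?D C) * card N ^ card I = card ?T * card M ^ card I"
      using card_generating_tuples_complement[OF M N _ Y, of C] MN by blast
    then have "real (card (?D C) * card N ^ card I) = real (card ?T * card M ^ card I)" by (simp only:)
    then have "real (card (?D C)) * real (card N) ^ card I = real (card ?T) * real (card M) ^ card I"
      by (simp only: of_nat_mult of_nat_power)
    moreover have "real (card N) ^ card I \<noteq> 0" using card_subgroup_pos[OF Ns] by simp
    ultimately have "real (card (?D C)) = real (card ?T) * real (card M) ^ card I / real (card N) ^ card I"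
      by (simp only: nonzero_eq_divide_eq not_False_eq_True)
    then show "real (card (?D C)) = card ?T * (card M / card N) ^ card I"
      by (simp only: power_divide times_divide_eq_right)
  qed
  finally have d: "real (card ?T) - card ?S = card ?K * (card ?T * (card M / card N) ^ card I)"
    by (simp only: sum_constant)
  have aux: "s = t * (1 - k * p)" if "t - s = k * (t * p)" for s t k p :: real
    using that by (simp add: algebra_simps)
  have "real (card ?S) = card ?T * (1 - card ?K * (card M / card N) ^ card I)"
    by (rule aux[OF d])
  then show ?thesis by (simp only: generation_prob_def times_divide_eq_left)
qed

end

end

section \<open>The derived subgroup modulo the Frattini subgroup\<close>

text \<open>The intended \<open>R\<close> is the intersection of \<open>A\<close> with the Frattini subgroup; the axioms make
  \<open>A / R\<close> a semisimple module over the abelian group \<open>G / A\<close> without trivial constituents.\<close>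

locale frattini_section = finite_group +
  fixes A R :: "'a set"
  assumes A_eq: "A = derived G (carrier G)"
    and R: "R \<lhd> G" and RA: "R \<subseteq> A"
    and comm_R: "\<And>x y. x \<in> A \<Longrightarrow> y \<in> A \<Longrightarrow> comm x y \<in> R"
    and R_maximal: "\<And>L. maximal_subgroup L \<Longrightarrow> R \<subseteq> L"
    and maximal_Int_normal: "\<And>L. maximal_subgroup L \<Longrightarrow> \<not> A \<subseteq> L \<Longrightarrow> L \<inter> A \<lhd> G"
    and maximal_separates: "\<And>T. T \<subseteq> A \<Longrightarrow> \<not> T \<subseteq> R \<Longrightarrow> \<exists>L. maximal_subgroup L \<and> \<not> T \<subseteq> L"
begin

lemma A: "A \<lhd> G"
  unfolding A_eq by (rule derived_self_is_normal)

lemma As: "subgroup A G" and Rs: "subgroup R G"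
  using A R normal_imp_subgroup by blast+

lemma A_carrier: "a \<in> A \<Longrightarrow> a \<in> carrier G"
  using subgroup.mem_carrier[OF As] .

lemma R_carrier: "a \<in> R \<Longrightarrow> a \<in> carrier G"
  using subgroup.mem_carrier[OF Rs] .

lemma comm_A:
  assumes "x \<in> carrier G" "y \<in> carrier G"
  shows "comm x y \<in> A"
  unfolding A_eq derived_def using assms by (intro generate.incl) blast

text \<open>Absence of trivial constituents. If all these commutators were in \<open>L\<close>, then
  \<open>A\<close>, and hence \<open>G = L A\<close>, would normalize \<open>L\<close>, and
  expanding \<open>comm x y\<close> along \<open>G = L A\<close> would place it in \<open>L\<close>.
  So \<open>L\<close> would contain the derived subgroup, which is \<open>A\<close>.\<close>

lemma maximal_noncentral:
  assumes L: "maximal_subgroup L" and AL: "\<not> A \<subseteq> L"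
  shows "\<exists>x\<in>carrier G. \<exists>a\<in>A. comm x a \<notin> L"
proof (rule ccontr)
  assume neg: "\<not> (\<exists>x\<in>carrier G. \<exists>a\<in>A. comm x a \<notin> L)"
  note Ls = maximal_subgroupD(1)[OF L]
  note cL = subgroup.mem_carrier[OF Ls]
  have LA: "L <#> A = carrier G" by (rule maximal_set_mult[OF L A AL])
  have conj: "z \<otimes> h \<otimes> inv z \<in> L" if z: "z \<in> carrier G" and h: "h \<in> L" for z h
  proof -
    obtain l a where la: "l \<in> L" "a \<in> A" "z = l \<otimes> a"
      using z unfolding LA[symmetric] mem_set_mult by blast
    note car = cL[OF la(1)] A_carrier[OF la(2)] cL[OF h]
    have "comm h a \<in> L" using neg la car by blast
    then have "inv (comm h a) \<otimes> h \<in> L"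
      by (rule subgroup.m_closed[OF Ls subgroup.m_inv_closed[OF Ls] h])
    then have "l \<otimes> (inv (comm h a) \<otimes> h) \<otimes> inv l \<in> L"
      by (rule subgroup.m_closed[OF Ls subgroup.m_closed[OF Ls la(1)] subgroup.m_inv_closed[OF Ls la(1)]])
    then show ?thesis using car by (simp add: la(3) word_simps)
  qed
  have "comm x y \<in> L" if x: "x \<in> carrier G" and y: "y \<in> carrier G" for x y
  proof -
    obtain l a where la: "l \<in> L" "a \<in> A" "x = l \<otimes> a"
      using x unfolding LA[symmetric] mem_set_mult by blast
    obtain k b where kb: "k \<in> L" "b \<in> A" "y = k \<otimes> b"
      using y unfolding LA[symmetric] mem_set_mult by blast
    note car = cL[OF la(1)] A_carrier[OF la(2)] cL[OF kb(1)] A_carrier[OF kb(2)]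
    let ?r = "comm a b"
    have r: "?r \<in> L" using comm_R[OF la(2) kb(2)] R_maximal[OF L] by blast
    have "comm x y =
        l \<otimes> (a \<otimes> k \<otimes> inv a) \<otimes> ?r \<otimes> (b \<otimes> inv l \<otimes> inv b) \<otimes> inv k"
      using car by (simp add: la(3) kb(3) word_simps)
    also have "\<dots> \<in> L"
      by (rule subgroup.m_closed[OF Ls subgroup.m_closed[OF Ls subgroup.m_closed[OF Ls
            subgroup.m_closed[OF Ls la(1) conj[OF car(2) kb(1)]] r]
            conj[OF car(4) subgroup.m_inv_closed[OF Ls la(1)]]] subgroup.m_inv_closed[OF Ls kb(1)]])
    finally show ?thesis .
  qed
  then have "A \<subseteq> L"
    unfolding A_eq derived_def by (intro generate_subgroup_incl[OF _ Ls]) blast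
  then show False using AL by blast
qed

text \<open>A minimal normal supplement \<open>V\<close> of \<open>U\<close> in \<open>A\<close> is
  a complement. Otherwise \<open>U \<inter> V\<close> escapes some maximal \<open>L\<close>, and
  \<open>V \<inter> (L \<inter> A)\<close> is a smaller supplement, normal by
  \<open>maximal_Int_normal\<close>.\<close>

lemma semisimple:
  assumes U: "U \<lhd> G" "R \<subseteq> U" "U \<subseteq> A"
  obtains V where "V \<lhd> G" "R \<subseteq> V" "V \<subseteq> A" "U <#> V = A" "U \<inter> V = R"
proof -
  note Us = normal_imp_subgroup[OF U(1)]
  let ?F = "{V. V \<lhd> G \<and> R \<subseteq> V \<and> V \<subseteq> A \<and> U <#> V = A}"
  have fF: "finite ?F"
    by (rule finite_subset[of _ "Pow A"]) (use finite_subgroup[OF As] in auto)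
  have "U <#> A = A"
    using set_mult_subset[OF As U(3) subset_refl] subset_set_mult(2)[OF Us As] by blast
  then have "A \<in> ?F" using A RA by blast
  then have nF: "?F \<noteq> {}" by blast
  obtain V where V: "V \<in> ?F" and min: "\<forall>W\<in>?F. W \<subseteq> V \<longrightarrow> V = W"
    by (rule bexE[OF finite_has_minimal[OF fF nF]]) (rule that)
  have Vn: "V \<lhd> G" and RV: "R \<subseteq> V" and VA: "V \<subseteq> A" and UV: "U <#> V = A" using V by blast+
  note Vs = normal_imp_subgroup[OF Vn]
  have "U \<inter> V \<subseteq> R"
  proof (rule ccontr)
    assume "\<not> U \<inter> V \<subseteq> R"
    then obtain L where L: "maximal_subgroup L" "\<not> U \<inter> V \<subseteq> L"
      using maximal_separates[of "U \<inter> V"] U(3) by blast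
    note Ls = maximal_subgroupD(1)[OF L(1)]
    have T: "U \<inter> V \<lhd> G" by (rule normal_Int[OF U(1) Vn])
    have LT: "L <#> (U \<inter> V) = carrier G" by (rule maximal_set_mult[OF L(1) T L(2)])
    have "V \<inter> (L \<inter> A) \<lhd> G"
      using L(2) U(3) by (intro normal_Int[OF Vn] maximal_Int_normal[OF L(1)]) blast
    moreover have "R \<subseteq> V \<inter> (L \<inter> A)" using RV RA R_maximal[OF L(1)] by blast
    moreover have "U <#> (V \<inter> (L \<inter> A)) = A"
    proof
      show "U <#> (V \<inter> (L \<inter> A)) \<subseteq> A" by (rule set_mult_subset[OF As U(3)]) blast
      show "A \<subseteq> U <#> (V \<inter> (L \<inter> A))"
      proof
        fix b assume "b \<in> A"
        then obtain u v where b: "u \<in> U" "v \<in> V" "b = u \<otimes> v" unfolding UV[symmetric] mem_set_mult by blast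
        have vc: "v \<in> carrier G" using subgroup.mem_carrier[OF Vs b(2)] .
        then obtain l t where v: "l \<in> L" "t \<in> U \<inter> V" "v = l \<otimes> t"
          unfolding LT[symmetric] mem_set_mult by blast
        note car = subgroup.mem_carrier[OF Us b(1)] subgroup.mem_carrier[OF Ls v(1)]
          subgroup.mem_carrier[OF Us, of t]
        have t: "t \<in> U" "t \<in> V" "t \<in> carrier G" using v(2) car by blast+
        have "l \<in> V" using subgroup_mult_mem(2)[OF Vs t(2) car(2)] b(2) v(3) by simp
        then have l: "l \<in> V \<inter> (L \<inter> A)" using v(1) VA by blast
        have "b = (u \<otimes> (l \<otimes> t \<otimes> inv l)) \<otimes> l"
          using car t by (simp add: b(3) v(3) word_simps)
        moreover have "u \<otimes> (l \<otimes> t \<otimes> inv l) \<in> U"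
          by (rule subgroup.m_closed[OF Us b(1) normal_conj(1)[OF U(1) car(2) t(1)]])
        ultimately show "b \<in> U <#> (V \<inter> (L \<inter> A))" unfolding mem_set_mult using l by blast
      qed
    qed
    ultimately have "V \<inter> (L \<inter> A) \<in> ?F" by blast
    from mp[OF bspec[OF min this] Int_lower1] have "V = V \<inter> (L \<inter> A)" .
    then show False using L(2) by blast
  qed
  then have "U \<inter> V = R" using U(2) RV by blast
  then show ?thesis using that[OF Vn RV VA UV] by blast
qed

text \<open>The argument of \<open>semisimple\<close> for supplements of \<open>A\<close> in
  \<open>G\<close>, which are only subgroups. To apply \<open>maximal_set_mult\<close> it is enough
  that \<open>H \<inter> A\<close> is normal: \<open>H\<close> normalizes it, and \<open>A\<close>
  does because \<open>A / R\<close> is abelian and \<open>R \<subseteq> H\<close>.\<close>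

lemma complement_of_A:
  obtains H where "subgroup H G" "R \<subseteq> H" "H <#> A = carrier G" "H \<inter> A = R"
proof -
  let ?F = "{H. subgroup H G \<and> R \<subseteq> H \<and> H <#> A = carrier G}"
  have fF: "finite ?F"
    by (rule finite_subset[of _ "Pow (carrier G)"]) (auto dest: subgroup.subset)
  have "carrier G <#> A = carrier G"
    using set_mult_subset[OF subgroup_self, of "carrier G" A] subset_set_mult(1)[OF subgroup_self As]
      A_carrier by blast
  then have "carrier G \<in> ?F" using R_carrier subgroup_self by blast
  then have nF: "?F \<noteq> {}" by blast
  obtain H where H: "H \<in> ?F" and min: "\<forall>K\<in>?F. K \<subseteq> H \<longrightarrow> H = K"
    by (rule bexE[OF finite_has_minimal[OF fF nF]]) (rule that)
  have Hs: "subgroup H G" and RH: "R \<subseteq> H" and HA: "H <#> A = carrier G" using H by blast+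
  note cH = subgroup.mem_carrier[OF Hs]
  have T: "H \<inter> A \<lhd> G"
  proof (rule normal_invI)
    show "subgroup (H \<inter> A) G" by (rule subgroups_Inter_pair[OF Hs As])
    fix z s assume z: "z \<in> carrier G" and s: "s \<in> H \<inter> A"
    then obtain h b where hb: "h \<in> H" "b \<in> A" "z = h \<otimes> b" unfolding HA[symmetric] mem_set_mult by blast
    have sc: "s \<in> H" "s \<in> A" "s \<in> carrier G" using s cH by blast+
    note car = cH[OF hb(1)] A_carrier[OF hb(2)]
    have "comm b s \<in> H" using comm_R[OF hb(2) sc(2)] RH by blast
    then have "comm b s \<otimes> s \<in> H" by (rule subgroup.m_closed[OF Hs _ sc(1)])
    then have "h \<otimes> (comm b s \<otimes> s) \<otimes> inv h \<in> H"
      by (rule subgroup.m_closed[OF Hs subgroup.m_closed[OF Hs hb(1)] subgroup.m_inv_closed[OF Hs hb(1)]])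
    then have "z \<otimes> s \<otimes> inv z \<in> H" using car sc by (simp add: hb(3) word_simps)
    then show "z \<otimes> s \<otimes> inv z \<in> H \<inter> A" using normal_conj(1)[OF A z sc(2)] by blast
  qed
  have "H \<inter> A \<subseteq> R"
  proof (rule ccontr)
    assume "\<not> H \<inter> A \<subseteq> R"
    then obtain L where L: "maximal_subgroup L" "\<not> H \<inter> A \<subseteq> L"
      using maximal_separates[of "H \<inter> A"] by blast
    note Ls = maximal_subgroupD(1)[OF L(1)]
    have LT: "L <#> (H \<inter> A) = carrier G" by (rule maximal_set_mult[OF L(1) T L(2)])
    have s: "subgroup (L \<inter> H) G" by (rule subgroups_Inter_pair[OF Ls Hs])
    have "(L \<inter> H) <#> A = carrier G"
    proof
      show "(L \<inter> H) <#> A \<subseteq> carrier G"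
        by (rule subgroup.subset[OF subgroup_set_mult_normal[OF s A]])
      show "carrier G \<subseteq> (L \<inter> H) <#> A"
      proof
        fix z assume "z \<in> carrier G"
        then obtain h b where z: "h \<in> H" "b \<in> A" "z = h \<otimes> b"
          unfolding HA[symmetric] mem_set_mult by blast
        obtain l t where h: "l \<in> L" "t \<in> H \<inter> A" "h = l \<otimes> t"
          using cH[OF z(1)] unfolding LT[symmetric] mem_set_mult by blast
        have t: "t \<in> H" "t \<in> A" "t \<in> carrier G" using h(2) cH by blast+
        have lc: "l \<in> carrier G" using subgroup.mem_carrier[OF Ls h(1)] .
        have "l \<in> L \<inter> H" using subgroup_mult_mem(2)[OF Hs t(1) lc] z(1) h by simp
        moreover have "t \<otimes> b \<in> A" by (rule subgroup.m_closed[OF As t(2) z(2)])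
        moreover have "z = l \<otimes> (t \<otimes> b)" using lc t A_carrier[OF z(2)] by (simp add: z(3) h(3) word_simps)
        ultimately show "z \<in> (L \<inter> H) <#> A" unfolding mem_set_mult by blast
      qed
    qed
    then have "L \<inter> H \<in> ?F" using s RH R_maximal[OF L(1)] by blast
    from mp[OF bspec[OF min this] Int_lower2] have "H = L \<inter> H" .
    then show False using L(2) by blast
  qed
  then have "H \<inter> A = R" using RH RA by blast
  then show ?thesis using that[OF Hs RH HA] by blast
qed

text \<open>For \<open>a\<close> in \<open>A\<close> this is the full preimage of the submodule of
  \<open>A / R\<close> generated by \<open>a\<close>.\<close>

definition closure_mod :: "'a \<Rightarrow> 'a set" where
  "closure_mod a = generate G (R \<union> (\<lambda>x. x \<otimes> a \<otimes> inv x) ` carrier G)"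

lemma closure_mod:
  assumes a: "a \<in> A"
  shows "closure_mod a \<lhd> G" "R \<subseteq> closure_mod a" "closure_mod a \<subseteq> A" "a \<in> closure_mod a"
proof -
  let ?S = "R \<union> (\<lambda>x. x \<otimes> a \<otimes> inv x) ` carrier G"
  have ac: "a \<in> carrier G" by (rule A_carrier[OF a])
  have S: "?S \<subseteq> A" using RA normal_conj(1)[OF A _ a] by blast
  show "closure_mod a \<lhd> G" unfolding closure_mod_def
  proof (rule normal_generateI)
    show "?S \<subseteq> carrier G" using S A_carrier by blast
    fix h z assume h: "h \<in> ?S" and z: "z \<in> carrier G"
    from h show "z \<otimes> h \<otimes> inv z \<in> ?S"
    proof
      assume "h \<in> R"
      then show ?thesis using normal_conj(1)[OF R z] by blast
    next
      assume "h \<in> (\<lambda>x. x \<otimes> a \<otimes> inv x) ` carrier G"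
      then obtain x where x: "x \<in> carrier G" "h = x \<otimes> a \<otimes> inv x" by blast
      then have "z \<otimes> h \<otimes> inv z = (z \<otimes> x) \<otimes> a \<otimes> inv (z \<otimes> x)" using z ac by (simp add: word_simps)
      then show ?thesis using z x(1) by blast
    qed
  qed
  show "R \<subseteq> closure_mod a" unfolding closure_mod_def using generate.incl[of _ ?S G] by blast
  show "closure_mod a \<subseteq> A" unfolding closure_mod_def by (rule generate_subgroup_incl[OF S As])
  have "\<one> \<otimes> a \<otimes> inv \<one> \<in> ?S" by blast
  then have "a \<in> ?S" using ac by simp
  then show "a \<in> closure_mod a" unfolding closure_mod_def by (rule generate.incl)
qed

text \<open>Here \<open>g = h a\<close> with \<open>h\<close> in a complement \<open>H\<close> of \<open>A\<close>, so \<open>g\<close> lies in \<open>H B\<close> for the submodule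
  \<open>B = closure_mod a\<close> generated by \<open>a\<close>, and \<open>E\<close> complements \<open>B\<close> in \<open>A\<close>.\<close>

lemma exists_avoiding_subgroup:
  assumes g: "g \<in> carrier G"
  obtains E a where "E \<lhd> G" "R \<subseteq> E" "E \<subseteq> A" "a \<in> A" "closure_mod a <#> E = A"
    "\<And>M N. M \<lhd> G \<Longrightarrow> N \<lhd> G \<Longrightarrow> R \<subseteq> M \<Longrightarrow> M \<subseteq> N \<Longrightarrow> N \<subseteq> E \<Longrightarrow> \<exists>C\<in>complements M N. g \<in> C"
proof -
  obtain H where H: "subgroup H G" "R \<subseteq> H" "H <#> A = carrier G" "H \<inter> A = R"
    by (rule complement_of_A)
  obtain h a where ha: "h \<in> H" "a \<in> A" "g = h \<otimes> a"
    using g unfolding H(3)[symmetric] mem_set_mult by blast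
  let ?B = "closure_mod a"
  note B = closure_mod[OF ha(2)]
  note Bs = normal_imp_subgroup[OF B(1)]
  obtain E where E: "E \<lhd> G" "R \<subseteq> E" "E \<subseteq> A" "?B <#> E = A" "?B \<inter> E = R"
    by (rule semisimple[OF B(1-3)])
  have "\<exists>C\<in>complements M N. g \<in> C"
    if M: "M \<lhd> G" and N: "N \<lhd> G" and RM: "R \<subseteq> M" and MN: "M \<subseteq> N" and NE: "N \<subseteq> E" for M N
  proof -
    note Ms = normal_imp_subgroup[OF M] and Ns = normal_imp_subgroup[OF N]
    let ?BN = "?B <#> N" and ?BM = "?B <#> M"
    have BN: "?BN \<lhd> G" and BM: "?BM \<lhd> G" using normal_set_mult[OF B(1)] M N by blast+
    note BNs = normal_imp_subgroup[OF BN] and BMs = normal_imp_subgroup[OF BM]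
    have BNA: "?BN \<subseteq> A" using set_mult_subset[OF As B(3)] NE E(3) by blast
    \<comment> \<open>\<open>A / R\<close> is the direct sum of the images of \<open>?B\<close>,
      \<open>N\<close> and \<open>T\<close>, where \<open>?B \<inter> N = R\<close> because
      \<open>N \<subseteq> E\<close>. Shrinking the middle summand to \<open>M\<close> gives
      \<open>S\<close>, with \<open>S \<inter> N = M\<close> and \<open>S <#> N = A\<close>. Then
      \<open>H <#> S\<close> is the complement, and it contains both \<open>h\<close> and
      \<open>a\<close>.\<close>
    obtain T where T: "T \<lhd> G" "R \<subseteq> T" "T \<subseteq> A" "?BN <#> T = A" "?BN \<inter> T = R"
      by (rule semisimple[OF BN _ BNA]) (use B(2) subset_set_mult(1)[OF Bs Ns] in blast)
    note Ts = normal_imp_subgroup[OF T(1)]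
    define S where "S = ?BM <#> T"
    have S: "S \<lhd> G" unfolding S_def by (rule normal_set_mult[OF BM T(1)])
    note Ss = normal_imp_subgroup[OF S]
    have subS: "?BM \<subseteq> S" "T \<subseteq> S" unfolding S_def using subset_set_mult[OF BMs Ts] by blast+
    have subBM: "?B \<subseteq> ?BM" "M \<subseteq> ?BM" using subset_set_mult[OF Bs Ms] by blast+
    have BM_BN: "?BM \<subseteq> ?BN" using MN unfolding set_mult_def by blast
    have SA: "S \<subseteq> A" unfolding S_def using set_mult_subset[OF As _ T(3)] BM_BN BNA by blast
    have BM_N: "?BM \<inter> N \<subseteq> M"
    proof
      fix x assume x: "x \<in> ?BM \<inter> N"
      then have "x \<in> ?BM" by blast
      then obtain b m where bm: "b \<in> ?B" "m \<in> M" "x = b \<otimes> m" unfolding mem_set_mult by blast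
      have "b \<in> N" using subgroup_mult_mem(2)[OF Ns, of m b] bm x MN subgroup.mem_carrier[OF Bs] by auto
      then have "b \<in> M" using bm(1) NE E(5) RM by blast
      then show "x \<in> M" unfolding bm(3) using bm(2) by (rule subgroup.m_closed[OF Ms])
    qed
    have SN: "S \<inter> N \<subseteq> M"
    proof
      fix x assume x: "x \<in> S \<inter> N"
      then have "x \<in> S" by blast
      then obtain q t where qt: "q \<in> ?BM" "t \<in> T" "x = q \<otimes> t"
        unfolding S_def mem_set_mult[of x ?BM] by blast
      have "q \<in> ?BN" "x \<in> ?BN" using qt(1) BM_BN x subset_set_mult(2)[OF Bs Ns] by blast+
      then have "t \<in> ?BN"
        using subgroup_mult_mem(1)[OF BNs, of q t] qt subgroup.mem_carrier[OF Ts] by simp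
      then have "t \<in> R" using qt(2) T(5) by blast
      then have "t \<in> ?BM" using RM subBM by blast
      then have "x \<in> ?BM" unfolding qt(3) using qt(1) by (intro subgroup.m_closed[OF BMs])
      then show "x \<in> M" using x BM_N by blast
    qed
    have SN_A: "A \<subseteq> S <#> N"
    proof -
      have sSN: "subgroup (S <#> N) G" by (rule subgroup_set_mult_normal[OF Ss N])
      have sub: "S \<subseteq> S <#> N" "N \<subseteq> S <#> N" using subset_set_mult[OF Ss Ns] by blast+
      have "?B \<subseteq> S <#> N" using subBM(1) subS(1) sub(1) by blast
      then have 1: "?BN \<subseteq> S <#> N" by (rule set_mult_subset[OF sSN _ sub(2)])
      have 2: "T \<subseteq> S <#> N" using subS(2) sub(1) by blast
      show ?thesis using set_mult_subset[OF sSN 1 2] T(4) by simp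
    qed
    let ?C = "H <#> S"
    have C: "subgroup ?C G" by (rule subgroup_set_mult_normal[OF H(1) S])
    have HC: "H \<subseteq> ?C" "S \<subseteq> ?C" using subset_set_mult[OF H(1) Ss] by blast+
    have "?C \<inter> N = M"
    proof
      show "M \<subseteq> ?C \<inter> N" using MN subBM subS HC by blast
      show "?C \<inter> N \<subseteq> M"
      proof
        fix x assume x: "x \<in> ?C \<inter> N"
        then have "x \<in> ?C" by blast
        then obtain k s where ks: "k \<in> H" "s \<in> S" "x = k \<otimes> s" unfolding mem_set_mult by blast
        have "x \<in> A" using x NE E(3) by blast
        then have "k \<in> A"
          using subgroup_mult_mem(2)[OF As, of s k] ks SA subgroup.mem_carrier[OF H(1)] by auto
        then have "k \<in> S" using ks(1) H(4) RM subBM subS by blast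
        then have "x \<in> S" unfolding ks(3) using ks(2) by (rule subgroup.m_closed[OF Ss])
        then show "x \<in> M" using x SN by blast
      qed
    qed
    moreover have "?C <#> N = carrier G"
    proof
      have sCN: "subgroup (?C <#> N) G" by (rule subgroup_set_mult_normal[OF C N])
      show "?C <#> N \<subseteq> carrier G" by (rule subgroup.subset[OF sCN])
      have sub: "?C \<subseteq> ?C <#> N" "N \<subseteq> ?C <#> N" using subset_set_mult[OF C Ns] by blast+
      have "S \<subseteq> ?C <#> N" using HC(2) sub(1) by blast
      then have "S <#> N \<subseteq> ?C <#> N" by (rule set_mult_subset[OF sCN _ sub(2)])
      then have "A \<subseteq> ?C <#> N" using SN_A by blast
      moreover have "H \<subseteq> ?C <#> N" using HC sub by blast
      ultimately show "carrier G \<subseteq> ?C <#> N"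
        using set_mult_subset[OF sCN, of H A] H(3) by simp
    qed
    moreover have "g \<in> ?C" unfolding ha(3)
    proof (rule subgroup.m_closed[OF C])
      show "h \<in> ?C" using ha(1) HC(1) by blast
      show "a \<in> ?C" using B(4) subBM(1) subS(1) HC(2) by blast
    qed
    ultimately show ?thesis using C unfolding complements_def by blast
  qed
  then show ?thesis using that[OF E(1-3) ha(2) E(4)] by blast
qed

text \<open>The induction proves a comparison of ratios, cross-multiplied because the probabilities
  at \<open>E\<close> may vanish. With \<open>n = card I\<close>, each chief factor multiplies the
  left side by \<open>1 - cg * r ^ n\<close> and the right side by \<open>1 - c * r ^ Suc n\<close>,
  which is no smaller: the additional element of \<open>J\<close> supplies exactly the factor
  \<open>r\<close> in \<open>c * r \<le> cg\<close>.\<close>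

lemma generation_prob_comparison:
  assumes g: "g \<in> carrier G" and E: "E \<lhd> G" "R \<subseteq> E" "E \<subseteq> A"
    and compl: "\<And>M N. M \<lhd> G \<Longrightarrow> N \<lhd> G \<Longrightarrow> R \<subseteq> M \<Longrightarrow> M \<subseteq> N \<Longrightarrow> N \<subseteq> E \<Longrightarrow> \<exists>C\<in>complements M N. g \<in> C"
    and I: "finite I" and J: "finite J" "card J = Suc (card I)"
  shows "generation_prob I {g} \<le> generation_prob J {} + (1 - generation_prob J E)"
proof -
  let ?P = "generation_prob I" and ?Q = "generation_prob J"
  have main: "?P (M \<union> {g}) * ?Q (E \<union> {}) \<le> ?Q (M \<union> {}) * ?P (E \<union> {g})"
    if "M \<lhd> G" "R \<subseteq> M" "M \<subseteq> E" for M
    using that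
  proof (induction "card E - card M" arbitrary: M rule: less_induct)
    case less
    note M = less.prems
    note Ms = normal_imp_subgroup[OF M(1)] and Es = normal_imp_subgroup[OF E(1)]
    show ?case
    proof (cases "M = E")
      case False
      let ?F = "{N. N \<lhd> G \<and> M \<subset> N \<and> N \<subseteq> E}"
      have fF: "finite ?F"
        by (rule finite_subset[of _ "Pow E"]) (use finite_subgroup[OF Es] in auto)
      have "E \<in> ?F" using E M False by blast
      then have nF: "?F \<noteq> {}" by blast
      obtain N where N: "N \<in> ?F" and min: "\<forall>K\<in>?F. K \<subseteq> N \<longrightarrow> N = K"
        by (rule bexE[OF finite_has_minimal[OF fF nF]]) (rule that)
      have Nn: "N \<lhd> G" and MN: "M \<subset> N" and NE: "N \<subseteq> E" using N by blast+
      note Ns = normal_imp_subgroup[OF Nn]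
      have comm: "comm u v \<in> M" if "u \<in> N" "v \<in> N" for u v
        using comm_R[of u v] that NE E(3) M(2) by blast
      have chief: "K = M \<or> K = N" if "K \<lhd> G" "M \<subseteq> K" "K \<subseteq> N" for K
        using min that NE by blast
      obtain C0 where C0: "C0 \<in> complements M N" "g \<in> C0"
        using compl[OF M(1) Nn M(2) _ NE] MN by blast
      define c where "c = real (card (complements M N))"
      define cg where "cg = real (card {C \<in> complements M N. {g} \<subseteq> C})"
      define r where "r = real (card M) / real (card N)"
      have r: "r > 0" unfolding r_def using card_subgroup_pos[OF Ms] card_subgroup_pos[OF Ns] by simp
      have "card (complements M N) * card M \<le> card N * card {C \<in> complements M N. g \<in> C}"
        using card_complements_le[OF M(1) Nn _ comm C0] MN by blast
      then have "real (card (complements M N) * card M) \<le> real (card N * card {C \<in> complements M N. g \<in> C})"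
        by (simp only: of_nat_le_iff)
      then have "c * card M \<le> card N * cg" unfolding c_def cg_def by simp
      then have cr: "c * r \<le> cg"
        unfolding r_def using card_subgroup_pos[OF Ns] by (simp add: field_simps)
      have P: "?P (M \<union> {g}) = ?P (N \<union> {g}) * (1 - cg * r ^ card I)"
        unfolding cg_def r_def
        by (rule generation_prob_chief[OF I M(1) Nn MN _ comm chief]) (use g in blast)+
      have Q: "?Q (M \<union> {}) = ?Q (N \<union> {}) * (1 - c * r ^ Suc (card I))"
        using generation_prob_chief[OF J(1) M(1) Nn MN _ comm chief, of "{}"]
        unfolding c_def r_def J(2) by simp
      have "c * r ^ Suc (card I) \<le> cg * r ^ card I"
        using mult_right_mono[OF cr, of "r ^ card I"] r by (simp add: mult_ac)
      then have le: "1 - cg * r ^ card I \<le> 1 - c * r ^ Suc (card I)" by simp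
      have "card E - card N < card E - card M"
        using psubset_card_mono[OF finite_subgroup[OF Ns] MN] card_mono[OF finite_subgroup[OF Es] NE] by simp
      then have IH: "?P (N \<union> {g}) * ?Q (E \<union> {}) \<le> ?Q (N \<union> {}) * ?P (E \<union> {g})"
        by (rule less.hyps) (use Nn MN M(2) NE in blast)+
      note nonneg = generation_prob_bounds(1)[OF I] generation_prob_bounds(1)[OF J(1)]
      show ?thesis
      proof (cases "1 - cg * r ^ card I \<ge> 0")
        case True
        have "?P (M \<union> {g}) * ?Q (E \<union> {}) = (?P (N \<union> {g}) * ?Q (E \<union> {})) * (1 - cg * r ^ card I)"
          unfolding P by (simp only: mult_ac)
        also have "\<dots> \<le> (?Q (N \<union> {}) * ?P (E \<union> {g})) * (1 - c * r ^ Suc (card I))"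
          by (rule mult_mono[OF IH le]) (use nonneg True in simp_all)
        also have "\<dots> = ?Q (M \<union> {}) * ?P (E \<union> {g})" unfolding Q by (simp only: mult_ac)
        finally show ?thesis .
      next
        case False
        \<comment> \<open>With a negative factor the inequalities can no longer be multiplied, but
          the probability, being nonnegative, is then zero.\<close>
        have "?P (M \<union> {g}) \<le> 0"
          unfolding P using False nonneg(1)[of "N \<union> {g}"] by (intro mult_nonneg_nonpos) simp_all
        then have "?P (M \<union> {g}) = 0" using nonneg(1)[of "M \<union> {g}"] by (rule antisym)
        then show ?thesis using nonneg by simp
      qed
    qed (simp add: mult.commute)
  qed
  have Rc: "R \<subseteq> carrier G" using R_carrier by blast
  from main[OF R subset_refl E(2)]
  have "?P {g} * ?Q E \<le> ?Q {} * ?P (E \<union> {g})"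
    using generation_prob_cong_frattini[OF I Rc R_maximal, of "{g}"]
      generation_prob_cong_frattini[OF J(1) Rc R_maximal, of "{}"] g by simp
  also have "\<dots> \<le> ?Q {}"
    using mult_left_mono[OF generation_prob_bounds(2)[OF I, of "E \<union> {g}"]
        generation_prob_bounds(1)[OF J(1), of "{}"]] by simp
  finally have "?P {g} * ?Q E \<le> ?Q {}" .
  \<comment> \<open>Division by \<open>?Q E\<close> is avoided by splitting \<open>?P {g}\<close>
    into its parts with weights \<open>?Q E\<close> and \<open>1 - ?Q E\<close>.\<close>
  moreover have "?P {g} * (1 - ?Q E) \<le> 1 * (1 - ?Q E)"
    by (rule mult_right_mono[OF generation_prob_bounds(2)[OF I]])
       (use generation_prob_bounds(2)[OF J(1), of E] in simp)
  ultimately show ?thesis by (simp add: right_diff_distrib)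
qed

end

section \<open>Counting maximal subgroups\<close>

context finite_group
begin

lemma generate_mono_subset: "S \<subseteq> carrier G \<Longrightarrow> S \<subseteq> generate G S"
  using generate.incl[of _ S G] by blast

text \<open>Since \<open>b\<close> normalizes \<open>U\<close>, the products of an element of
  \<open>U\<close> and a power of \<open>b\<close> form a subgroup, and
  \<open>b [^] m \<in> U\<close> lets every exponent be reduced modulo \<open>m\<close>.\<close>

lemma card_generate_insert_le:
  assumes U: "subgroup U G" and b: "b \<in> carrier G"
    and norm: "\<And>u. u \<in> U \<Longrightarrow> b \<otimes> u \<otimes> inv b \<in> U"
    and bm: "b [^] m \<in> U" and m: "m \<ge> (1::nat)"
  shows "card (generate G (insert b U)) \<le> m * card U"
proof -
  note cU = subgroup.mem_carrier[OF U]
  let ?W = "{u \<otimes> b [^] i | u i. u \<in> U \<and> i \<in> (UNIV :: nat set)}"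
  have pow_norm: "b [^] i \<otimes> u \<otimes> inv (b [^] i) \<in> U" if "u \<in> U" for u and i :: nat
  proof (induction i)
    case 0 then show ?case using that cU[OF that] by simp
  next
    case (Suc i)
    have "b [^] Suc i = b \<otimes> b [^] i" using b nat_pow_Suc2 by blast
    then have "b [^] Suc i \<otimes> u \<otimes> inv (b [^] Suc i) = b \<otimes> (b [^] i \<otimes> u \<otimes> inv (b [^] i)) \<otimes> inv b"
      using b cU[OF that] by (simp add: word_simps)
    then show ?case using norm[OF Suc] by simp
  qed
  have W: "subgroup ?W G"
  proof (rule subgroup_of_mult_closed)
    show "?W \<subseteq> carrier G" using cU b by auto
    show "?W \<noteq> {}" using subgroup.one_closed[OF U] by blast
    fix x y assume "x \<in> ?W" "y \<in> ?W"
    then obtain u i v j where x: "u \<in> U" "x = u \<otimes> b [^] (i::nat)" and y: "v \<in> U" "y = v \<otimes> b [^] (j::nat)"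
      by blast
    have "x \<otimes> y = (u \<otimes> (b [^] i \<otimes> v \<otimes> inv (b [^] i))) \<otimes> b [^] (i + j)"
      using cU[OF x(1)] cU[OF y(1)] b by (simp add: x y word_simps flip: nat_pow_mult)
    moreover have "u \<otimes> (b [^] i \<otimes> v \<otimes> inv (b [^] i)) \<in> U"
      by (rule subgroup.m_closed[OF U x(1) pow_norm[OF y(1)]])
    ultimately show "x \<otimes> y \<in> ?W" by blast
  qed
  have "u \<in> ?W" if "u \<in> U" for u
  proof -
    have "u = u \<otimes> b [^] (0::nat)" using cU[OF that] by simp
    then show ?thesis using that by blast
  qed
  moreover have "b \<in> ?W"
  proof -
    have "b = \<one> \<otimes> b [^] (1::nat)" using b by simp
    then show ?thesis using subgroup.one_closed[OF U] by blast
  qed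
  ultimately have "generate G (insert b U) \<subseteq> ?W"
    by (intro generate_subgroup_incl[OF _ W]) blast
  also have "?W \<subseteq> (\<lambda>(u, i). u \<otimes> b [^] i) ` (U \<times> {..<m})"
  proof
    fix x assume "x \<in> ?W"
    then obtain u i where x: "u \<in> U" "x = u \<otimes> b [^] (i::nat)" by blast
    let ?v = "(b [^] m) [^] (i div m)"
    have "(b [^] m) [^] j \<in> U" for j :: nat
      using subgroup.one_closed[OF U] subgroup.m_closed[OF U _ bm] by (induction j) simp_all
    then have v: "?v \<in> U" .
    have "b [^] i = b [^] (m * (i div m) + i mod m)" by simp
    also have "\<dots> = ?v \<otimes> b [^] (i mod m)"
      using b by (simp only: nat_pow_mult[symmetric] nat_pow_pow)
    finally have "x = (u \<otimes> ?v) \<otimes> b [^] (i mod m)"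
      using x cU[OF x(1)] cU[OF v] b by (simp add: m_assoc)
    moreover have "(u \<otimes> ?v, i mod m) \<in> U \<times> {..<m}"
      using subgroup.m_closed[OF U x(1) v] m by simp
    ultimately show "x \<in> (\<lambda>(u, i). u \<otimes> b [^] i) ` (U \<times> {..<m})"
      by (intro image_eqI[of _ _ "(u \<otimes> ?v, i mod m)"]) simp_all
  qed
  finally have sub: "generate G (insert b U) \<subseteq> (\<lambda>(u, i). u \<otimes> b [^] i) ` (U \<times> {..<m})" .
  have fin: "finite (U \<times> {..<m})" using finite_subgroup[OF U] by simp
  have "card (generate G (insert b U)) \<le> card ((\<lambda>(u, i). u \<otimes> b [^] i) ` (U \<times> {..<m}))"
    by (rule card_mono[OF finite_imageI[OF fin] sub])
  also have "\<dots> \<le> card (U \<times> {..<m})" by (rule card_image_le[OF fin])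
  finally show ?thesis by (simp add: card_cartesian_product mult.commute)
qed

text \<open>Used twice in \<open>card_chief_quotients_le\<close>: with \<open>K\<close> the whole
  group, for the index of a centralizer, and with \<open>K = A\<close>, for the index of an
  intersection of submodules.\<close>

lemma card_generate_Un_le:
  assumes U: "subgroup U G" and K: "subgroup K G" and UK: "U \<subseteq> K"
    and F: "finite F" "F \<subseteq> K"
    and comm: "\<And>b x. b \<in> K \<Longrightarrow> x \<in> K \<Longrightarrow> comm b x \<in> U"
    and pow: "\<And>b. b \<in> F \<Longrightarrow> b [^] m \<in> U" and m: "m \<ge> (1::nat)"
  shows "card (generate G (U \<union> F)) \<le> m ^ card F * card U"
  using F pow
proof (induction F)
  case empty
  have "generate G (U \<union> {}) \<subseteq> U" by (rule generate_subgroup_incl[OF _ U]) simp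
  then show ?case using card_mono[OF finite_subgroup[OF U]] by simp
next
  case (insert b F)
  note cK = subgroup.mem_carrier[OF K]
  let ?V = "generate G (U \<union> F)"
  have sub: "U \<union> F \<subseteq> carrier G" using UK insert.prems cK by blast
  have V: "subgroup ?V G" by (rule generate_is_subgroup[OF sub])
  have UV: "U \<subseteq> ?V" "F \<subseteq> ?V" using generate.incl[of _ "U \<union> F" G] by blast+
  have VK: "?V \<subseteq> K" by (rule generate_subgroup_incl[OF _ K]) (use UK insert.prems in blast)
  have b: "b \<in> K" "b \<in> carrier G" using insert.prems cK by blast+
  have Vb: "subgroup (generate G (insert b ?V)) G"
    by (rule generate_is_subgroup) (use b VK cK in blast)
  have inc: "insert b ?V \<subseteq> generate G (insert b ?V)" using generate.incl[of _ "insert b ?V" G] by blast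
  have "generate G (U \<union> insert b F) \<subseteq> generate G (insert b ?V)"
    by (rule generate_subgroup_incl[OF _ Vb]) (use inc UV in blast)
  then have "card (generate G (U \<union> insert b F)) \<le> card (generate G (insert b ?V))"
    by (rule card_mono[OF finite_subgroup[OF Vb]])
  also have "\<dots> \<le> m * card ?V"
  proof (rule card_generate_insert_le[OF V b(2) _ _ m])
    show "b [^] m \<in> ?V" using insert.prems UV by blast
    fix u assume u: "u \<in> ?V"
    have uc: "u \<in> carrier G" using subgroup.mem_carrier[OF V u] .
    have "comm b u \<in> ?V" using comm[OF b(1), of u] u VK UV by blast
    then have "comm b u \<otimes> u \<in> ?V" using u by (rule subgroup.m_closed[OF V])
    then show "b \<otimes> u \<otimes> inv b \<in> ?V" using b uc by (simp add: word_simps)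
  qed
  also have "\<dots> \<le> m * (m ^ card F * card U)"
    using insert by (intro mult_left_mono) simp_all
  finally show ?case using insert.hyps by (simp add: mult.assoc)
qed

lemma pow_index_mem:
  assumes N: "N \<lhd> G" and x: "x \<in> carrier G" and k: "card (carrier G) = k * card N"
  shows "x [^] k \<in> N"
proof -
  interpret N: normal N G by (rule N)
  interpret Q: group "G Mod N" by (rule N.factorgroup_is_group)
  have "card (rcosets N) * card N = k * card N"
    using lagrange[OF N.subgroup_axioms] k by (simp add: Coset.order_def)
  then have o: "Coset.order (G Mod N) = k"
    using card_subgroup_pos[OF N.subgroup_axioms] by (simp add: Coset.order_def FactGroup_def)
  have "N #> x [^] k = (N #> x) [^]\<^bsub>G Mod N\<^esub> k"
    using N.FactGroup_pow[OF x] x by simp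
  also have "\<dots> = N"
    using Q.pow_order_eq_1[of "N #> x"] x o by (simp add: carrier_FactGroup)
  finally show ?thesis using x by (metis nat_pow_closed rcos_self N.subgroup_axioms)
qed

lemma pow_index_mem_subgroup:
  assumes N: "N \<lhd> G" and H: "subgroup H G" "N \<subseteq> H" and x: "x \<in> H" and k: "card H = k * card N"
  shows "x [^] k \<in> N"
proof -
  let ?H = "G\<lparr>carrier := H\<rparr>"
  interpret H: finite_group ?H
    by (rule finite_group.intro[OF subgroup_imp_group[OF H(1)]])
       (simp add: finite_group_axioms_def finite_subgroup[OF H(1)])
  have "N \<lhd> ?H" by (rule normal_restrict_supergroup[OF H(1) N H(2)])
  then have "x [^]\<^bsub>?H\<^esub> k \<in> N" using H.pow_index_mem[of N x k] x k by simp
  then show ?thesis using nat_pow_consistent by simp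
qed

end

context frattini_section
begin

lemma normal_of_superset:
  assumes K: "subgroup K G" "A \<subseteq> K"
  shows "K \<lhd> G"
proof (rule normal_invI[OF K(1)])
  fix z h assume z: "z \<in> carrier G" and h: "h \<in> K"
  have hc: "h \<in> carrier G" using subgroup.mem_carrier[OF K(1) h] .
  have "comm z h \<in> K" using comm_A[OF z hc] K(2) by blast
  then have "comm z h \<otimes> h \<in> K" using h by (rule subgroup.m_closed[OF K(1)])
  then show "z \<otimes> h \<otimes> inv z \<in> K" using z hc by (simp add: word_simps)
qed

text \<open>The index \<open>k\<close> is the order of \<open>t\<close> modulo \<open>L\<close>: if
  \<open>t [^] r \<in> L\<close> with \<open>0 < r < k\<close>, then \<open>L\<close> and
  \<open>t\<close> would generate at most \<open>r * card L\<close> elements, but by maximality they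
  generate \<open>G\<close>.\<close>

lemma pow_mem_maximal_iff:
  assumes L: "maximal_subgroup L" "A \<subseteq> L" and k: "card (carrier G) = k * card L"
    and t: "t \<in> carrier G" "t \<notin> L"
  shows "t [^] (e::nat) \<in> L \<longleftrightarrow> k dvd e"
proof -
  note Ls = maximal_subgroupD(1)[OF L(1)]
  have Ln: "L \<lhd> G" by (rule normal_of_superset[OF Ls L(2)])
  have tk: "t [^] k \<in> L" by (rule pow_index_mem[OF Ln t(1) k])
  have k0: "k > 0" using k card_carrier_pos by (cases k) simp_all
  have mult: "(t [^] k) [^] q \<in> L" for q :: nat
    using subgroup.one_closed[OF Ls] subgroup.m_closed[OF Ls _ tk] by (induction q) simp_all
  show ?thesis
  proof
    assume "k dvd e"
    then obtain q where "e = k * q" by blast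
    then show "t [^] e \<in> L" using mult[of q] t(1) by (simp add: nat_pow_pow)
  next
    assume e: "t [^] e \<in> L"
    show "k dvd e"
    proof (rule ccontr)
      assume nd: "\<not> k dvd e"
      let ?r = "e mod k"
      have r: "?r \<ge> 1" "?r < k" using nd k0 by (auto simp: dvd_eq_mod_eq_0 Suc_le_eq)
      have "t [^] e = t [^] (k * (e div k) + ?r)" by simp
      also have "\<dots> = (t [^] k) [^] (e div k) \<otimes> t [^] ?r"
        using t(1) by (simp only: nat_pow_mult[symmetric] nat_pow_pow)
      finally have "(t [^] k) [^] (e div k) \<otimes> t [^] ?r \<in> L" using e by simp
      then have tr: "t [^] ?r \<in> L"
        using subgroup_mult_mem(1)[OF Ls mult[of "e div k"], of "t [^] ?r"] t(1) by simp
      have sub: "insert t L \<subseteq> carrier G" using t(1) subgroup.subset[OF Ls] by blast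
      have "generate G (insert t L) = carrier G"
        by (rule maximal_subgroupD(3)[OF L(1) generate_is_subgroup[OF sub]])
           (use generate.incl[of _ "insert t L" G] t(2) in blast)+
      then have "card (carrier G) \<le> ?r * card L"
        using card_generate_insert_le[OF Ls t(1) _ tr r(1)] normal_conj(1)[OF Ln t(1)] by simp
      then have "k * card L \<le> ?r * card L" using k by simp
      then show False using r card_subgroup_pos[OF Ls] by simp
    qed
  qed
qed

text \<open>By \<open>pow_mem_maximal_iff\<close> the products \<open>l \<otimes> t [^] e\<close>
  with \<open>l\<close> in \<open>L\<close> and \<open>e < k\<close> are distinct, so they exhaust
  the group.\<close>

lemma coset_pow_maximal:
  assumes L: "maximal_subgroup L" "A \<subseteq> L" and k: "card (carrier G) = k * card L"
    and t: "t \<in> carrier G" "t \<notin> L" and x: "x \<in> carrier G"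
  shows "\<exists>e<k. x \<otimes> inv (t [^] (e::nat)) \<in> L"
proof -
  note Ls = maximal_subgroupD(1)[OF L(1)]
  note cL = subgroup.mem_carrier[OF Ls]
  have k0: "k > 0" using k card_carrier_pos by (cases k) simp_all
  have inj: "inj_on (\<lambda>(l, e). l \<otimes> t [^] e) (L \<times> {..<k})"
  proof (rule inj_onI)
    have aux: "e = e'" if "l \<in> L" "l' \<in> L" "l \<otimes> t [^] e = l' \<otimes> t [^] e'" "e \<le> e'" "e' < k"
      for l l' and e e' :: nat
    proof -
      have c: "l \<in> carrier G" "l' \<in> carrier G" using that cL by blast+
      have "t [^] e' = t [^] (e' - e) \<otimes> t [^] e" using that t(1) by (simp add: nat_pow_mult)
      then have "l \<otimes> t [^] e = (l' \<otimes> t [^] (e' - e)) \<otimes> t [^] e"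
        using that(3) c t(1) by (simp add: m_assoc)
      then have "l = l' \<otimes> t [^] (e' - e)"
        using c t(1) by (simp only: right_cancel nat_pow_closed m_closed)
      then have "t [^] (e' - e) \<in> L"
        using subgroup_mult_mem(1)[OF Ls that(2), of "t [^] (e' - e)"] that(1) t(1) by simp
      then have "k dvd e' - e" using pow_mem_maximal_iff[OF L k t] by simp
      moreover have "e' - e < k" using that by simp
      ultimately have "e' - e = 0" using nat_dvd_not_less by blast
      then show ?thesis using that by simp
    qed
    fix p p' assume "p \<in> L \<times> {..<k}" "p' \<in> L \<times> {..<k}"
      "(case p of (l, e) \<Rightarrow> l \<otimes> t [^] e) = (case p' of (l, e) \<Rightarrow> l \<otimes> t [^] e)"
    then obtain l e l' e' where p: "p = (l, e)" "p' = (l', e')" "l \<in> L" "l' \<in> L" "e < k" "e' < k"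
      "l \<otimes> t [^] e = l' \<otimes> t [^] e'" by auto
    have "e = e'"
      using aux[OF p(3,4,7) _ p(6)] aux[OF p(4,3) p(7)[symmetric] _ p(5)] by (cases "e \<le> e'") simp_all
    moreover have "l \<in> carrier G" "l' \<in> carrier G" using p cL by blast+
    ultimately show "p = p'" using p t(1) by simp
  qed
  let ?f = "\<lambda>(l, e). l \<otimes> t [^] (e::nat)"
  have "card (?f ` (L \<times> {..<k})) = card (carrier G)"
    using card_image[OF inj] k by (simp add: card_cartesian_product mult.commute)
  moreover have "?f ` (L \<times> {..<k}) \<subseteq> carrier G" using cL t(1) by auto
  ultimately have "?f ` (L \<times> {..<k}) = carrier G" using card_subset_eq[OF fin] by blast
  then have "x \<in> ?f ` (L \<times> {..<k})" using x by simp
  then obtain p where p: "p \<in> L \<times> {..<k}" "x = ?f p" by blast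
  obtain l e where le: "p = (l, e)" by (cases p)
  have l: "l \<in> L" "e < k" "x = l \<otimes> t [^] e" using p le by simp_all
  then have "x \<otimes> inv (t [^] e) = l" using cL[OF l(1)] t(1) by (simp add: word_simps)
  then show ?thesis using l by blast
qed

text \<open>Such an \<open>L\<close> is the kernel of a homomorphism to the integers modulo
  \<open>k\<close> that sends a chosen \<open>t L\<close> outside \<open>L\<close> to 1. The
  homomorphism is determined by its values \<open>e L y\<close> on the generators, so
  \<open>L\<close> is determined by the restriction of \<open>e L\<close> to
  \<open>Y\<close>.\<close>

lemma card_maximal_superset_le:
  assumes Y: "finite Y" "Y \<subseteq> carrier G" "generate G Y = carrier G"
  shows "card {L. maximal_subgroup L \<and> A \<subseteq> L \<and> card (carrier G) = k * card L} \<le> k ^ card Y"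
proof -
  let ?M = "{L. maximal_subgroup L \<and> A \<subseteq> L \<and> card (carrier G) = k * card L}"
  have "\<forall>L\<in>?M. \<exists>t. t \<in> carrier G \<and> t \<notin> L"
    using maximal_subgroupD(1,2) subgroup.subset by blast
  from bchoice[OF this] obtain t where tb: "\<forall>L\<in>?M. t L \<in> carrier G \<and> t L \<notin> L" by (rule exE)
  have t: "t L \<in> carrier G" "t L \<notin> L" if "L \<in> ?M" for L using bspec[OF tb that] by blast+
  have "\<forall>p\<in>?M \<times> Y. \<exists>e<k. snd p \<otimes> inv (t (fst p) [^] (e::nat)) \<in> fst p"
  proof
    fix p assume p: "p \<in> ?M \<times> Y"
    then have L: "fst p \<in> ?M" and y: "snd p \<in> carrier G" using Y(2) by auto
    have "maximal_subgroup (fst p)" "A \<subseteq> fst p" "card (carrier G) = k * card (fst p)" using L by blast+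
    then show "\<exists>e<k. snd p \<otimes> inv (t (fst p) [^] (e::nat)) \<in> fst p"
      by (rule coset_pow_maximal[OF _ _ _ t[OF L] y])
  qed
  from bchoice[OF this] obtain e' where
    "\<forall>p\<in>?M \<times> Y. e' p < k \<and> snd p \<otimes> inv (t (fst p) [^] (e' p :: nat)) \<in> fst p" by (rule exE)
  then have e': "e' p < k \<and> snd p \<otimes> inv (t (fst p) [^] (e' p :: nat)) \<in> fst p" if "p \<in> ?M \<times> Y" for p
    using that by (rule bspec)
  define e where "e = curry e'"
  have e: "e L y < k" "y \<otimes> inv (t L [^] (e L y)) \<in> L" if "L \<in> ?M" "y \<in> Y" for L y
    using e'[of "(L, y)"] that unfolding e_def by simp_all
  let ?f = "\<lambda>L. restrict (e L) Y"
  have sub: "L \<subseteq> L'" if L: "L \<in> ?M" and L': "L' \<in> ?M" and eq: "?f L = ?f L'" for L L'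
  proof -
    have Ls: "subgroup L G" and Ls': "subgroup L' G" using L L' maximal_subgroupD(1) by blast+
    have Ln: "L \<lhd> G" and Ln': "L' \<lhd> G" using normal_of_superset Ls Ls' L L' by blast+
    \<comment> \<open>The set where the homomorphisms of \<open>L\<close> and \<open>L'\<close>
      agree; it is a subgroup containing \<open>Y\<close>.\<close>
    let ?W = "{x \<in> carrier G. \<exists>i::nat. x \<otimes> inv (t L [^] i) \<in> L \<and> x \<otimes> inv (t L' [^] i) \<in> L'}"
    have prod: "(x \<otimes> y) \<otimes> inv (u [^] (i + j)) \<in> N"
      if N: "N \<lhd> G" and u: "u \<in> carrier G" and x: "x \<in> carrier G" "x \<otimes> inv (u [^] i) \<in> N"
        and y: "y \<in> carrier G" "y \<otimes> inv (u [^] j) \<in> N" for N u x y and i j :: nat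
    proof -
      have "u [^] (i + j) = u [^] i \<otimes> u [^] j" using u by (simp add: nat_pow_mult)
      moreover have "u [^] (i + j) = u [^] j \<otimes> u [^] i" using u by (simp add: nat_pow_mult add.commute)
      ultimately have "(x \<otimes> y) \<otimes> inv (u [^] (i + j)) =
          (x \<otimes> inv (u [^] i)) \<otimes> (u [^] i \<otimes> (y \<otimes> inv (u [^] j)) \<otimes> inv (u [^] i))"
        using u x y by (simp add: word_simps)
      also have "\<dots> \<in> N"
        by (rule subgroup.m_closed[OF normal_imp_subgroup[OF N] x(2) normal_conj(1)[OF N _ y(2)]])
           (use u in simp)
      finally show ?thesis .
    qed
    have W: "subgroup ?W G"
    proof (rule subgroup_of_mult_closed)
      show "?W \<subseteq> carrier G" by blast
      have "\<one> \<otimes> inv (t L [^] (0::nat)) \<in> L \<and> \<one> \<otimes> inv (t L' [^] (0::nat)) \<in> L'"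
        using subgroup.one_closed[OF Ls] subgroup.one_closed[OF Ls'] by simp
      then have "\<one> \<in> ?W" by blast
      then show "?W \<noteq> {}" by blast
      fix x y assume x: "x \<in> ?W" and y: "y \<in> ?W"
      then obtain i j where ij: "x \<otimes> inv (t L [^] (i::nat)) \<in> L" "x \<otimes> inv (t L' [^] i) \<in> L'"
        "y \<otimes> inv (t L [^] (j::nat)) \<in> L" "y \<otimes> inv (t L' [^] j) \<in> L'" by blast
      have c: "x \<in> carrier G" "y \<in> carrier G" using x y by blast+
      have "(x \<otimes> y) \<otimes> inv (t L [^] (i + j)) \<in> L" "(x \<otimes> y) \<otimes> inv (t L' [^] (i + j)) \<in> L'"
        using prod[OF Ln t(1)[OF L] c(1) ij(1) c(2) ij(3)]
          prod[OF Ln' t(1)[OF L'] c(1) ij(2) c(2) ij(4)] by blast+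
      then show "x \<otimes> y \<in> ?W" using c by blast
    qed
    have "Y \<subseteq> ?W"
    proof
      fix y assume y: "y \<in> Y"
      have "e L y = e L' y" using eq y by (metis restrict_apply')
      then have "y \<otimes> inv (t L [^] e L y) \<in> L \<and> y \<otimes> inv (t L' [^] e L y) \<in> L'"
        using e(2)[OF L y] e(2)[OF L' y] by simp
      then show "y \<in> ?W" using y Y(2) by blast
    qed
    then have WG: "?W = carrier G" by (rule generate_eq_carrierD[OF Y(3) W])
    show ?thesis
    proof
      fix x assume x: "x \<in> L"
      have xc: "x \<in> carrier G" using subgroup.mem_carrier[OF Ls x] .
      then obtain i where i: "x \<otimes> inv (t L [^] (i::nat)) \<in> L" "x \<otimes> inv (t L' [^] i) \<in> L'"
        using WG by blast
      have "inv (t L [^] i) \<in> L"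
        using subgroup_mult_mem(1)[OF Ls x, of "inv (t L [^] i)"] i(1) t(1)[OF L] by simp
      then have "inv (inv (t L [^] i)) \<in> L" by (rule subgroup.m_inv_closed[OF Ls])
      then have "t L [^] i \<in> L" using t(1)[OF L] by simp
      then have "k dvd i" using pow_mem_maximal_iff[of L k "t L" i] t[OF L] L by blast
      then have "t L' [^] i \<in> L'" using pow_mem_maximal_iff[of L' k "t L'" i] t[OF L'] L' by blast
      then have "inv (t L' [^] i) \<in> L'" by (rule subgroup.m_inv_closed[OF Ls'])
      then show "x \<in> L'" using subgroup_mult_mem(2)[OF Ls' _ xc] i(2) by blast
    qed
  qed
  have "card ?M \<le> card (Y \<rightarrow>\<^sub>E {..<k})"
  proof (rule card_inj_on_le)
    show "inj_on ?f ?M" 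
    proof (rule inj_onI)
      fix L L' assume "L \<in> ?M" "L' \<in> ?M" "?f L = ?f L'"
      then show "L = L'" using sub[of L L'] sub[of L' L] by simp
    qed
    show "?f ` ?M \<subseteq> Y \<rightarrow>\<^sub>E {..<k}" using e(1) by auto
    show "finite (Y \<rightarrow>\<^sub>E {..<k})" using Y(1) by (simp add: finite_PiE)
  qed
  then show ?thesis using Y(1) by (simp add: card_PiE)
qed

subsection \<open>Chief quotients of the derived subgroup\<close>

text \<open>In module terms, \<open>A / S\<close> is a simple quotient of \<open>A / R\<close> with
  \<open>k\<close> elements.\<close>

definition chief_quotient :: "nat \<Rightarrow> 'a set \<Rightarrow> bool" where
  "chief_quotient k S \<longleftrightarrow> S \<lhd> G \<and> R \<subseteq> S \<and> S \<subseteq> A \<and> S \<noteq> A \<and> card A = k * card S \<and>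
     (\<forall>K. K \<lhd> G \<longrightarrow> S \<subseteq> K \<longrightarrow> K \<subseteq> A \<longrightarrow> K = S \<or> K = A)"

lemma chief_quotientD:
  assumes "chief_quotient k S"
  shows "S \<lhd> G" "R \<subseteq> S" "S \<subseteq> A" "S \<noteq> A" "card A = k * card S"
    "K \<lhd> G \<Longrightarrow> S \<subseteq> K \<Longrightarrow> K \<subseteq> A \<Longrightarrow> K = S \<or> K = A" "subgroup S G"
  using assms unfolding chief_quotient_def by (simp_all add: normal_imp_subgroup)

lemma chief_quotient_ge_2:
  assumes "chief_quotient k S" shows "k \<ge> 2"
proof -
  have "card S < card A"
    using chief_quotientD[OF assms] finite_subgroup[OF As] by (intro psubset_card_mono) blast+
  then have "1 * card S < k * card S" using chief_quotientD(5)[OF assms] by simp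
  then show ?thesis by (metis mult_less_cancel2 Suc_1 Suc_leI)
qed

text \<open>\<open>L A = G\<close> turns the index of \<open>L\<close> into that of
  \<open>L \<inter> A\<close>. A normal \<open>K\<close> between \<open>L \<inter> A\<close> and
  \<open>A\<close> that is not inside \<open>L\<close> satisfies \<open>L K = G\<close>, and the
  modular law gives \<open>K = A\<close>.\<close>

lemma chief_quotient_maximal:
  assumes L: "maximal_subgroup L" "\<not> A \<subseteq> L" and k: "card (carrier G) = k * card L"
  shows "chief_quotient k (L \<inter> A)"
proof -
  note Ls = maximal_subgroupD(1)[OF L(1)]
  have LA: "L <#> A = carrier G" by (rule maximal_set_mult[OF L(1) A L(2)])
  have "card L * card A = k * card L * card (L \<inter> A)"
    using card_set_mult[OF Ls As] LA k by simp
  then have c: "card A = k * card (L \<inter> A)" using card_subgroup_pos[OF Ls] by simp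
  have "K = L \<inter> A \<or> K = A" if K: "K \<lhd> G" "L \<inter> A \<subseteq> K" "K \<subseteq> A" for K
  proof (cases "K \<subseteq> L")
    case False
    have LK: "L <#> K = carrier G" by (rule maximal_set_mult[OF L(1) K(1) False])
    have "x \<in> K" if x: "x \<in> A" for x
    proof -
      obtain l y where ly: "l \<in> L" "y \<in> K" "x = l \<otimes> y"
        using A_carrier[OF x] unfolding LK[symmetric] mem_set_mult by blast
      have "l \<in> A" using subgroup_mult_mem(2)[OF As, of y l] ly x K(3) subgroup.mem_carrier[OF Ls] by auto
      then have "l \<in> K" using ly K(2) by blast
      then show ?thesis unfolding ly(3) using ly(2) by (rule subgroup.m_closed[OF normal_imp_subgroup[OF K(1)]])
    qed
    then show ?thesis using K(3) by blast
  qed (use K in blast)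
  then show ?thesis unfolding chief_quotient_def
    using maximal_Int_normal[OF L] R_maximal[OF L(1)] RA L(2) c by blast
qed

definition centralizer_mod :: "'a set \<Rightarrow> 'a \<Rightarrow> 'a set" where
  "centralizer_mod S q = {z \<in> carrier G. comm z q \<in> S}"

lemma centralizer_mod_subgroup:
  assumes S: "S \<lhd> G" and q: "q \<in> carrier G"
  shows "subgroup (centralizer_mod S q) G"
proof (rule subgroup_of_mult_closed)
  note Ss = normal_imp_subgroup[OF S]
  show "centralizer_mod S q \<subseteq> carrier G" unfolding centralizer_mod_def by blast
  have "\<one> \<in> centralizer_mod S q"
    unfolding centralizer_mod_def using q subgroup.one_closed[OF Ss] by simp
  then show "centralizer_mod S q \<noteq> {}" by blast
  fix z w assume "z \<in> centralizer_mod S q" "w \<in> centralizer_mod S q"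
  then have z: "z \<in> carrier G" "comm z q \<in> S"
    and w: "w \<in> carrier G" "comm w q \<in> S" unfolding centralizer_mod_def by blast+
  have "comm (z \<otimes> w) q =
      (z \<otimes> (comm w q) \<otimes> inv z) \<otimes> (comm z q)"
    using z w q by (simp add: word_simps)
  also have "\<dots> \<in> S" by (rule subgroup.m_closed[OF Ss normal_conj(1)[OF S z(1) w(2)] z(2)])
  finally show "z \<otimes> w \<in> centralizer_mod S q" unfolding centralizer_mod_def using z w by simp
qed

lemma centralizer_mod_coset:
  assumes S: "S \<lhd> G" and q: "q \<in> carrier G" and s: "s \<in> S"
  shows "centralizer_mod S (q \<otimes> s) = centralizer_mod S q"
proof -
  note Ss = normal_imp_subgroup[OF S]
  have "comm z (q \<otimes> s) \<in> S \<longleftrightarrow> comm z q \<in> S"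
    if z: "z \<in> carrier G" for z
  proof -
    have sc: "s \<in> carrier G" using subgroup.mem_carrier[OF Ss s] .
    have "comm z s \<in> S"
      by (rule subgroup.m_closed[OF Ss normal_conj(1)[OF S z s] subgroup.m_inv_closed[OF Ss s]])
    then have "q \<otimes> (comm z s) \<otimes> inv q \<in> S" by (rule normal_conj(1)[OF S q])
    moreover have "comm z (q \<otimes> s) =
        (comm z q) \<otimes> (q \<otimes> (comm z s) \<otimes> inv q)"
      using z q sc by (simp add: word_simps)
    ultimately show ?thesis
      using subgroup_mult_mem(2)[OF Ss, of "q \<otimes> (comm z s) \<otimes> inv q"] z q by simp
  qed
  then show ?thesis unfolding centralizer_mod_def by blast
qed

text \<open>Fix \<open>x\<close> acting nontrivially on \<open>A / S\<close>. Each \<open>L\<close>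
  in the fibre contains some \<open>x \<otimes> b\<close> with \<open>b\<close> in \<open>A\<close>
  and is recovered as the centralizer of that element modulo \<open>S\<close>: commutators of
  elements of \<open>L\<close> lie in \<open>L \<inter> A = S\<close>, the centralizer is not
  everything, and \<open>L\<close> is maximal. The centralizer depends only on the coset of
  \<open>b\<close> modulo \<open>S\<close>, which leaves \<open>k\<close> possibilities.\<close>

lemma card_maximal_fibre_le:
  assumes S: "chief_quotient k S"
  shows "card {L. maximal_subgroup L \<and> \<not> A \<subseteq> L \<and> L \<inter> A = S} \<le> k" (is "card ?M \<le> k")
proof (cases "?M = {}")
  case True
  then show ?thesis by (simp only: card.empty)
next
  case False
  then obtain L0 where L0: "maximal_subgroup L0" "\<not> A \<subseteq> L0" "L0 \<inter> A = S" by blast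
  note Sn = chief_quotientD(1)[OF S] and Ss = chief_quotientD(7)[OF S]
  obtain x a where xa: "x \<in> carrier G" "a \<in> A" "comm x a \<notin> L0"
    using maximal_noncentral[OF L0(1,2)] by blast
  have ac: "a \<in> carrier G" by (rule A_carrier[OF xa(2)])
  have nS: "comm x a \<notin> S" using xa(3) L0(3) by blast
  let ?f = "\<lambda>b. centralizer_mod S (x \<otimes> b)"
  have "?M \<subseteq> ?f ` A"
  proof
    fix L assume "L \<in> ?M"
    then have L: "maximal_subgroup L" "\<not> A \<subseteq> L" "L \<inter> A = S" by blast+
    note Ls = maximal_subgroupD(1)[OF L(1)]
    note cL = subgroup.mem_carrier[OF Ls]
    have LA: "L <#> A = carrier G" by (rule maximal_set_mult[OF L(1) A L(2)])
    obtain l c where lc: "l \<in> L" "c \<in> A" "x = l \<otimes> c"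
      using xa(1) unfolding LA[symmetric] mem_set_mult by blast
    define b where "b = inv c"
    have b: "b \<in> A" "b \<in> carrier G"
      unfolding b_def using subgroup.m_inv_closed[OF As lc(2)] A_carrier by blast+
    have xb: "x \<otimes> b \<in> L" "x \<otimes> b \<in> carrier G"
      using lc cL A_carrier[OF lc(2)] unfolding b_def by (simp_all add: word_simps)
    note Z = centralizer_mod_subgroup[OF Sn xb(2)]
    have "L \<subseteq> ?f b"
    proof
      fix z assume z: "z \<in> L"
      have "comm z (x \<otimes> b) \<in> L"
        by (rule subgroup.m_closed[OF Ls subgroup.m_closed[OF Ls subgroup.m_closed[OF Ls z xb(1)]
              subgroup.m_inv_closed[OF Ls z]] subgroup.m_inv_closed[OF Ls xb(1)]])
      moreover have "comm z (x \<otimes> b) \<in> A" by (rule comm_A[OF cL[OF z] xb(2)])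
      ultimately show "z \<in> ?f b" unfolding centralizer_mod_def using L(3) cL[OF z] by blast
    qed
    moreover have "a \<notin> ?f b"
    proof
      assume "a \<in> ?f b"
      then have m: "comm a (x \<otimes> b) \<in> S" unfolding centralizer_mod_def by blast
      let ?r = "b \<otimes> inv a \<otimes> inv b \<otimes> inv (inv a)"
      have "?r \<in> S"
        using comm_R[OF b(1) subgroup.m_inv_closed[OF As xa(2)]] chief_quotientD(2)[OF S] by blast
      then have r: "(a \<otimes> x) \<otimes> ?r \<otimes> inv (a \<otimes> x) \<in> S"
        by (rule normal_conj(1)[OF Sn m_closed[OF ac xa(1)]])
      have "comm a (x \<otimes> b) =
          ((a \<otimes> x) \<otimes> ?r \<otimes> inv (a \<otimes> x)) \<otimes> inv (comm x a)"
        using ac xa(1) b by (simp add: word_simps)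
      then have "inv (comm x a) \<in> S"
        using subgroup_mult_mem(1)[OF Ss r, of "inv (comm x a)"] m ac xa(1) by simp
      then have "inv (inv (comm x a)) \<in> S" by (rule subgroup.m_inv_closed[OF Ss])
      then show False using nS ac xa(1) by simp
    qed
    then have "?f b \<noteq> carrier G" using ac by blast
    ultimately have "?f b = L" using maximal_subgroupD(3)[OF L(1) Z] by blast
    then show "L \<in> ?f ` A" using b(1) by blast
  qed
  moreover have fA: "finite (?f ` A)" using finite_subgroup[OF As] by simp
  ultimately have "card ?M \<le> card (?f ` A)" using card_mono by blast
  moreover have "card (?f ` A) * card S \<le> card A"
  proof -
    have fib: "card S \<le> card {c \<in> A. ?f c = y}" if "y \<in> ?f ` A" for y
    proof -
      obtain b where b: "b \<in> A" "y = ?f b" using \<open>y \<in> ?f ` A\<close> by blast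
      have "(\<lambda>s. b \<otimes> s) ` S \<subseteq> {c \<in> A. ?f c = y}"
      proof
        fix c assume "c \<in> (\<lambda>s. b \<otimes> s) ` S"
        then obtain s where s: "s \<in> S" "c = b \<otimes> s" by blast
        have "c \<in> A" unfolding s(2) using b(1) s(1) chief_quotientD(3)[OF S] by (intro subgroup.m_closed[OF As]) blast+
        moreover have "x \<otimes> c = (x \<otimes> b) \<otimes> s"
          using xa(1) A_carrier[OF b(1)] subgroup.mem_carrier[OF Ss s(1)] by (simp add: s(2) m_assoc)
        ultimately show "c \<in> {c \<in> A. ?f c = y}"
          using centralizer_mod_coset[OF Sn _ s(1), of "x \<otimes> b"] xa(1) A_carrier[OF b(1)] b(2) by simp
      qed
      then have "card ((\<lambda>s. b \<otimes> s) ` S) \<le> card {c \<in> A. ?f c = y}"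
        by (rule card_mono[rotated]) (use finite_subgroup[OF As] in simp)
      moreover have "inj_on (\<lambda>s. b \<otimes> s) S"
      proof (rule inj_onI)
        fix s s' assume "s \<in> S" "s' \<in> S" "b \<otimes> s = b \<otimes> s'"
        then show "s = s'" using A_carrier[OF b(1)] subgroup.mem_carrier[OF Ss, of s] subgroup.mem_carrier[OF Ss, of s'] by simp
      qed
      ultimately show ?thesis by (simp add: card_image)
    qed
    have "card (?f ` A) * card S = (\<Sum>y\<in>?f ` A. card S)" by simp
    also have "\<dots> \<le> (\<Sum>y\<in>?f ` A. card {c \<in> A. ?f c = y})" by (rule sum_mono) (rule fib)
    also have "\<dots> = card A"
      using sum.group[OF finite_subgroup[OF As] fA subset_refl, of "\<lambda>_. 1::nat"] by simp
    finally show ?thesis .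
  qed
  then have "card (?f ` A) \<le> k" using chief_quotientD(5)[OF S] card_subgroup_pos[OF Ss] by simp
  ultimately show ?thesis by simp
qed

end

section \<open>Action of the group on a chief quotient\<close>

context frattini_section
begin

text \<open>The elements of \<open>A\<close> centralized by \<open>x\<close> modulo \<open>S\<close>
  form a submodule, since conjugating \<open>x\<close> by \<open>z\<close> changes it only by an
  element of \<open>A\<close>, and \<open>A\<close> acts trivially on itself modulo
  \<open>R\<close>. This submodule contains \<open>S\<close> and \<open>b\<close>, so by simplicity
  it is \<open>A\<close>.\<close>

lemma centralizes_chief_quotient:
  assumes S: "chief_quotient k S" and x: "x \<in> carrier G" and b: "b \<in> A" "b \<notin> S"
    and xb: "comm x b \<in> S" and c: "c \<in> A"
  shows "comm x c \<in> S"
proof -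
  note Sn = chief_quotientD(1)[OF S] and Ss = chief_quotientD(7)[OF S]
  let ?K = "{c \<in> A. comm x c \<in> S}"
  have K: "?K \<lhd> G"
  proof (rule normal_invI)
    show "subgroup ?K G"
    proof (rule subgroup_of_mult_closed)
      show "?K \<subseteq> carrier G" using A_carrier by blast
      show "?K \<noteq> {}" using b xb by blast
      fix c d assume "c \<in> ?K" "d \<in> ?K"
      then have c: "c \<in> A" "comm x c \<in> S" and d: "d \<in> A" "comm x d \<in> S"
        by blast+
      note car = A_carrier[OF c(1)] A_carrier[OF d(1)] x
      have "comm x (c \<otimes> d) =
          (comm x c) \<otimes> (c \<otimes> (comm x d) \<otimes> inv c)"
        using car by (simp add: word_simps)
      also have "\<dots> \<in> S" by (rule subgroup.m_closed[OF Ss c(2) normal_conj(1)[OF Sn car(1) d(2)]])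
      finally show "c \<otimes> d \<in> ?K" using subgroup.m_closed[OF As c(1) d(1)] by blast
    qed
    fix z c assume z: "z \<in> carrier G" and "c \<in> ?K"
    then have c: "c \<in> A" "comm x c \<in> S" by blast+
    note car = A_carrier[OF c(1)] x z
    let ?p = "inv x \<otimes> inv z \<otimes> inv (inv x) \<otimes> inv (inv z)"
    have p: "?p \<in> A" by (rule comm_A[OF inv_closed[OF x] inv_closed[OF z]])
    have pc: "?p \<in> carrier G" by (rule A_carrier[OF p])
    have "comm ?p c \<in> S" using comm_R[OF p c(1)] chief_quotientD(2)[OF S] by blast
    then have 1: "x \<otimes> (comm ?p c) \<otimes> inv x \<in> S" by (rule normal_conj(1)[OF Sn x])
    have "(x \<otimes> (comm ?p c) \<otimes> inv x) \<otimes> (comm x c) \<in> S"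
      by (rule subgroup.m_closed[OF Ss 1 c(2)])
    then have "z \<otimes> ((x \<otimes> (comm ?p c) \<otimes> inv x) \<otimes> (comm x c)) \<otimes> inv z \<in> S"
      by (rule normal_conj(1)[OF Sn z])
    moreover have "z \<otimes> ((x \<otimes> (comm ?p c) \<otimes> inv x) \<otimes> (comm x c)) \<otimes> inv z =
        comm x (z \<otimes> c \<otimes> inv z)"
      using car by (simp add: word_simps)
    ultimately show "z \<otimes> c \<otimes> inv z \<in> ?K" using normal_conj(1)[OF A z c(1)] by simp
  qed
  have "S \<subseteq> ?K"
  proof
    fix s assume s: "s \<in> S"
    have "comm x s \<in> S"
      by (rule subgroup.m_closed[OF Ss normal_conj(1)[OF Sn x s] subgroup.m_inv_closed[OF Ss s]])
    then show "s \<in> ?K" using s chief_quotientD(3)[OF S] by blast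
  qed
  moreover have "?K \<subseteq> A" by blast
  ultimately have "?K = S \<or> ?K = A" by (rule chief_quotientD(6)[OF S K])
  then have "?K = A" using b xb by blast
  then show ?thesis using c by blast
qed

definition quotient_centralizer :: "'a set \<Rightarrow> 'a set" where
  "quotient_centralizer S = {x \<in> carrier G. \<forall>c\<in>A. comm x c \<in> S}"

lemma quotient_centralizer:
  assumes S: "chief_quotient k S"
  shows "subgroup (quotient_centralizer S) G" "A \<subseteq> quotient_centralizer S"
proof -
  note Sn = chief_quotientD(1)[OF S] and Ss = chief_quotientD(7)[OF S]
  have "quotient_centralizer S = carrier G \<inter> (\<Inter>c\<in>A. centralizer_mod S c)"
    unfolding quotient_centralizer_def centralizer_mod_def by blast
  also have "\<dots> = \<Inter>(insert (carrier G) (centralizer_mod S ` A))" by blast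
  also have "subgroup \<dots> G"
    by (rule subgroups_Inter) (use subgroup_self centralizer_mod_subgroup[OF Sn] A_carrier in blast)+
  finally show "subgroup (quotient_centralizer S) G" .
  show "A \<subseteq> quotient_centralizer S"
    unfolding quotient_centralizer_def using comm_R chief_quotientD(2)[OF S] A_carrier by blast
qed

text \<open>The abelian group \<open>G / C\<close>, with \<open>C\<close> the centralizer of the chief quotient \<open>A / S\<close>, acts
  freely on its nontrivial elements, so its order divides \<open>k - 1\<close>.\<close>

lemma pow_mem_quotient_centralizer:
  assumes S: "chief_quotient k S" and y: "y \<in> carrier G"
  shows "y [^] (k - 1) \<in> quotient_centralizer S"
proof -
  note Sn = chief_quotientD(1)[OF S] and Ss = chief_quotientD(7)[OF S] and SA = chief_quotientD(3)[OF S]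
  let ?K = "quotient_centralizer S"
  note Ks = quotient_centralizer(1)[OF S]
  have Kn: "?K \<lhd> G" by (rule normal_of_superset[OF quotient_centralizer[OF S]])
  note cK = subgroup.mem_carrier[OF Ks] and cS = subgroup.mem_carrier[OF Ss]
  let ?O = "A - S"
  \<comment> \<open>The classes are the preimages in \<open>A\<close> of the orbits of
    \<open>G\<close> on the nontrivial elements of \<open>A / S\<close>.\<close>
  let ?r = "{(b, c). b \<in> ?O \<and> (\<exists>x\<in>carrier G. \<exists>s\<in>S. c = x \<otimes> b \<otimes> inv x \<otimes> s)}"
  have rO: "c \<in> ?O" if "(b, c) \<in> ?r" for b c
  proof -
    obtain x s where x: "b \<in> A" "b \<notin> S" "x \<in> carrier G" "s \<in> S" "c = x \<otimes> b \<otimes> inv x \<otimes> s"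
      using \<open>(b, c) \<in> ?r\<close> by blast
    have bc: "b \<in> carrier G" by (rule A_carrier[OF x(1)])
    have xb: "x \<otimes> b \<otimes> inv x \<in> A" by (rule normal_conj(1)[OF A x(3,1)])
    have "x \<otimes> b \<otimes> inv x \<notin> S"
    proof
      assume "x \<otimes> b \<otimes> inv x \<in> S"
      then have "inv x \<otimes> (x \<otimes> b \<otimes> inv x) \<otimes> x \<in> S" by (rule normal_conj(2)[OF Sn x(3)])
      then show False using x(2,3) bc by (simp add: word_simps)
    qed
    then have "c \<notin> S"
      using subgroup_mult_mem(2)[OF Ss x(4) A_carrier[OF xb]] x(5) by simp
    moreover have "c \<in> A" unfolding x(5) by (rule subgroup.m_closed[OF As xb subsetD[OF SA x(4)]])
    ultimately show ?thesis by blast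
  qed
  have eq: "equiv ?O ?r"
  proof (rule equivI)
    show "?r \<subseteq> ?O \<times> ?O" using rO by blast
    show "refl_on ?O ?r"
    proof (rule refl_onI)
      fix b assume b: "b \<in> ?O"
      then have "b = \<one> \<otimes> b \<otimes> inv \<one> \<otimes> \<one>" using A_carrier[of b] by simp
      then show "(b, b) \<in> ?r" using b subgroup.one_closed[OF Ss] by blast
    qed
    show "sym ?r"
    proof (rule symI)
      fix b c assume bc: "(b, c) \<in> ?r"
      then obtain x s where x: "b \<in> ?O" "x \<in> carrier G" "s \<in> S" "c = x \<otimes> b \<otimes> inv x \<otimes> s" by blast
      have bcar: "b \<in> carrier G" "s \<in> carrier G" using x A_carrier cS by blast+
      have "b = inv x \<otimes> c \<otimes> inv (inv x) \<otimes> (inv x \<otimes> inv s \<otimes> x)"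
        using x(2) bcar by (simp add: x(4) word_simps)
      moreover have "inv x \<otimes> inv s \<otimes> x \<in> S"
        by (rule normal_conj(2)[OF Sn x(2) subgroup.m_inv_closed[OF Ss x(3)]])
      ultimately show "(c, b) \<in> ?r" using rO[OF bc] inv_closed[OF x(2)] by blast
    qed
    show "trans ?r"
    proof (rule transI)
      fix b c d assume "(b, c) \<in> ?r" "(c, d) \<in> ?r"
      then obtain x s z t where x: "b \<in> ?O" "x \<in> carrier G" "s \<in> S" "c = x \<otimes> b \<otimes> inv x \<otimes> s"
        and z: "z \<in> carrier G" "t \<in> S" "d = z \<otimes> c \<otimes> inv z \<otimes> t" by blast
      have car: "b \<in> carrier G" "s \<in> carrier G" "t \<in> carrier G" using x z A_carrier cS by blast+
      have "d = (z \<otimes> x) \<otimes> b \<otimes> inv (z \<otimes> x) \<otimes> ((z \<otimes> s \<otimes> inv z) \<otimes> t)"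
        using x(2) z(1) car by (simp add: z(3) x(4) word_simps)
      moreover have "(z \<otimes> s \<otimes> inv z) \<otimes> t \<in> S"
        by (rule subgroup.m_closed[OF Ss normal_conj(1)[OF Sn z(1) x(3)] z(2)])
      ultimately show "(b, d) \<in> ?r" using x(1) m_closed[OF z(1) x(2)] by blast
    qed
  qed
  define q where "q = card (rcosets ?K)"
  have q: "q * card ?K = card (carrier G)"
    using lagrange[OF Ks] unfolding q_def Coset.order_def by simp
  \<comment> \<open>Every orbit is regular for the quotient by \<open>?K\<close>, so it has
    \<open>q\<close> elements: by \<open>centralizes_chief_quotient\<close>, whatever fixes one
    nontrivial coset lies in \<open>?K\<close>.\<close>
  have cls: "card X = q * card S" if X: "X \<in> ?O // ?r" for X
  proof -
    obtain b where b: "b \<in> ?O" "X = ?r `` {b}" using X unfolding quotient_def by blast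
    have bA: "b \<in> A" "b \<notin> S" and bc: "b \<in> carrier G" using b A_carrier by blast+
    let ?f = "\<lambda>(x, s). x \<otimes> b \<otimes> inv x \<otimes> s"
    have "card (carrier G \<times> S) = card X * card ?K"
    proof (rule card_eq_fibres[where f = ?f])
      show "finite (carrier G \<times> S)" using finite_subgroup[OF Ss] by simp
      show "?f ` (carrier G \<times> S) = X" using b by auto
      fix c assume "c \<in> X"
      then obtain x0 s0 where x0: "x0 \<in> carrier G" "s0 \<in> S" "c = x0 \<otimes> b \<otimes> inv x0 \<otimes> s0"
        using b by blast
      have s0c: "s0 \<in> carrier G" using x0(2) cS by blast
      have cc: "c \<in> carrier G" using x0 s0c bc by simp
      \<comment> \<open>In the fibre over \<open>c\<close> the first entry runs through the coset of
        \<open>x0\<close> modulo \<open>?K\<close> and determines the second.\<close>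
      let ?g = "\<lambda>\<kappa>. (x0 \<otimes> \<kappa>, inv ((x0 \<otimes> \<kappa>) \<otimes> b \<otimes> inv (x0 \<otimes> \<kappa>)) \<otimes> c)"
      have "{p \<in> carrier G \<times> S. ?f p = c} = ?g ` ?K"
      proof (intro equalityI subsetI)
        fix p assume p: "p \<in> {p \<in> carrier G \<times> S. ?f p = c}"
        obtain x s where xs: "p = (x, s)" by (cases p)
        have x: "x \<in> carrier G" "s \<in> S" "x \<otimes> b \<otimes> inv x \<otimes> s = c" using p xs by simp_all
        have sc: "s \<in> carrier G" using x(2) cS by blast
        let ?\<kappa> = "inv x0 \<otimes> x"
        have "inv x0 \<otimes> (c \<otimes> inv s) \<otimes> x0 \<otimes> inv b = comm ?\<kappa> b"
          unfolding x(3)[symmetric] using x(1) x0(1) sc bc by (simp add: word_simps)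
        moreover have "inv x0 \<otimes> (c \<otimes> inv s) \<otimes> x0 \<otimes> inv b = b \<otimes> (inv x0 \<otimes> (s0 \<otimes> inv s) \<otimes> x0) \<otimes> inv b"
          unfolding x0(3) using x0(1) sc bc s0c by (simp add: word_simps)
        moreover have "b \<otimes> (inv x0 \<otimes> (s0 \<otimes> inv s) \<otimes> x0) \<otimes> inv b \<in> S"
          by (rule normal_conj(1)[OF Sn bc normal_conj(2)[OF Sn x0(1)
                subgroup.m_closed[OF Ss x0(2) subgroup.m_inv_closed[OF Ss x(2)]]]])
        ultimately have m: "comm ?\<kappa> b \<in> S" by simp
        have \<kappa>c: "?\<kappa> \<in> carrier G" using x0(1) x(1) by simp
        have "?\<kappa> \<in> ?K" unfolding quotient_centralizer_def
          using \<kappa>c centralizes_chief_quotient[OF S \<kappa>c bA m] by blast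
        moreover have "p = ?g ?\<kappa>"
          unfolding xs x(3)[symmetric] using x(1) x0(1) sc bc by (simp add: word_simps)
        ultimately show "p \<in> ?g ` ?K" by blast
      next
        fix p assume "p \<in> ?g ` ?K"
        then obtain \<kappa> where \<kappa>: "\<kappa> \<in> ?K" "p = ?g \<kappa>" by blast
        have \<kappa>c: "\<kappa> \<in> carrier G" using cK[OF \<kappa>(1)] .
        have "comm \<kappa> b \<in> S" using \<kappa>(1) bA unfolding quotient_centralizer_def by blast
        then have "inv (comm \<kappa> b) \<in> S" by (rule subgroup.m_inv_closed[OF Ss])
        then have "inv b \<otimes> inv (comm \<kappa> b) \<otimes> b \<in> S" by (rule normal_conj(2)[OF Sn bc])
        then have "x0 \<otimes> (inv b \<otimes> inv (comm \<kappa> b) \<otimes> b) \<otimes> inv x0 \<in> S"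
          by (rule normal_conj(1)[OF Sn x0(1)])
        then have m: "(x0 \<otimes> (inv b \<otimes> inv (comm \<kappa> b) \<otimes> b) \<otimes> inv x0) \<otimes> s0 \<in> S"
          by (rule subgroup.m_closed[OF Ss _ x0(2)])
        have "inv ((x0 \<otimes> \<kappa>) \<otimes> b \<otimes> inv (x0 \<otimes> \<kappa>)) \<otimes> c =
            (x0 \<otimes> (inv b \<otimes> inv (comm \<kappa> b) \<otimes> b) \<otimes> inv x0) \<otimes> s0"
          using x0(1) s0c bc \<kappa>c by (simp add: x0(3) word_simps)
        then have "inv ((x0 \<otimes> \<kappa>) \<otimes> b \<otimes> inv (x0 \<otimes> \<kappa>)) \<otimes> c \<in> S" using m by simp
        moreover have "?f p = c" unfolding \<kappa>(2) using x0(1) \<kappa>c bc cc by (simp add: word_simps)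
        ultimately show "p \<in> {p \<in> carrier G \<times> S. ?f p = c}" using \<kappa>(2) x0(1) \<kappa>c by simp
      qed
      moreover have "inj_on ?g ?K"
      proof (rule inj_onI)
        fix \<kappa> \<kappa>' assume "\<kappa> \<in> ?K" "\<kappa>' \<in> ?K" "?g \<kappa> = ?g \<kappa>'"
        then show "\<kappa> = \<kappa>'" using x0(1) cK[of \<kappa>] cK[of \<kappa>'] by simp
      qed
      ultimately show "card {p \<in> carrier G \<times> S. ?f p = c} = card ?K" by (simp add: card_image)
    qed
    then have "q * card ?K * card S = card X * card ?K"
      by (simp only: card_cartesian_product q)
    then have "card ?K * card X = card ?K * (q * card S)" by (simp only: mult_ac)
    then show ?thesis using card_subgroup_pos[OF Ks] by simp
  qed
  have finO: "finite ?O" using finite_subgroup[OF As] by simp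
  have "q * card S dvd card ?O"
    by (rule equiv_imp_dvd_card[OF finO eq]) (simp add: cls)
  moreover have "card ?O = (k - 1) * card S"
    using card_Diff_subset[OF finite_subgroup[OF Ss] SA] chief_quotientD(5)[OF S]
    by (simp add: diff_mult_distrib)
  ultimately have "q dvd k - 1" using card_subgroup_pos[OF Ss] by simp
  then obtain j where j: "k - 1 = q * j" by blast
  have yq: "y [^] q \<in> ?K" by (rule pow_index_mem[OF Kn y]) (simp add: q)
  have "(y [^] q) [^] j \<in> ?K"
    using subgroup.one_closed[OF Ks] subgroup.m_closed[OF Ks _ yq] by (induction j) simp_all
  then show ?thesis unfolding j using y by (simp add: nat_pow_pow)
qed

subsection \<open>Endomorphisms induced by the group ring\<close>

text \<open>Membership of both sides in \<open>A\<close> is built in, so that congruences can be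
  multiplied and inverted without side conditions.\<close>

definition cong_R :: "'a \<Rightarrow> 'a \<Rightarrow> bool"  (infix "\<simeq>" 50) where
  "x \<simeq> y \<longleftrightarrow> x \<in> A \<and> y \<in> A \<and> x \<otimes> inv y \<in> R"

lemma cong_R_refl: "x \<in> A \<Longrightarrow> x \<simeq> x"
  unfolding cong_R_def using A_carrier subgroup.one_closed[OF Rs] by simp

lemma cong_R_sym: "x \<simeq> y \<Longrightarrow> y \<simeq> x"
proof -
  assume xy: "x \<simeq> y"
  then have c: "x \<in> carrier G" "y \<in> carrier G" unfolding cong_R_def using A_carrier by blast+
  have "inv (x \<otimes> inv y) \<in> R" using xy unfolding cong_R_def by (blast intro: subgroup.m_inv_closed[OF Rs])
  then show "y \<simeq> x" using xy c unfolding cong_R_def by (simp add: word_simps)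
qed

lemma cong_R_trans [trans]: "x \<simeq> y \<Longrightarrow> y \<simeq> z \<Longrightarrow> x \<simeq> z"
proof -
  assume xy: "x \<simeq> y" and yz: "y \<simeq> z"
  then have c: "x \<in> carrier G" "y \<in> carrier G" "z \<in> carrier G"
    unfolding cong_R_def using A_carrier by blast+
  have "(x \<otimes> inv y) \<otimes> (y \<otimes> inv z) \<in> R"
    using xy yz unfolding cong_R_def by (blast intro: subgroup.m_closed[OF Rs])
  then show "x \<simeq> z" using xy yz c unfolding cong_R_def by (simp add: word_simps)
qed

lemma cong_R_mult:
  assumes "x \<simeq> x'" "y \<simeq> y'" shows "x \<otimes> y \<simeq> x' \<otimes> y'"
proof -
  have A4: "x \<in> A" "x' \<in> A" "y \<in> A" "y' \<in> A" using assms unfolding cong_R_def by blast+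
  note c = A4[THEN A_carrier]
  have "x \<otimes> (y \<otimes> inv y') \<otimes> inv x \<in> R"
    by (rule normal_conj(1)[OF R c(1)]) (use assms in \<open>simp add: cong_R_def\<close>)
  then have "(x \<otimes> (y \<otimes> inv y') \<otimes> inv x) \<otimes> (x \<otimes> inv x') \<in> R"
    by (rule subgroup.m_closed[OF Rs]) (use assms in \<open>simp add: cong_R_def\<close>)
  then show ?thesis
    unfolding cong_R_def using A4 c by (simp add: word_simps subgroup.m_closed[OF As])
qed

lemma cong_R_comm:
  assumes "x \<in> A" "y \<in> A" shows "x \<otimes> y \<simeq> y \<otimes> x"
  using comm_R[OF assms] assms[THEN A_carrier] assms
  by (simp add: cong_R_def word_simps subgroup.m_closed[OF As])

lemma cong_R_inv:
  assumes "x \<simeq> y" shows "inv x \<simeq> inv y"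
proof -
  have A2: "x \<in> A" "y \<in> A" using assms unfolding cong_R_def by blast+
  note c = A2[THEN A_carrier]
  have "y \<otimes> inv x \<in> R" using cong_R_sym[OF assms] unfolding cong_R_def by blast
  then have "inv x \<otimes> (y \<otimes> inv x) \<otimes> x \<in> R" by (rule normal_conj(2)[OF R c(1)])
  then show ?thesis
    unfolding cong_R_def using A2 c by (simp add: word_simps subgroup.m_inv_closed[OF As])
qed

lemma cong_R_conj:
  assumes "x \<simeq> y" "z \<in> carrier G" shows "z \<otimes> x \<otimes> inv z \<simeq> z \<otimes> y \<otimes> inv z"
proof -
  have A2: "x \<in> A" "y \<in> A" "x \<otimes> inv y \<in> R" using assms unfolding cong_R_def by blast+
  note c = A2(1,2)[THEN A_carrier] assms(2)
  have "(z \<otimes> x \<otimes> inv z) \<otimes> inv (z \<otimes> y \<otimes> inv z) = z \<otimes> (x \<otimes> inv y) \<otimes> inv z"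
    using c by (simp add: word_simps)
  then show ?thesis
    unfolding cong_R_def using normal_conj(1)[OF R c(3) A2(3)] normal_conj(1)[OF A c(3)] A2 by simp
qed

lemma cong_R_mem:
  assumes "x \<simeq> y" "subgroup X G" "R \<subseteq> X" shows "x \<in> X \<longleftrightarrow> y \<in> X"
proof -
  have A2: "x \<in> carrier G" "y \<in> carrier G" "x \<otimes> inv y \<in> X"
    using assms A_carrier unfolding cong_R_def by blast+
  have "x = (x \<otimes> inv y) \<otimes> y" using A2 by (simp add: word_simps)
  then show ?thesis using subgroup_mult_mem(1)[OF assms(2) A2(3,2)] by simp
qed

lemma cong_R_mult4:
  assumes "a \<in> A" "b \<in> A" "c \<in> A" "d \<in> A"
  shows "(a \<otimes> b) \<otimes> (c \<otimes> d) \<simeq> (a \<otimes> c) \<otimes> (b \<otimes> d)"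
proof -
  note c = assms[THEN A_carrier]
  have "a \<otimes> (b \<otimes> c) \<otimes> d \<simeq> a \<otimes> (c \<otimes> b) \<otimes> d"
    by (intro cong_R_mult cong_R_refl cong_R_comm assms)
  then show ?thesis using c by (simp add: m_assoc)
qed

text \<open>The action on \<open>A\<close> of elements of the group ring of \<open>G\<close>, well behaved only modulo \<open>R\<close>.\<close>

inductive group_ring_map :: "('a \<Rightarrow> 'a) \<Rightarrow> bool" where
  conj: "x \<in> carrier G \<Longrightarrow> group_ring_map (\<lambda>b. x \<otimes> b \<otimes> inv x)"
| one: "group_ring_map (\<lambda>b. \<one>)"
| mult: "group_ring_map f \<Longrightarrow> group_ring_map h \<Longrightarrow> group_ring_map (\<lambda>b. f b \<otimes> h b)"
| inv: "group_ring_map f \<Longrightarrow> group_ring_map (\<lambda>b. inv (f b))"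

lemma group_ring_map_closed:
  assumes "group_ring_map f" "N \<lhd> G" "b \<in> N" shows "f b \<in> N"
  using assms
proof (induction rule: group_ring_map.induct)
  note Ns = normal_imp_subgroup[OF assms(2)]
  case (conj x) then show ?case using normal_conj(1) by blast
next
  case one then show ?case using subgroup.one_closed[OF normal_imp_subgroup] by blast
next
  case (mult f h)
  then show ?case by (intro subgroup.m_closed[OF normal_imp_subgroup]) blast+
next
  case (inv f)
  then show ?case by (intro subgroup.m_inv_closed[OF normal_imp_subgroup]) blast+
qed

lemma group_ring_map_A: "group_ring_map f \<Longrightarrow> b \<in> A \<Longrightarrow> f b \<in> A"
  using group_ring_map_closed A by blast

lemma group_ring_map_cong:
  assumes "group_ring_map f" "b \<simeq> c" shows "f b \<simeq> f c"
  using assms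
proof (induction rule: group_ring_map.induct)
  case (conj x) then show ?case by (intro cong_R_conj)
next
  case one then show ?case by (intro cong_R_refl subgroup.one_closed[OF As])
next
  case (mult f h) then show ?case by (intro cong_R_mult) blast+
next
  case (inv f) then show ?case by (intro cong_R_inv) blast
qed

lemma group_ring_map_mult:
  assumes f: "group_ring_map f" and b: "b \<in> A" "c \<in> A"
  shows "f (b \<otimes> c) \<simeq> f b \<otimes> f c"
  using f
proof (induction rule: group_ring_map.induct)
  note car = b[THEN A_carrier]
  case (conj x)
  have "x \<otimes> (b \<otimes> c) \<otimes> inv x \<in> A" by (rule normal_conj(1)[OF A conj subgroup.m_closed[OF As b]])
  moreover have "(x \<otimes> b \<otimes> inv x) \<otimes> (x \<otimes> c \<otimes> inv x) = x \<otimes> (b \<otimes> c) \<otimes> inv x"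
    using car conj by (simp add: word_simps)
  ultimately show ?case using cong_R_refl by simp
next
  case one
  show ?case using cong_R_refl[OF subgroup.one_closed[OF As]] by simp
next
  case (mult f h)
  have "f (b \<otimes> c) \<otimes> h (b \<otimes> c) \<simeq> (f b \<otimes> f c) \<otimes> (h b \<otimes> h c)"
    by (rule cong_R_mult[OF mult.IH])
  also have "(f b \<otimes> f c) \<otimes> (h b \<otimes> h c) \<simeq> (f b \<otimes> h b) \<otimes> (f c \<otimes> h c)"
    by (rule cong_R_mult4[OF group_ring_map_A[OF mult.hyps(1) b(1)] group_ring_map_A[OF mult.hyps(1) b(2)]
          group_ring_map_A[OF mult.hyps(2) b(1)] group_ring_map_A[OF mult.hyps(2) b(2)]])
  finally show ?case .
next
  case (inv f)
  have fA: "f b \<in> A" "f c \<in> A" using group_ring_map_A[OF inv.hyps] b by blast+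
  have "inv (f (b \<otimes> c)) \<simeq> inv (f b \<otimes> f c)" by (rule cong_R_inv[OF inv.IH])
  also have "inv (f b \<otimes> f c) = inv (f c) \<otimes> inv (f b)" using fA[THEN A_carrier] by (simp add: inv_mult_group)
  also have "inv (f c) \<otimes> inv (f b) \<simeq> inv (f b) \<otimes> inv (f c)"
    by (intro cong_R_comm subgroup.m_inv_closed[OF As] fA)
  finally show ?case .
qed

lemma group_ring_map_one: "group_ring_map f \<Longrightarrow> f \<one> = \<one>"
  using group_ring_map_closed[OF _ one_is_normal, of f \<one>] by simp

lemma group_ring_map_inv:
  assumes f: "group_ring_map f" and b: "b \<in> A"
  shows "f (inv b) \<simeq> inv (f b)"
proof -
  have ib: "inv b \<in> A" by (rule subgroup.m_inv_closed[OF As b])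
  have fA: "f b \<in> A" "f (inv b) \<in> A" using group_ring_map_A[OF f] b ib by blast+
  note c = fA[THEN A_carrier]
  have "f (b \<otimes> inv b) \<simeq> f b \<otimes> f (inv b)" by (rule group_ring_map_mult[OF f b ib])
  then have "\<one> \<simeq> f b \<otimes> f (inv b)" using A_carrier[OF b] group_ring_map_one[OF f] by simp
  then have "inv (f b) \<otimes> \<one> \<simeq> inv (f b) \<otimes> (f b \<otimes> f (inv b))"
    by (rule cong_R_mult[OF cong_R_refl[OF subgroup.m_inv_closed[OF As fA(1)]]])
  then have "inv (f b) \<simeq> f (inv b)" using c by simp
  then show ?thesis by (rule cong_R_sym)
qed

text \<open>Modulo \<open>R\<close>, group ring maps are module endomorphisms. For conjugation by
  \<open>x\<close>, the words \<open>x \<otimes> z\<close> and \<open>z \<otimes> x\<close> differ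
  by the commutator \<open>p\<close> in \<open>A\<close>, and conjugation by \<open>p\<close> is
  trivial on \<open>A\<close> modulo \<open>R\<close>.\<close>

lemma group_ring_map_conj:
  assumes f: "group_ring_map f" and b: "b \<in> A" and z: "z \<in> carrier G"
  shows "f (z \<otimes> b \<otimes> inv z) \<simeq> z \<otimes> f b \<otimes> inv z"
  using f
proof (induction rule: group_ring_map.induct)
  note bc = A_carrier[OF b]
  case (conj x)
  note x = conj
  define p where "p = comm x z"
  define d where "d = (z \<otimes> x) \<otimes> b \<otimes> inv (z \<otimes> x)"
  have p: "p \<in> A" unfolding p_def by (rule comm_A[OF x z])
  have d: "d \<in> A" unfolding d_def by (rule normal_conj(1)[OF A m_closed[OF z x] b])
  note pd = A_carrier[OF p] A_carrier[OF d]
  have 1: "x \<otimes> (z \<otimes> b \<otimes> inv z) \<otimes> inv x = p \<otimes> d \<otimes> inv p"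
    unfolding p_def d_def using x z bc by (simp add: word_simps)
  have 2: "z \<otimes> (x \<otimes> b \<otimes> inv x) \<otimes> inv z = d"
    unfolding d_def using x z bc by (simp add: word_simps)
  have "p \<otimes> d \<otimes> inv p \<simeq> d \<otimes> p \<otimes> inv p"
    by (rule cong_R_mult[OF cong_R_comm[OF p d] cong_R_refl[OF subgroup.m_inv_closed[OF As p]]])
  then show ?case unfolding 1 2 using pd by (simp add: m_assoc)
next
  case one
  show ?case using cong_R_refl[OF subgroup.one_closed[OF As]] z by simp
next
  case (mult f h)
  have fA: "f b \<in> A" "h b \<in> A" using group_ring_map_A mult.hyps b by blast+
  have "f (z \<otimes> b \<otimes> inv z) \<otimes> h (z \<otimes> b \<otimes> inv z) \<simeq> (z \<otimes> f b \<otimes> inv z) \<otimes> (z \<otimes> h b \<otimes> inv z)"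
    by (rule cong_R_mult[OF mult.IH])
  also have "(z \<otimes> f b \<otimes> inv z) \<otimes> (z \<otimes> h b \<otimes> inv z) = z \<otimes> (f b \<otimes> h b) \<otimes> inv z"
    using fA[THEN A_carrier] z by (simp add: word_simps)
  finally show ?case .
next
  case (inv f)
  have fA: "f b \<in> A" using group_ring_map_A inv.hyps b by blast
  have "inv (f (z \<otimes> b \<otimes> inv z)) \<simeq> inv (z \<otimes> f b \<otimes> inv z)" by (rule cong_R_inv[OF inv.IH])
  also have "inv (z \<otimes> f b \<otimes> inv z) = z \<otimes> inv (f b) \<otimes> inv z"
    using A_carrier[OF fA] z by (simp add: word_simps)
  finally show ?case .
qed

lemma group_ring_map_commute:
  assumes f: "group_ring_map f" and h: "group_ring_map h" and b: "b \<in> A"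
  shows "f (h b) \<simeq> h (f b)"
  using h
proof (induction rule: group_ring_map.induct)
  case (conj x)
  then show ?case by (rule group_ring_map_conj[OF f b])
next
  case one
  show ?case using group_ring_map_one[OF f] cong_R_refl[OF subgroup.one_closed[OF As]] by simp
next
  case (mult h1 h2)
  have "f (h1 b \<otimes> h2 b) \<simeq> f (h1 b) \<otimes> f (h2 b)"
    by (rule group_ring_map_mult[OF f group_ring_map_A[OF mult.hyps(1) b] group_ring_map_A[OF mult.hyps(2) b]])
  also have "f (h1 b) \<otimes> f (h2 b) \<simeq> h1 (f b) \<otimes> h2 (f b)" by (rule cong_R_mult[OF mult.IH])
  finally show ?case .
next
  case (inv h)
  have "f (inv (h b)) \<simeq> inv (f (h b))"
    by (rule group_ring_map_inv[OF f group_ring_map_A[OF inv.hyps b]])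
  also have "inv (f (h b)) \<simeq> inv (h (f b))" by (rule cong_R_inv[OF inv.IH])
  finally show ?case .
qed

lemma closure_mod_group_ring_map:
  assumes a: "a \<in> A" and b: "b \<in> closure_mod a"
  shows "\<exists>f. group_ring_map f \<and> b \<simeq> f a"
  using b unfolding closure_mod_def
proof (induction rule: generate.induct)
  case one
  show ?case using group_ring_map.one cong_R_refl[OF subgroup.one_closed[OF As]] by blast
next
  case (incl h)
  show ?case
  proof (cases "h \<in> R")
    case True
    then have "h \<simeq> \<one>" unfolding cong_R_def using RA R_carrier subgroup.one_closed[OF As] by auto
    then show ?thesis using group_ring_map.one by blast
  next
    case False
    then obtain x where x: "x \<in> carrier G" "h = x \<otimes> a \<otimes> inv x" using incl by blast
    then have "h \<simeq> x \<otimes> a \<otimes> inv x" using cong_R_refl[OF normal_conj(1)[OF A x(1) a]] by simp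
    then show ?thesis using group_ring_map.conj[OF x(1)] by blast
  qed
next
  case (inv h)
  show ?case
  proof (cases "h \<in> R")
    case True
    then have "h \<simeq> \<one>" unfolding cong_R_def using RA R_carrier subgroup.one_closed[OF As] by auto
    then have "inv h \<simeq> inv \<one>" by (rule cong_R_inv)
    then show ?thesis using group_ring_map.one by auto
  next
    case False
    then obtain x where x: "x \<in> carrier G" "h = x \<otimes> a \<otimes> inv x" using inv by blast
    then have "h \<simeq> x \<otimes> a \<otimes> inv x" using cong_R_refl[OF normal_conj(1)[OF A x(1) a]] by simp
    then have "inv h \<simeq> inv (x \<otimes> a \<otimes> inv x)" by (rule cong_R_inv)
    then show ?thesis using group_ring_map.inv[OF group_ring_map.conj[OF x(1)]] by blast
  qed
next
  case (eng h1 h2)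
  then show ?case using cong_R_mult group_ring_map.mult by blast
qed

text \<open>The prime property below says that the lattice of \<open>G\<close>-submodules of the cyclic module
  \<open>A / E\<close> is distributive; the commutativity of the group ring action enters here.\<close>

lemma chief_quotient_prime:
  assumes S: "chief_quotient k S" and ES: "E \<subseteq> S"
    and E: "E \<lhd> G" "R \<subseteq> E" "E \<subseteq> A" and a: "a \<in> A" and gen: "closure_mod a <#> E = A"
    and X: "X \<lhd> G" "E \<subseteq> X" "X \<subseteq> A" "\<not> X \<subseteq> S" and Y: "Y \<lhd> G" "E \<subseteq> Y" "Y \<subseteq> A" "\<not> Y \<subseteq> S"
  shows "\<not> X \<inter> Y \<subseteq> S"
proof -
  note Sn = chief_quotientD(1)[OF S] and Ss = chief_quotientD(7)[OF S]
  note Xs = normal_imp_subgroup[OF X(1)] and Ys = normal_imp_subgroup[OF Y(1)]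
  have RX: "R \<subseteq> X" "R \<subseteq> Y" "R \<subseteq> S" using E(2) X(2) Y(2) ES by blast+
  have rep: "\<exists>f e. group_ring_map f \<and> e \<in> E \<and> b \<simeq> f a \<otimes> e" if b: "b \<in> A" for b
  proof -
    obtain c e where ce: "c \<in> closure_mod a" "e \<in> E" "b = c \<otimes> e"
      using b unfolding gen[symmetric] mem_set_mult by blast
    obtain f where f: "group_ring_map f" "c \<simeq> f a" using closure_mod_group_ring_map[OF a ce(1)] by blast
    have "b \<simeq> f a \<otimes> e" unfolding ce(3) using ce(2) E(3) by (intro cong_R_mult f cong_R_refl) blast
    then show ?thesis using f(1) ce(2) by blast
  qed
  have SX: "S <#> X = A"
  proof -
    have "S \<subseteq> S <#> X" "X \<subseteq> S <#> X" using subset_set_mult[OF Ss Xs] by blast+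
    moreover have "S <#> X \<subseteq> A" by (rule set_mult_subset[OF As chief_quotientD(3)[OF S] X(3)])
    ultimately show ?thesis
      using chief_quotientD(6)[OF S normal_set_mult[OF Sn X(1)]] X(4) by blast
  qed
  \<comment> \<open>Split \<open>a\<close> along \<open>A = S X\<close> and choose \<open>f\<close>
    with \<open>f a\<close> in \<open>Y\<close> outside \<open>S\<close>. The witness is
    \<open>f x\<close>. It is outside \<open>S\<close> because \<open>f s\<close> is inside while
    \<open>f a\<close> is not, and it is in \<open>X\<close> as \<open>X\<close> is a submodule. It
    is in \<open>Y\<close> because \<open>x\<close> is congruent to \<open>h a\<close> up to an
    element of \<open>E\<close>, and \<open>f (h a)\<close> to \<open>h (f a)\<close> by
    commutativity.\<close>
  obtain s x where sx: "s \<in> S" "x \<in> X" "a = s \<otimes> x" using a unfolding SX[symmetric] mem_set_mult by blast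
  have sxA: "s \<in> A" "x \<in> A" using sx chief_quotientD(3)[OF S] X(3) by blast+
  obtain y where y: "y \<in> Y" "y \<notin> S" using Y(4) by blast
  obtain f e where f: "group_ring_map f" "e \<in> E" "y \<simeq> f a \<otimes> e" using rep Y(3) y(1) by blast
  have fa: "f a \<in> A" by (rule group_ring_map_A[OF f(1) a])
  have e: "e \<in> S" "e \<in> Y" "e \<in> carrier G" using f(2) ES Y(2) E(3) A_carrier by blast+
  have "f a \<otimes> e \<in> Y" "f a \<otimes> e \<notin> S"
    using cong_R_mem[OF f(3) Ys RX(2)] cong_R_mem[OF f(3) Ss RX(3)] y by simp_all
  then have faY: "f a \<in> Y" "f a \<notin> S"
    using subgroup_mult_mem(2)[OF Ys e(2) A_carrier[OF fa]] subgroup_mult_mem(2)[OF Ss e(1) A_carrier[OF fa]]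
    by simp_all
  have fx: "f x \<in> A" by (rule group_ring_map_A[OF f(1) sxA(2)])
  have "f a \<simeq> f s \<otimes> f x" unfolding sx(3) by (rule group_ring_map_mult[OF f(1) sxA])
  then have "f s \<otimes> f x \<notin> S" using cong_R_mem[OF _ Ss RX(3)] faY(2) by blast
  then have fxS: "f x \<notin> S"
    using subgroup_mult_mem(1)[OF Ss group_ring_map_closed[OF f(1) Sn sx(1)] A_carrier[OF fx]] by simp
  have fxX: "f x \<in> X" by (rule group_ring_map_closed[OF f(1) X(1) sx(2)])
  obtain h e' where h: "group_ring_map h" "e' \<in> E" "x \<simeq> h a \<otimes> e'" using rep[OF sxA(2)] by blast
  have ha: "h a \<in> A" by (rule group_ring_map_A[OF h(1) a])
  have e': "e' \<in> A" "e' \<in> Y" using h(2) E(3) Y(2) by blast+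
  have "f x \<simeq> f (h a \<otimes> e')" by (rule group_ring_map_cong[OF f(1) h(3)])
  also have "f (h a \<otimes> e') \<simeq> f (h a) \<otimes> f e'" by (rule group_ring_map_mult[OF f(1) ha e'(1)])
  also have "f (h a) \<otimes> f e' \<simeq> h (f a) \<otimes> f e'"
    by (rule cong_R_mult[OF group_ring_map_commute[OF f(1) h(1) a]
          cong_R_refl[OF group_ring_map_A[OF f(1) e'(1)]]])
  finally have "f x \<simeq> h (f a) \<otimes> f e'" .
  moreover have "h (f a) \<otimes> f e' \<in> Y"
    by (rule subgroup.m_closed[OF Ys group_ring_map_closed[OF h(1) Y(1) faY(1)]
          group_ring_map_closed[OF f(1) Y(1) e'(2)]])
  ultimately have "f x \<in> Y" using cong_R_mem[OF _ Ys RX(2)] by blast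
  then show ?thesis using fxX fxS by blast
qed

end

section \<open>Independence and number of the chief quotients above \<open>E\<close>\<close>

context frattini_section
begin

lemma normal_Int_chief_quotients:
  assumes "finite \<S>" "\<And>S. S \<in> \<S> \<Longrightarrow> chief_quotient k S"
  shows "A \<inter> \<Inter>\<S> \<lhd> G"
  using assms
proof (induction \<S>)
  case empty then show ?case using A by simp
next
  case (insert S \<S>)
  have "A \<inter> \<Inter>(insert S \<S>) = S \<inter> (A \<inter> \<Inter>\<S>)" by blast
  moreover have "S \<lhd> G" using insert.prems chief_quotientD(1) by blast
  ultimately show ?case using insert normal_Int[of S "A \<inter> \<Inter>\<S>"] by simp
qed

context
  fixes E :: "'a set" and a :: 'a
  assumes E: "E \<lhd> G" "R \<subseteq> E" "E \<subseteq> A" and a: "a \<in> A" and gen: "closure_mod a <#> E = A"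
begin

text \<open>Repeated use of \<open>chief_quotient_prime\<close>; distinct maximal submodules do not
  contain one another. For a module that is not cyclic independence can fail: three distinct maximal
  submodules of the square of a simple module meet pairwise in zero.\<close>

lemma chief_quotients_independent:
  assumes "finite \<S>" "\<And>S'. S' \<in> \<S> \<Longrightarrow> chief_quotient k S' \<and> E \<subseteq> S'"
    and "chief_quotient k S" "E \<subseteq> S" "S \<notin> \<S>"
  shows "\<not> A \<inter> \<Inter>\<S> \<subseteq> S"
  using assms
proof (induction \<S>)
  case empty
  then show ?case using chief_quotientD(3,4)[of k S] by auto
next
  case (insert S' \<S>)
  have S': "chief_quotient k S'" "E \<subseteq> S'" and ne: "S' \<noteq> S"
    using insert.prems by blast+
  have all: "\<And>T. T \<in> \<S> \<Longrightarrow> chief_quotient k T \<and> E \<subseteq> T" using insert.prems(1) by blast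
  then have n: "A \<inter> \<Inter>\<S> \<lhd> G" using normal_Int_chief_quotients[OF insert.hyps(1)] by blast
  have "\<not> A \<inter> \<Inter>\<S> \<subseteq> S" using insert.IH[OF all insert.prems(2,3)] insert.prems(4) by blast
  moreover have "\<not> S' \<subseteq> S"
  proof
    assume "S' \<subseteq> S"
    then have "S = S' \<or> S = A"
      using chief_quotientD(6)[OF S'(1) chief_quotientD(1)[OF insert.prems(2)] _ chief_quotientD(3)[OF insert.prems(2)]]
      by blast
    then show False using ne chief_quotientD(4)[OF insert.prems(2)] by blast
  qed
  moreover have "E \<subseteq> A \<inter> \<Inter>\<S>" using E(3) all by blast
  ultimately have "\<not> S' \<inter> (A \<inter> \<Inter>\<S>) \<subseteq> S"
    using chief_quotient_prime[OF insert.prems(2,3) E a gen chief_quotientD(1)[OF S'(1)] S'(2)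
        chief_quotientD(3)[OF S'(1)] _ n] by blast
  moreover have "A \<inter> \<Inter>(insert S' \<S>) = S' \<inter> (A \<inter> \<Inter>\<S>)" by blast
  ultimately show ?case by simp
qed

text \<open>Chinese remainder theorem: by independence, the next \<open>S\<close> is comaximal with
  the intersection of the preceding ones.\<close>

lemma card_Int_chief_quotients:
  assumes "finite \<S>" "\<And>S. S \<in> \<S> \<Longrightarrow> chief_quotient k S \<and> E \<subseteq> S"
  shows "card A = k ^ card \<S> * card (A \<inter> \<Inter>\<S>)"
  using assms
proof (induction \<S>)
  case empty then show ?case by simp
next
  case (insert S \<S>)
  let ?J = "A \<inter> \<Inter>\<S>"
  have S: "chief_quotient k S" "E \<subseteq> S" using insert.prems by blast+
  note Sn = chief_quotientD(1)[OF S(1)] and Ss = chief_quotientD(7)[OF S(1)]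
  have all: "\<And>T. T \<in> \<S> \<Longrightarrow> chief_quotient k T \<and> E \<subseteq> T" using insert.prems(1) by blast
  then have J: "?J \<lhd> G" using normal_Int_chief_quotients[OF insert.hyps(1)] by blast
  note Js = normal_imp_subgroup[OF J]
  have nJ: "\<not> ?J \<subseteq> S" by (rule chief_quotients_independent[OF insert.hyps(1) all S insert.hyps(2)])
  have SJ: "S <#> ?J = A"
  proof -
    have "S \<subseteq> S <#> ?J" "?J \<subseteq> S <#> ?J" using subset_set_mult[OF Ss Js] by blast+
    moreover have "S <#> ?J \<subseteq> A" by (rule set_mult_subset[OF As chief_quotientD(3)[OF S(1)]]) blast
    ultimately show ?thesis
      using chief_quotientD(6)[OF S(1) normal_set_mult[OF Sn J]] nJ by blast
  qed
  have "card S * card ?J = k * card S * card (S \<inter> ?J)"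
    using card_set_mult[OF Ss Js] SJ chief_quotientD(5)[OF S(1)] by simp
  then have "card ?J = k * card (S \<inter> ?J)" using card_subgroup_pos[OF Ss] by simp
  moreover have "A \<inter> \<Inter>(insert S \<S>) = S \<inter> ?J" by blast
  ultimately have "card ?J = k * card (A \<inter> \<Inter>(insert S \<S>))" by simp
  then show ?case using insert.IH[OF all] insert.hyps by simp
qed

lemma card_chief_quotients_le:
  assumes Y: "finite Y" "Y \<subseteq> carrier G" "generate G Y = carrier G"
    and fS: "finite \<S>" and S: "\<And>S. S \<in> \<S> \<Longrightarrow> chief_quotient k S \<and> E \<subseteq> S"
  shows "card \<S> \<le> (k - 1) ^ card Y"
proof (cases "\<S> = {}")
  case False
  then obtain S0 where "S0 \<in> \<S>" by blast
  then have k: "k \<ge> 2" using S chief_quotient_ge_2 by blast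
  \<comment> \<open>The elements that act trivially on all the quotients under consideration; the
    index of \<open>K\<close> will bound both the number of conjugates of \<open>a\<close> modulo
    \<open>?I\<close> and \<open>card \<S>\<close>.\<close>
  define K where "K = carrier G \<inter> (\<Inter>S\<in>\<S>. quotient_centralizer S)"
  have "K = \<Inter>(insert (carrier G) (quotient_centralizer ` \<S>))" unfolding K_def by blast
  also have "subgroup \<dots> G"
    by (rule subgroups_Inter) (use subgroup_self quotient_centralizer(1) S in blast)+
  finally have Ks: "subgroup K G" .
  have AK: "A \<subseteq> K" unfolding K_def using A_carrier quotient_centralizer(2) S by blast
  note cK = subgroup.mem_carrier[OF Ks]
  \<comment> \<open>The quotient by \<open>K\<close> is abelian as \<open>A \<subseteq> K\<close>,
    and the \<open>(k - 1)\<close>-th power of each generator is trivial in it.\<close>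
  have cardG: "card (carrier G) \<le> (k - 1) ^ card Y * card K"
  proof -
    have "generate G (K \<union> Y) = carrier G"
      by (rule generate_eq_carrierI) (use cK Y generate_eq_carrierD[OF Y(3)] in auto)
    moreover have "card (generate G (K \<union> Y)) \<le> (k - 1) ^ card Y * card K"
    proof (rule card_generate_Un_le[OF Ks subgroup_self _ Y(1,2)])
      show "K \<subseteq> carrier G" using cK by blast
      show "comm b x \<in> K" if "b \<in> carrier G" "x \<in> carrier G" for b x
        using comm_A[OF that] AK by blast
      show "b [^] (k - 1) \<in> K" if "b \<in> Y" for b
        unfolding K_def using that Y(2) S pow_mem_quotient_centralizer[of k _ b] by auto
      show "1 \<le> k - 1" using k by simp
    qed
    ultimately show ?thesis by simp
  qed
  define q where "q = card (rcosets K)"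
  have q: "q * card K = card (carrier G)"
    using lagrange[OF Ks] unfolding q_def Coset.order_def by simp
  have qle: "q \<le> (k - 1) ^ card Y" using cardG card_subgroup_pos[OF Ks] by (simp flip: q)
  let ?I = "A \<inter> \<Inter>\<S>"
  have In: "?I \<lhd> G" using normal_Int_chief_quotients[OF fS] S by blast
  note Is = normal_imp_subgroup[OF In]
  have EI: "E \<subseteq> ?I" and RI: "R \<subseteq> ?I" using E S by blast+
  \<comment> \<open>One conjugate of \<open>a\<close> for each coset of \<open>K\<close>. Another
    representative of the coset changes the conjugate only by an element of \<open>?I\<close>, so
    \<open>F\<close> and \<open>?I\<close> generate all of \<open>closure_mod a\<close> and, as
    \<open>E \<subseteq> ?I\<close>, all of \<open>A\<close>.\<close>
  define F where "F = (\<lambda>C. let t = SOME t. t \<in> C in t \<otimes> a \<otimes> inv t) ` (rcosets K)"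
  have ac: "a \<in> carrier G" by (rule A_carrier[OF a])
  have finr: "finite (rcosets K)"
    using fin unfolding RCOSETS_def by simp
  have F: "finite F" "card F \<le> q" unfolding F_def q_def using finr card_image_le by simp_all
  have rc: "(SOME t. t \<in> C) \<in> C" "C \<subseteq> carrier G" if "C \<in> rcosets K" for C
    using that subgroup.rcosets_non_empty[OF Ks that] rcosets_part_G[OF Ks] by (auto simp: some_in_eq)
  have FA: "F \<subseteq> A"
    unfolding F_def Let_def using rc normal_conj(1)[OF A _ a] by blast
  have conj_gen: "x \<otimes> a \<otimes> inv x \<in> generate G (?I \<union> F)" if x: "x \<in> carrier G" for x
  proof -
    let ?C = "K #> x"
    define t where "t = (SOME t. t \<in> ?C)"
    have C: "?C \<in> rcosets K" using rcosetsI[OF subgroup.subset[OF Ks] x] .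
    have t: "t \<in> ?C" unfolding t_def by (rule rc(1)[OF C])
    then obtain \<kappa> where \<kappa>: "\<kappa> \<in> K" "t = \<kappa> \<otimes> x" unfolding r_coset_def by blast
    have \<kappa>c: "\<kappa> \<in> carrier G" using cK[OF \<kappa>(1)] .
    have tc: "t \<in> carrier G" using \<kappa> \<kappa>c x by simp
    let ?b = "t \<otimes> a \<otimes> inv t"
    have b: "?b \<in> F" unfolding F_def Let_def using C t_def by blast
    have bA: "?b \<in> A" using b FA by blast
    have bc: "?b \<in> carrier G" by (rule A_carrier[OF bA])
    have i\<kappa>: "inv \<kappa> \<in> K" by (rule subgroup.m_inv_closed[OF Ks \<kappa>(1)])
    have "inv \<kappa> \<otimes> ?b \<otimes> inv (inv \<kappa>) \<otimes> inv ?b \<in> S" if "S \<in> \<S>" for S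
      using i\<kappa> that bA unfolding K_def quotient_centralizer_def by blast
    moreover have "inv \<kappa> \<otimes> ?b \<otimes> inv (inv \<kappa>) \<otimes> inv ?b \<in> A"
      by (rule comm_A[OF inv_closed[OF \<kappa>c] bc])
    ultimately have "inv \<kappa> \<otimes> ?b \<otimes> inv (inv \<kappa>) \<otimes> inv ?b \<in> ?I" by blast
    then have "(inv \<kappa> \<otimes> ?b \<otimes> inv (inv \<kappa>) \<otimes> inv ?b) \<otimes> ?b \<in> generate G (?I \<union> F)"
      using b by (intro generate.eng generate.incl) blast+
    moreover have "(inv \<kappa> \<otimes> ?b \<otimes> inv (inv \<kappa>) \<otimes> inv ?b) \<otimes> ?b = x \<otimes> a \<otimes> inv x"
      using \<kappa>c x ac by (simp add: \<kappa>(2) word_simps)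
    ultimately show ?thesis by simp
  qed
  have IFc: "?I \<union> F \<subseteq> carrier G" using A_carrier FA by blast
  note gs = generate_is_subgroup[OF IFc]
  have IFg: "?I \<union> F \<subseteq> generate G (?I \<union> F)" by (rule generate_mono_subset[OF IFc])
  have "closure_mod a \<subseteq> generate G (?I \<union> F)"
    unfolding closure_mod_def
  proof (rule generate_subgroup_incl[OF _ gs])
    show "R \<union> (\<lambda>x. x \<otimes> a \<otimes> inv x) ` carrier G \<subseteq> generate G (?I \<union> F)"
      using conj_gen RI IFg by blast
  qed
  moreover have "E \<subseteq> generate G (?I \<union> F)" using EI IFg by blast
  ultimately have "A \<subseteq> generate G (?I \<union> F)"
    using set_mult_subset[OF gs, of "closure_mod a" E] gen by simp
  then have "card A \<le> card (generate G (?I \<union> F))" by (rule card_mono[OF finite_subgroup[OF gs]])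
  \<comment> \<open>Every \<open>A / S\<close> has order \<open>k\<close>, so \<open>k\<close>-th
    powers of elements of \<open>A\<close> lie in \<open>?I\<close>.\<close>
  also have "\<dots> \<le> k ^ card F * card ?I"
  proof (rule card_generate_Un_le[OF Is As _ F(1) FA])
    show "?I \<subseteq> A" by blast
    show "comm b x \<in> ?I" if "b \<in> A" "x \<in> A" for b x
      using comm_R[OF that] RI by blast
    show "b [^] k \<in> ?I" if b: "b \<in> F" for b
    proof -
      have bA: "b \<in> A" using b FA by blast
      have "b [^] k \<in> S" if "S \<in> \<S>" for S
        using pow_index_mem_subgroup[OF chief_quotientD(1) As chief_quotientD(3) bA chief_quotientD(5)] S[OF that]
        by blast
      moreover have "b [^] k \<in> A"
        using subgroup.one_closed[OF As] subgroup.m_closed[OF As _ bA] by (induction k) simp_all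
      ultimately show ?thesis by blast
    qed
    show "1 \<le> k" using k by simp
  qed
  also have "\<dots> \<le> k ^ q * card ?I"
    using F(2) k by (intro mult_right_mono power_increasing) simp_all
  finally have "k ^ card \<S> * card ?I \<le> k ^ q * card ?I"
    using card_Int_chief_quotients[OF fS S] by simp
  then have "k ^ card \<S> \<le> k ^ q" using card_subgroup_pos[OF Is] by simp
  then have "card \<S> \<le> q" using k by (simp add: power_le_imp_le_exp)
  then show ?thesis using qle by simp
qed simp

lemma card_maximal_not_superset_le:
  assumes Y: "finite Y" "Y \<subseteq> carrier G" "generate G Y = carrier G"
  shows "card {L. maximal_subgroup L \<and> E \<subseteq> L \<and> \<not> A \<subseteq> L \<and> card (carrier G) = k * card L} \<le> k ^ Suc (card Y)"
proof -
  let ?M = "{L. maximal_subgroup L \<and> E \<subseteq> L \<and> \<not> A \<subseteq> L \<and> card (carrier G) = k * card L}"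
  let ?S = "(\<lambda>L. L \<inter> A) ` ?M"
  let ?F = "\<lambda>S. {L. maximal_subgroup L \<and> \<not> A \<subseteq> L \<and> L \<inter> A = S}"
  have finF: "finite (?F S)" for S by (rule finite_maximal_subgroups)
  have finM: "finite ?M" by (rule finite_maximal_subgroups)
  then have finS: "finite ?S" by simp
  have S: "chief_quotient k S \<and> E \<subseteq> S" if S: "S \<in> ?S" for S
  proof -
    obtain L where L: "L \<in> ?M" "S = L \<inter> A" using S by (rule imageE)
    then show ?thesis using chief_quotient_maximal[of L k] E(3) by blast
  qed
  have "?M \<subseteq> (\<Union>S\<in>?S. ?F S)" by blast
  then have "card ?M \<le> card (\<Union>S\<in>?S. ?F S)" by (rule card_mono[rotated]) (use finS finF in blast)
  also have "\<dots> \<le> (\<Sum>S\<in>?S. card (?F S))" by (rule card_UN_le[OF finS])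
  also have "\<dots> \<le> (\<Sum>S\<in>?S. k)"
    by (rule sum_mono) (use S card_maximal_fibre_le in blast)
  also have "\<dots> = card ?S * k" by simp
  also have "\<dots> \<le> (k - 1) ^ card Y * k"
    by (rule mult_right_mono[OF card_chief_quotients_le[OF Y finS S]]) simp_all
  also have "\<dots> \<le> k ^ card Y * k"
    by (intro mult_right_mono power_mono) simp_all
  finally show ?thesis by (simp add: mult.commute)
qed

lemma generation_prob_tail_bound:
  assumes Y: "finite Y" "Y \<subseteq> carrier G" "generate G Y = carrier G" and I: "finite I"
  shows "1 - generation_prob I E \<le>
    (\<Sum>k = 2..card (carrier G). 2 * real k ^ Suc (card Y) * (1 / real k) ^ card I)"
proof -
  let ?n = "card (carrier G)"
  let ?M = "{L. maximal_subgroup L \<and> E \<subseteq> L}"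
  let ?Mk = "\<lambda>k. {L \<in> ?M. ?n = k * card L}"
  have finM: "finite ?M" by (rule finite_maximal_subgroups)
  have finMk: "finite (?Mk k)" for k by (rule finite_subset[OF _ finM]) blast
  have idx: "\<exists>k\<in>{2..?n}. ?n = k * card L" if "L \<in> ?M" for L
    using maximal_subgroup_index that by blast
  \<comment> \<open>The factor 2 merges the two kinds of maximal subgroups: the bound
    \<open>k ^ card Y\<close> for those above \<open>A\<close> is replaced by
    \<open>k ^ Suc (card Y)\<close>, the bound for the others.\<close>
  have cnt: "card (?Mk k) \<le> 2 * k ^ Suc (card Y)" if "k \<ge> 1" for k
  proof -
    let ?M1 = "{L. maximal_subgroup L \<and> A \<subseteq> L \<and> ?n = k * card L}"
    let ?M2 = "{L. maximal_subgroup L \<and> E \<subseteq> L \<and> \<not> A \<subseteq> L \<and> ?n = k * card L}"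
    have f: "finite ?M1" "finite ?M2" by (rule finite_maximal_subgroups)+
    have "card (?Mk k) \<le> card (?M1 \<union> ?M2)" by (rule card_mono) (use f in auto)
    also have "\<dots> \<le> card ?M1 + card ?M2" by (rule card_Un_le)
    also have "\<dots> \<le> k ^ card Y + k ^ Suc (card Y)"
      by (rule add_mono[OF card_maximal_superset_le[OF Y] card_maximal_not_superset_le[OF Y]])
    also have "k ^ card Y \<le> k ^ Suc (card Y)" using that by simp
    finally show ?thesis by simp
  qed
  have "1 - generation_prob I E \<le> (\<Sum>L\<in>?M. (card L / ?n) ^ card I)"
    using generation_prob_union_bound[OF I, of E] E(3) A_carrier by blast
  also have "\<dots> \<le> (\<Sum>L\<in>(\<Union>k\<in>{2..?n}. ?Mk k). (card L / ?n) ^ card I)"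
  proof (rule sum_mono2)
    show "finite (\<Union>k\<in>{2..?n}. ?Mk k)" using finMk by blast
    show "?M \<subseteq> (\<Union>k\<in>{2..?n}. ?Mk k)" using idx by blast
  qed simp
  also have "\<dots> = (\<Sum>k = 2..?n. \<Sum>L\<in>?Mk k. (card L / ?n) ^ card I)"
  proof (rule sum.UNION_disjoint)
    have "i = j" if "L \<in> ?Mk i" "L \<in> ?Mk j" for i j L
    proof -
      have "card L > 0" using that maximal_subgroupD(1) card_subgroup_pos by blast
      moreover have "i * card L = j * card L" using that by simp
      ultimately show ?thesis by simp
    qed
    then show "\<forall>i\<in>{2..?n}. \<forall>j\<in>{2..?n}. i \<noteq> j \<longrightarrow> ?Mk i \<inter> ?Mk j = {}" by blast
    show "\<forall>i\<in>{2..?n}. finite (?Mk i)" using finMk by blast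
  qed simp
  also have "\<dots> = (\<Sum>k = 2..?n. card (?Mk k) * (1 / real k) ^ card I)"
  proof (rule sum.cong[OF refl])
    fix k assume "k \<in> {2..?n}"
    then have k: "k > 0" by simp
    have "(card L / ?n) ^ card I = (1 / real k) ^ card I" if L: "L \<in> ?Mk k" for L
    proof -
      have "card L > 0" using L maximal_subgroupD(1) card_subgroup_pos by blast
      then have "real (card L) / real (k * card L) = 1 / real k" by simp
      moreover have "?n = k * card L" using L by blast
      ultimately show ?thesis by simp
    qed
    then have "(\<Sum>L\<in>?Mk k. (card L / ?n) ^ card I) = (\<Sum>L\<in>?Mk k. (1 / real k) ^ card I)"
      by (rule sum.cong[OF refl])
    then show "(\<Sum>L\<in>?Mk k. (card L / ?n) ^ card I) = card (?Mk k) * (1 / real k) ^ card I"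
      by (simp only: sum_constant)
  qed
  also have "\<dots> \<le> (\<Sum>k = 2..?n. 2 * real k ^ Suc (card Y) * (1 / real k) ^ card I)"
  proof (rule sum_mono)
    fix k assume k: "k \<in> {2..?n}"
    then have "card (?Mk k) \<le> 2 * k ^ Suc (card Y)" by (intro cnt) simp
    then have "real (card (?Mk k)) \<le> real (2 * k ^ Suc (card Y))" by (simp only: of_nat_le_iff)
    then have "real (card (?Mk k)) \<le> 2 * real k ^ Suc (card Y)"
      by (simp only: of_nat_mult of_nat_power of_nat_numeral)
    then show "card (?Mk k) * (1 / real k) ^ card I \<le> 2 * real k ^ Suc (card Y) * (1 / real k) ^ card I"
      by (rule mult_right_mono) simp
  qed
  finally show ?thesis .
qed

end

end

section \<open>Groups with nilpotent derived subgroup\<close>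

context group
begin

text \<open>The terms are characteristic in \<open>A\<close>; concretely, conjugation carries
  generating commutators to generating commutators. The series lives in the group with carrier
  \<open>A\<close>, and \<open>step\<close> turns its generation into generation in
  \<open>G\<close>.\<close>

lemma lower_central_series_normal:
  assumes A: "A \<lhd> G"
  shows "lower_central_series (G\<lparr>carrier := A\<rparr>) n \<lhd> G \<and> lower_central_series (G\<lparr>carrier := A\<rparr>) n \<subseteq> A"
    and "h \<in> A \<Longrightarrow> k \<in> lower_central_series (G\<lparr>carrier := A\<rparr>) n \<Longrightarrow>
      comm h k \<in> lower_central_series (G\<lparr>carrier := A\<rparr>) (Suc n)"
proof -
  let ?\<gamma> = "lower_central_series (G\<lparr>carrier := A\<rparr>)"
  let ?C = "\<lambda>n. \<Union>h\<in>A. \<Union>k\<in>?\<gamma> n. {comm h k}"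
  note As = normal_imp_subgroup[OF A]
  note cA = subgroup.mem_carrier[OF As]
  have step: "?\<gamma> (Suc n) = generate G (?C n)" and C: "?C n \<subseteq> A" if g: "?\<gamma> n \<subseteq> A" for n
  proof -
    have comm: "comm h k \<in> A" if "h \<in> A" "k \<in> A" for h k
      by (intro subgroup.m_closed[OF As] subgroup.m_inv_closed[OF As] that)
    show C: "?C n \<subseteq> A" using g comm by blast
    have "(\<Union>h\<in>A. \<Union>k\<in>?\<gamma> n. {h \<otimes> k \<otimes> inv\<^bsub>G\<lparr>carrier := A\<rparr>\<^esub> h \<otimes> inv\<^bsub>G\<lparr>carrier := A\<rparr>\<^esub> k}) = ?C n"
      using m_inv_consistent[OF As] g by (intro SUP_cong refl) auto
    then have "?\<gamma> (Suc n) = generate (G\<lparr>carrier := A\<rparr>) (?C n)" by simp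
    then show "?\<gamma> (Suc n) = generate G (?C n)" using generate_consistent[OF C As] by simp
  qed
  show N: "?\<gamma> n \<lhd> G \<and> ?\<gamma> n \<subseteq> A" for n
  proof (induction n)
    case 0 then show ?case using A by simp
  next
    case (Suc n)
    have g: "?\<gamma> n \<subseteq> A" and n: "?\<gamma> n \<lhd> G" using Suc by blast+
    have "generate G (?C n) \<lhd> G"
    proof (rule normal_generateI)
      show "?C n \<subseteq> carrier G" using C[OF g] cA by blast
      fix c z assume "c \<in> ?C n" and z: "z \<in> carrier G"
      then obtain h k where hk: "h \<in> A" "k \<in> ?\<gamma> n" "c = comm h k" by blast
      have hc: "h \<in> carrier G" "k \<in> carrier G" using hk g cA by blast+
      have "z \<otimes> c \<otimes> inv z = comm (z \<otimes> h \<otimes> inv z) (z \<otimes> k \<otimes> inv z)"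
        using hc z by (simp add: hk(3) word_simps)
      then show "z \<otimes> c \<otimes> inv z \<in> ?C n"
        using normal_conj(1)[OF A z hk(1)] normal_conj(1)[OF n z hk(2)] by blast
    qed
    moreover have "generate G (?C n) \<subseteq> A" by (rule generate_subgroup_incl[OF C[OF g] As])
    ultimately show ?case unfolding step[OF g] by blast
  qed
  show "comm h k \<in> ?\<gamma> (Suc n)" if "h \<in> A" "k \<in> ?\<gamma> n"
    unfolding step[OF conjunct2[OF N]] using that by (intro generate.incl) blast
qed

end

context finite_group
begin

text \<open>For a maximal \<open>L\<close> not above \<open>A\<close>, let \<open>?T\<close> be the
  last term of the lower central series of \<open>A\<close> that is not inside \<open>L\<close>.
  Then \<open>L ?T = G\<close>, and commutators of \<open>A\<close> with \<open>?T\<close> lie in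
  \<open>L\<close>. Hence \<open>?T\<close> normalizes \<open>L \<inter> A\<close>, and a commutator
  of two elements of \<open>A\<close>, written along \<open>L ?T\<close>, expands into factors from
  \<open>L\<close>. Normality of \<open>R\<close> follows from that of the
  \<open>L \<inter> A\<close>.\<close>

lemma frattini_section_nilpotent_derived:
  assumes nil: "nilpotent_group (G\<lparr>carrier := derived G (carrier G)\<rparr>)"
  defines "A \<equiv> derived G (carrier G)"
  defines "R \<equiv> A \<inter> \<Inter>{L. maximal_subgroup L}"
  shows "frattini_section G A R"
proof -
  have A: "A \<lhd> G" unfolding A_def by (rule derived_self_is_normal)
  note As = normal_imp_subgroup[OF A]
  note cA = subgroup.mem_carrier[OF As]
  let ?\<gamma> = "lower_central_series (G\<lparr>carrier := A\<rparr>)"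
  obtain n where n: "?\<gamma> n = {\<one>}" using nil unfolding nilpotent_group_def A_def by auto
  have key: "L \<inter> A \<lhd> G \<and> (\<forall>x\<in>A. \<forall>y\<in>A. comm x y \<in> L)"
    if L: "maximal_subgroup L" and AL: "\<not> A \<subseteq> L" for L
  proof -
    note Ls = maximal_subgroupD(1)[OF L]
    note cL = subgroup.mem_carrier[OF Ls]
    have ex: "?\<gamma> n \<subseteq> L" using n subgroup.one_closed[OF Ls] by simp
    define k where "k = (LEAST k. ?\<gamma> k \<subseteq> L)"
    have k: "?\<gamma> k \<subseteq> L" unfolding k_def by (rule LeastI[of "\<lambda>k. ?\<gamma> k \<subseteq> L", OF ex])
    have "k \<noteq> 0" using k AL by (metis lower_central_series.simps(1) partial_object.select_convs(1) partial_object.surjective partial_object.update_convs(1))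
    then obtain j where j: "k = Suc j" by (cases k) simp_all
    have nj: "\<not> ?\<gamma> j \<subseteq> L" using not_less_Least[of j "\<lambda>k. ?\<gamma> k \<subseteq> L"] j unfolding k_def by simp
    let ?T = "?\<gamma> j"
    have T: "?T \<lhd> G" "?T \<subseteq> A" using lower_central_series_normal(1)[OF A, of j] by blast+
    have AT: "comm h t \<in> L" if "h \<in> A" "t \<in> ?T" for h t
      using lower_central_series_normal(2)[OF A that] k j by blast
    have TA: "comm t h \<in> L" if "h \<in> A" "t \<in> ?T" for h t
    proof -
      have "inv (comm h t) \<in> L" by (rule subgroup.m_inv_closed[OF Ls AT[OF that]])
      then show ?thesis using cA[OF that(1)] cA[of t] that T(2) by (auto simp: word_simps)
    qed
    have LT: "L <#> ?T = carrier G" by (rule maximal_set_mult[OF L T(1) nj])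
    have "L \<inter> A \<lhd> G"
    proof (rule normal_invI)
      show "subgroup (L \<inter> A) G" by (rule subgroups_Inter_pair[OF Ls As])
      fix x s assume x: "x \<in> carrier G" and s: "s \<in> L \<inter> A"
      obtain l t where lt: "l \<in> L" "t \<in> ?T" "x = l \<otimes> t"
        using x unfolding LT[symmetric] mem_set_mult by blast
      have sL: "s \<in> L" "s \<in> A" using s by blast+
      have car: "l \<in> carrier G" "t \<in> carrier G" "s \<in> carrier G" using lt sL T(2) cL cA by blast+
      have "comm t s \<otimes> s \<in> L" by (rule subgroup.m_closed[OF Ls TA[OF sL(2) lt(2)] sL(1)])
      then have "l \<otimes> (comm t s \<otimes> s) \<otimes> inv l \<in> L"
        by (rule subgroup.m_closed[OF Ls subgroup.m_closed[OF Ls lt(1)] subgroup.m_inv_closed[OF Ls lt(1)]])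
      then have "x \<otimes> s \<otimes> inv x \<in> L" using car by (simp add: lt(3) word_simps)
      then show "x \<otimes> s \<otimes> inv x \<in> L \<inter> A" using normal_conj(1)[OF A x sL(2)] by blast
    qed
    moreover have "comm x y \<in> L" if x: "x \<in> A" and y: "y \<in> A" for x y
    proof -
      obtain l t where lt: "l \<in> L" "t \<in> ?T" "x = l \<otimes> t"
        using cA[OF x] unfolding LT[symmetric] mem_set_mult by blast
      obtain m u where mu: "m \<in> L" "u \<in> ?T" "y = m \<otimes> u"
        using cA[OF y] unfolding LT[symmetric] mem_set_mult by blast
      have car: "l \<in> carrier G" "t \<in> carrier G" "m \<in> carrier G" "u \<in> carrier G" "y \<in> carrier G"
        using lt mu T(2) cL cA y by blast+
      have tA: "t \<in> A" "u \<in> A" using lt(2) mu(2) T(2) by blast+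
      have lA: "l \<in> A" using subgroup_mult_mem(2)[OF As tA(1) car(1)] x lt(3) by simp
      note Lm = subgroup.m_closed[OF Ls] and Li = subgroup.m_inv_closed[OF Ls]
      have 1: "l \<otimes> (comm t y) \<otimes> inv l \<in> L"
        by (rule Lm[OF Lm[OF lt(1) TA[OF y lt(2)]] Li[OF lt(1)]])
      have 2: "comm l m \<in> L"
        by (rule Lm[OF Lm[OF Lm[OF lt(1) mu(1)] Li[OF lt(1)]] Li[OF mu(1)]])
      have 3: "m \<otimes> (comm l u) \<otimes> inv m \<in> L"
        by (rule Lm[OF Lm[OF mu(1) AT[OF lA mu(2)]] Li[OF mu(1)]])
      have "comm x y = (l \<otimes> (comm t y) \<otimes> inv l) \<otimes>
          ((comm l m) \<otimes> (m \<otimes> (comm l u) \<otimes> inv m))"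
        using car(1-4) by (simp add: lt(3) mu(3) word_simps)
      then show ?thesis using Lm[OF 1 Lm[OF 2 3]] by simp
    qed
    ultimately show ?thesis by blast
  qed
  have comm_in_A: "comm x y \<in> A" if "x \<in> A" "y \<in> A" for x y
    by (intro subgroup.m_closed[OF As] subgroup.m_inv_closed[OF As] that)
  have R_mem: "h \<in> R \<longleftrightarrow> h \<in> A \<and> (\<forall>L. maximal_subgroup L \<longrightarrow> h \<in> L)" for h
    unfolding R_def by blast
  have R: "R \<lhd> G"
  proof (rule normal_invI)
    have "R = \<Inter>(insert A {L. maximal_subgroup L})" unfolding R_def by blast
    also have "subgroup \<dots> G"
      by (rule subgroups_Inter) (use As maximal_subgroupD(1) in blast)+
    finally show "subgroup R G" .
    fix z h assume z: "z \<in> carrier G" and h: "h \<in> R"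
    have hA: "h \<in> A" using h R_mem by blast
    have zA: "z \<otimes> h \<otimes> inv z \<in> A" by (rule normal_conj(1)[OF A z hA])
    have "z \<otimes> h \<otimes> inv z \<in> L" if L: "maximal_subgroup L" for L
    proof (cases "A \<subseteq> L")
      case False
      have "h \<in> L \<inter> A" using h L R_mem by blast
      then have "z \<otimes> h \<otimes> inv z \<in> L \<inter> A" by (rule normal_conj(1)[OF conjunct1[OF key[OF L False]] z])
      then show ?thesis by blast
    qed (use zA in blast)
    then show "z \<otimes> h \<otimes> inv z \<in> R" using zA R_mem by blast
  qed
  show ?thesis
  proof (intro frattini_section.intro frattini_section_axioms.intro)
    show "finite_group G" by (rule finite_group_axioms)
    show "A = derived G (carrier G)" by (rule A_def[THEN meta_eq_to_obj_eq])
    show "R \<lhd> G" by (rule R)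
    show "R \<subseteq> A" unfolding R_def by blast
    show "comm x y \<in> R" if "x \<in> A" "y \<in> A" for x y
      using comm_in_A[OF that] key that R_mem by blast
    show "R \<subseteq> L" if "maximal_subgroup L" for L using that R_mem by blast
    show "L \<inter> A \<lhd> G" if "maximal_subgroup L" "\<not> A \<subseteq> L" for L using key[OF that] by blast
    show "\<exists>L. maximal_subgroup L \<and> \<not> T \<subseteq> L" if "T \<subseteq> A" "\<not> T \<subseteq> R" for T using that R_mem by blast
  qed
qed

end

section \<open>The expected generation time\<close>

context finite_group
begin

text \<open>Only finitely many coordinates matter, so the event is a finite disjoint union of
  cylinders, one for each generating tuple.\<close>

lemma measure_generating_event:
  "emeasure (uniform_sequence_measure G)
     {x \<in> space (uniform_sequence_measure G). generate G (Y \<union> x ` {1..t}) = carrier G} =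
   ennreal (generation_prob {1..t} Y)"
proof -
  let ?U = "uniform_count_measure (carrier G)" and ?J = "{1..t}" and ?I = "{1::nat..}"
  let ?n = "card (carrier G)"
  have J: "?J \<subseteq> ?I" by auto
  have "prob_space ?U" by (rule prob_space_uniform_count_measure) auto
  then interpret product_prob_space "\<lambda>_. ?U" ?I by (rule product_prob_spaceI)
  let ?M = "PiM ?I (\<lambda>_. ?U)"
  let ?e = "\<lambda>x. prod_emb ?I (\<lambda>_. ?U) ?J (PiE ?J (\<lambda>i. {x i}))"
  have T: "x i \<in> carrier G" if "x \<in> generating_tuples ?J Y" "i \<in> ?J" for x i
    using generating_tuplesD(1)[OF that(1)] that(2) by blast
  have sing: "PiE ?J (\<lambda>i. {x i}) = {x}" if "x \<in> generating_tuples ?J Y" for x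
    using generating_tuplesD(1)[OF that] by (intro PiE_singleton) (simp add: PiE_iff)
  have e_eq: "?e x = {\<omega> \<in> space ?M. restrict \<omega> ?J = x}" if "x \<in> generating_tuples ?J Y" for x
    unfolding sing[OF that] prod_emb_def space_PiM by blast
  have e_sets: "?e x \<in> sets ?M" if x: "x \<in> generating_tuples ?J Y" for x
    using T[OF x] J by (intro sets_PiM_I) (auto simp: sets_uniform_count_measure)
  have e_meas: "emeasure ?M (?e x) = ennreal ((1 / ?n) ^ t)" if x: "x \<in> generating_tuples ?J Y" for x
  proof -
    have "emeasure ?M (?e x) = (\<Prod>i\<in>?J. emeasure ?U {x i})"
      using T[OF x] J by (intro emeasure_PiM_emb) (auto simp: sets_uniform_count_measure)
    also have "\<dots> = (\<Prod>i\<in>?J. ennreal (1 / ?n))"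
      using T[OF x] by (intro prod.cong refl) (simp add: emeasure_uniform_count_measure)
    also have "\<dots> = ennreal ((1 / ?n) ^ t)" by (simp add: ennreal_power)
    finally show ?thesis .
  qed
  have fin': "finite (generating_tuples ?J Y)" by (rule finite_generating_tuples) simp
  have "{x \<in> space ?M. generate G (Y \<union> x ` ?J) = carrier G} = (\<Union>x\<in>generating_tuples ?J Y. ?e x)"
  proof (intro equalityI subsetI)
    fix \<omega> assume "\<omega> \<in> {x \<in> space ?M. generate G (Y \<union> x ` ?J) = carrier G}"
    then have \<omega>: "\<omega> \<in> space ?M" "generate G (Y \<union> \<omega> ` ?J) = carrier G" by blast+
    have "restrict \<omega> ?J \<in> ?J \<rightarrow>\<^sub>E carrier G"
      using \<omega>(1) J by (auto simp: space_PiM space_uniform_count_measure PiE_iff)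
    then have x: "restrict \<omega> ?J \<in> generating_tuples ?J Y"
      by (rule generating_tuplesI) (simp only: image_restrict_eq \<omega>(2))
    then have "\<omega> \<in> ?e (restrict \<omega> ?J)" unfolding e_eq[OF x] using \<omega>(1) by blast
    then show "\<omega> \<in> (\<Union>x\<in>generating_tuples ?J Y. ?e x)" using x by blast
  next
    fix \<omega> assume "\<omega> \<in> (\<Union>x\<in>generating_tuples ?J Y. ?e x)"
    then obtain x where x: "x \<in> generating_tuples ?J Y" "\<omega> \<in> ?e x" by blast
    then have "\<omega> \<in> space ?M" "restrict \<omega> ?J = x" unfolding e_eq[OF x(1)] by blast+
    moreover from this have "\<omega> ` ?J = x ` ?J" by (metis image_restrict_eq)
    ultimately show "\<omega> \<in> {x \<in> space ?M. generate G (Y \<union> x ` ?J) = carrier G}"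
      using generating_tuplesD(2)[OF x(1)] by simp
  qed
  then have "emeasure ?M {x \<in> space ?M. generate G (Y \<union> x ` ?J) = carrier G} =
      emeasure ?M (\<Union>x\<in>generating_tuples ?J Y. ?e x)" by (simp only:)
  also have "\<dots> = (\<Sum>x\<in>generating_tuples ?J Y. emeasure ?M (?e x))"
  proof (rule sum_emeasure[symmetric])
    show "?e ` generating_tuples ?J Y \<subseteq> sets ?M" using e_sets by blast
    show "disjoint_family_on ?e (generating_tuples ?J Y)"
      unfolding disjoint_family_on_def using e_eq by auto
  qed (rule fin')
  also have "\<dots> = (\<Sum>x\<in>generating_tuples ?J Y. ennreal ((1 / ?n) ^ t))"
    by (rule sum.cong[OF refl]) (rule e_meas)
  also have "\<dots> = ennreal (real (card (generating_tuples ?J Y)) * (1 / ?n) ^ t)"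
    by (simp add: ennreal_mult ennreal_of_nat_eq_real_of_nat)
  also have "real (card (generating_tuples ?J Y)) * (1 / ?n) ^ t = generation_prob ?J Y"
    unfolding generation_prob_def by (simp add: power_divide)
  finally show ?thesis unfolding uniform_sequence_measure_def .
qed

lemma generation_time_greater_iff:
  assumes x: "x \<in> space (uniform_sequence_measure G)" and Y: "Y \<subseteq> carrier G" and t: "t \<ge> 1"
  shows "enat t < generation_time G Y x \<longleftrightarrow> generate G (Y \<union> x ` {1..t}) \<noteq> carrier G"
proof -
  let ?S = "{enat n | n. 1 \<le> n \<and> generate G (Y \<union> x ` {1..n}) = carrier G}"
  have xc: "x i \<in> carrier G" if "i \<ge> 1" for i
    using x that by (auto simp: uniform_sequence_measure_def space_PiM space_uniform_count_measure)
  have mono: "generate G (Y \<union> x ` {1..t}) = carrier G"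
    if n: "n \<le> t" "generate G (Y \<union> x ` {1..n}) = carrier G" for n
  proof
    show "generate G (Y \<union> x ` {1..t}) \<subseteq> carrier G"
      using xc Y by (intro generate_incl) auto
    have "generate G (Y \<union> x ` {1..n}) \<subseteq> generate G (Y \<union> x ` {1..t})"
      using n(1) by (intro mono_generate) auto
    then show "carrier G \<subseteq> generate G (Y \<union> x ` {1..t})" using n(2) by simp
  qed
  show ?thesis
  proof
    assume less: "enat t < generation_time G Y x"
    show "generate G (Y \<union> x ` {1..t}) \<noteq> carrier G"
    proof
      assume "generate G (Y \<union> x ` {1..t}) = carrier G"
      then have "generation_time G Y x \<le> enat t"
        unfolding generation_time_def using t by (intro Inf_lower) blast
      then show False using less by simp
    qed
  next
    assume ng: "generate G (Y \<union> x ` {1..t}) \<noteq> carrier G"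
    have "enat (Suc t) \<le> generation_time G Y x"
      unfolding generation_time_def
    proof (rule Inf_greatest)
      fix s assume "s \<in> ?S"
      then obtain n where n: "s = enat n" "generate G (Y \<union> x ` {1..n}) = carrier G" by blast
      then have "\<not> n \<le> t" using mono ng by blast
      then show "enat (Suc t) \<le> s" using n(1) by simp
    qed
    then show "enat t < generation_time G Y x" by (simp add: Suc_ile_eq)
  qed
qed

text \<open>The probability that \<open>generation_time\<close> exceeds \<open>t\<close>. At
  \<open>t = 0\<close> it is 1 even if \<open>Y\<close> generates the group, as at least one element
  is drawn.\<close>

definition survival_prob :: "'a set \<Rightarrow> nat \<Rightarrow> real" where
  "survival_prob Y t = (if t = 0 then 1 else 1 - generation_prob {1..t} Y)"

lemma survival_prob_nonneg: "0 \<le> survival_prob Y t"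
  using generation_prob_bounds(2)[of "{1..t}" Y] by (simp add: survival_prob_def)

text \<open>The tail sum formula for the expectation of an extended natural number, in the form
  \<open>nn_integral_enat_function\<close>.\<close>

lemma expected_generation_time_eq_suminf:
  assumes Y: "Y \<subseteq> carrier G"
  shows "expected_generation_time G Y = enn2ereal (\<Sum>t. ennreal (survival_prob Y t))"
proof -
  let ?M = "uniform_sequence_measure G"
  have "prob_space (uniform_count_measure (carrier G))"
    by (rule prob_space_uniform_count_measure) auto
  then interpret M: prob_space ?M
    unfolding uniform_sequence_measure_def by (intro prob_space_PiM)
  have "emeasure ?M {x \<in> space ?M. enat t < generation_time G Y x} = ennreal (survival_prob Y t)" for t
  proof (cases "t = 0")
    case True
    have "enat 0 < generation_time G Y x" for x
    proof -
      have "enat 1 \<le> generation_time G Y x"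
        unfolding generation_time_def by (rule Inf_greatest) auto
      then show ?thesis by (metis enat_ord_simps(2) less_le_trans zero_less_one)
    qed
    then have "{x \<in> space ?M. enat t < generation_time G Y x} = space ?M" using True by simp
    then show ?thesis using True M.emeasure_space_1 by (simp add: survival_prob_def)
  next
    case False
    let ?A = "{x \<in> space ?M. generate G (Y \<union> x ` {1..t}) = carrier G}"
    have ms: "{x \<in> space ?M. enat t < generation_time G Y x} \<in> sets ?M"
      using measurable_generation_time[OF fin, of Y] by measurable
    have eq: "?A = space ?M - {x \<in> space ?M. enat t < generation_time G Y x}"
      using generation_time_greater_iff[OF _ Y, of _ t] False by auto
    then have eq': "{x \<in> space ?M. enat t < generation_time G Y x} = space ?M - ?A" by blast
    have As: "?A \<in> sets ?M" unfolding eq using ms by blast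
    have "emeasure ?M (space ?M - ?A) = emeasure ?M (space ?M) - emeasure ?M ?A"
      by (rule emeasure_compl[OF As]) simp
    also have "\<dots> = ennreal 1 - ennreal (generation_prob {1..t} Y)"
      by (simp only: measure_generating_event M.emeasure_space_1 ennreal_1)
    also have "\<dots> = ennreal (1 - generation_prob {1..t} Y)"
      by (rule ennreal_minus[OF generation_prob_bounds(1)]) simp
    also have "\<dots> = ennreal (survival_prob Y t)" using False by (simp add: survival_prob_def)
    finally show ?thesis unfolding eq' .
  qed
  then show ?thesis
    unfolding expected_generation_time_def
      nn_integral_enat_function[OF measurable_generation_time[OF fin]] by simp
qed

text \<open>Makes the final difference of expectations one of real numbers. Maximal subgroups have
  index at least 2, so the union bound decays geometrically.\<close>

lemma survival_prob_suminf_finite: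
  assumes Y: "Y \<subseteq> carrier G"
  shows "(\<Sum>t. ennreal (survival_prob Y t)) \<noteq> top_class.top"
proof -
  let ?M = "{L. maximal_subgroup L \<and> Y \<subseteq> L}"
  let ?b = "\<lambda>t. (1 + real (card ?M)) * (1 / 2) ^ t"
  have half: "real (card L) / card (carrier G) \<le> 1 / 2" if L: "L \<in> ?M" for L
  proof -
    obtain k where "2 \<le> k" and k: "card (carrier G) = k * card L"
      using maximal_subgroup_index[of L] L by auto
    have "2 * card L \<le> card (carrier G)" unfolding k using \<open>2 \<le> k\<close> by simp
    then have "real (2 * card L) \<le> real (card (carrier G))" by (simp only: of_nat_le_iff)
    then show ?thesis using card_carrier_pos by (simp add: field_simps)
  qed
  have le: "survival_prob Y t \<le> ?b t" for t
  proof (cases "t = 0")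
    case False
    have "1 - generation_prob {1..t} Y \<le> (\<Sum>L\<in>?M. (real (card L) / card (carrier G)) ^ t)"
      using generation_prob_union_bound[OF _ Y, of "{1..t}"] by simp
    also have "\<dots> \<le> (\<Sum>L\<in>?M. (1 / 2) ^ t)"
      by (intro sum_mono power_mono half) simp_all
    also have "\<dots> \<le> ?b t" by (simp add: distrib_right)
    finally show ?thesis using False by (simp add: survival_prob_def)
  qed (simp add: survival_prob_def)
  have "(\<Sum>t. ennreal (survival_prob Y t)) \<le> (\<Sum>t. ennreal (?b t))"
    by (intro suminf_le ennreal_leI le summableI)
  moreover have "(\<Sum>t. ennreal (?b t)) \<noteq> top_class.top"
    by (intro ennreal_suminf_neq_top summable_mult summable_geometric) simp_all
  ultimately show ?thesis by (metis neq_top_trans)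
qed

end

section \<open>Numerical estimates\<close>

lemma sum_inverse_squares_le: "(\<Sum>k = 2..n. (1 / real k)\<^sup>2) \<le> 1"
proof -
  \<comment> \<open>The stronger bound \<open>1 - 1 / n\<close> carries the induction, by comparison
    with the telescoping \<open>1 / (k - 1) - 1 / k\<close>.\<close>
  have le: "(\<Sum>k = 2..n. (1 / real k)\<^sup>2) \<le> 1 - 1 / real n" if "n \<ge> 1" for n
    using that
  proof (induction n rule: dec_induct)
    case (step n)
    have "(1 / real (Suc n))\<^sup>2 = 1 / (real (Suc n) * real (Suc n))"
      by (simp add: power2_eq_square)
    also have "\<dots> \<le> 1 / (real n * real (Suc n))"
      using step.hyps by (intro frac_le mult_right_mono) simp_all
    also have "\<dots> = 1 / real n - 1 / real (Suc n)"
      using step.hyps by (simp add: divide_simps)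
    finally have "(1 / real (Suc n))\<^sup>2 \<le> 1 / real n - 1 / real (Suc n)" .
    moreover have "{2..Suc n} = insert (Suc n) {2..n}" using step.hyps by auto
    ultimately show ?case using step.IH by simp
  qed simp
  show ?thesis
  proof (cases "n \<ge> 1")
    case True
    have "1 - 1 / real n \<le> 1" by simp
    then show ?thesis using le[OF True] by (rule order_trans[rotated])
  qed simp
qed

text \<open>Origin of the threshold \<open>d + 3\<close>: of the exponent \<open>d + 4 + i\<close>,
  the part \<open>d + 1\<close> cancels the number of maximal subgroups, \<open>i + 1\<close> gives
  \<open>(1 / 2) ^ Suc i\<close>, whose additional half cancels the factor 2, and the remaining 2
  makes the sum over \<open>k\<close> bounded.\<close>

lemma sum_power_tail_le:
  "(\<Sum>k = 2..n. 2 * real k ^ Suc d * (1 / real k) ^ Suc (d + 3 + i)) \<le> (1 / 2) ^ i"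
proof -
  have "2 * real k ^ Suc d * (1 / real k) ^ Suc (d + 3 + i) \<le> (1 / 2) ^ i * (1 / real k)\<^sup>2"
    if k: "k \<in> {2..n}" for k
  proof -
    have k2: "real k \<ge> 2" using k by simp
    have "real k ^ Suc d * (1 / real k) ^ Suc (d + 3 + i) = (1 / real k) ^ Suc i * (1 / real k)\<^sup>2"
      using k2 by (simp add: power_add power_divide field_simps eval_nat_numeral)
    also have "\<dots> \<le> (1 / 2) ^ Suc i * (1 / real k)\<^sup>2"
      using k2 by (intro mult_right_mono power_mono) (simp_all add: field_simps)
    finally show ?thesis by simp
  qed
  then have "(\<Sum>k = 2..n. 2 * real k ^ Suc d * (1 / real k) ^ Suc (d + 3 + i)) \<le>
      (\<Sum>k = 2..n. (1 / 2) ^ i * (1 / real k)\<^sup>2)" by (rule sum_mono)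
  also have "\<dots> = (1 / 2) ^ i * (\<Sum>k = 2..n. (1 / real k)\<^sup>2)" by (simp only: sum_distrib_left)
  also have "\<dots> \<le> (1 / 2) ^ i * 1" by (intro mult_left_mono sum_inverse_squares_le) simp
  finally show ?thesis by simp
qed

text \<open>The three contributions are 4 for the indices from \<open>d - 1\<close> to
  \<open>d + 2\<close>, 1 for the telescoping differences of \<open>p\<close>, and 2 for the
  geometric series.\<close>

lemma telescoping_sum_bound:
  fixes \<delta> p :: "nat \<Rightarrow> real"
  assumes le1: "\<And>t. \<delta> t \<le> 1" and le0: "\<And>t. t + 1 < d \<Longrightarrow> \<delta> t \<le> 0"
    and tail: "\<And>i. \<delta> (d + 3 + i) \<le> p (Suc (d + 3 + i)) - p (d + 3 + i) + (1 / 2) ^ i"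
    and p: "\<And>t. 0 \<le> p t" "\<And>t. p t \<le> 1"
  shows "(\<Sum>t<T. \<delta> t) \<le> 7"
proof -
  have head: "(\<Sum>t<S. \<delta> t) \<le> 4" if S: "S \<le> d + 3" for S
  proof -
    have "(\<Sum>t<S. \<delta> t) \<le> (\<Sum>t<S. if d \<le> t + 1 then 1 else 0)"
      by (rule sum_mono) (use le1 le0 in auto)
    also have "\<dots> = real (card {t \<in> {..<S}. d \<le> t + 1})"
      by (simp add: sum.If_cases Int_def)
    also have "\<dots> \<le> real (card {d - 1..<d + 3})"
      using S by (intro of_nat_mono card_mono) auto
    also have "\<dots> \<le> 4" by simp
    finally show ?thesis .
  qed
  show ?thesis
  proof (cases "T \<le> d + 3")
    case False
    then obtain m where m: "T = d + 3 + m" by (metis le_add_diff_inverse nat_le_linear)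
    have "(\<Sum>t<c + m. \<delta> t) = (\<Sum>t<c. \<delta> t) + (\<Sum>i<m. \<delta> (c + i))" for c
      by (induction m) (simp_all add: add.assoc)
    then have "(\<Sum>t<T. \<delta> t) = (\<Sum>t<d + 3. \<delta> t) + (\<Sum>i<m. \<delta> (d + 3 + i))"
      unfolding m .
    also have "(\<Sum>i<m. \<delta> (d + 3 + i)) \<le>
        (\<Sum>i<m. (p (Suc (d + 3 + i)) - p (d + 3 + i)) + (1 / 2) ^ i)"
      by (rule sum_mono) (rule tail)
    also have "\<dots> = (\<Sum>i<m. p (Suc (d + 3 + i)) - p (d + 3 + i)) + (\<Sum>i<m. (1 / 2) ^ i)"
      by (rule sum.distrib)
    also have "(\<Sum>i<m. p (Suc (d + 3 + i)) - p (d + 3 + i)) = p (d + 3 + m) - p (d + 3)"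
      by (induction m) simp_all
    also have "(\<Sum>i<m. (1 / 2) ^ i) \<le> (2 :: real)"
      by (simp add: sum_gp_strict)
    finally show ?thesis using head[of "d + 3"] p(1)[of "d + 3"] p(2)[of "d + 3 + m"] by simp
  qed (use head in force)
qed

theorem theorem5:
  fixes G :: "('a, 'b) monoid_scheme" and g :: 'a
  assumes "group G"
    and "finite (carrier G)"
    and "carrier G \<noteq> {\<one>\<^bsub>G\<^esub>}"
    and "nilpotent_group (G\<lparr>carrier := derived G (carrier G)\<rparr>)"
    and "g \<in> carrier G"
  shows "expected_generation_time G {} - expected_generation_time G {g} \<le> 11"
proof -
  interpret finite_group G
    by (rule finite_group.intro[OF assms(1)]) (simp add: finite_group_axioms_def assms(2))
  interpret frattini_section G "derived G (carrier G)"
    "derived G (carrier G) \<inter> \<Inter>{L. maximal_subgroup L}"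
    by (rule frattini_section_nilpotent_derived[OF assms(4)])
  let ?A = "derived G (carrier G)"
  let ?R = "?A \<inter> \<Inter>{L. maximal_subgroup L}"
  obtain E a where E: "E \<lhd> G" "?R \<subseteq> E" "E \<subseteq> ?A" and a: "a \<in> ?A" and gen: "closure_mod a <#>\<^bsub>G\<^esub> E = ?A"
    and compl: "\<And>M N. M \<lhd> G \<Longrightarrow> N \<lhd> G \<Longrightarrow> ?R \<subseteq> M \<Longrightarrow> M \<subseteq> N \<Longrightarrow> N \<subseteq> E \<Longrightarrow> \<exists>C\<in>complements M N. g \<in> C"
    by (rule exists_avoiding_subgroup[OF assms(5)]) (rule that)
  \<comment> \<open>\<open>d\<close> is the least number of generators. By minimality
    \<open>g\<close> and \<open>t\<close> elements cannot generate when \<open>t + 1 < d\<close>,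
    while a generating set \<open>Z\<close> of size \<open>d\<close> feeds the count of maximal
    subgroups.\<close>
  define Q where "Q m \<longleftrightarrow> (\<exists>Z. Z \<subseteq> carrier G \<and> card Z = m \<and> generate G Z = carrier G)" for m
  define d where "d = (LEAST m. Q m)"
  have "generate G (carrier G) = carrier G"
    using generate_mono_subset[OF subset_refl] generate_incl[OF subset_refl] by blast
  then have "Q (card (carrier G))" unfolding Q_def by blast
  then have "Q d" unfolding d_def by (rule LeastI)
  then obtain Z where Z: "Z \<subseteq> carrier G" "card Z = d" "generate G Z = carrier G" unfolding Q_def by blast
  have finZ: "finite Z" by (rule finite_sub[OF Z(1)])
  have dmin: "d \<le> card Z'" if "Z' \<subseteq> carrier G" "generate G Z' = carrier G" for Z'
    unfolding d_def by (rule Least_le) (use that in \<open>unfold Q_def, blast\<close>)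
  let ?p = "\<lambda>t. generation_prob {1..t} {}" and ?q = "\<lambda>t. generation_prob {1..t} {g}"
  let ?\<delta> = "\<lambda>t. survival_prob {} t - survival_prob {g} t"
  have bounds: "0 \<le> generation_prob {1..t} Y" "generation_prob {1..t} Y \<le> 1" for t Y
    by (rule generation_prob_bounds, simp)+
  have q0: "?q t = 0" if t: "t + 1 < d" for t
  proof -
    have "generating_tuples {1..t} {g} = {}"
    proof (rule ccontr)
      assume "generating_tuples {1..t} {g} \<noteq> {}"
      then obtain x where x: "x \<in> generating_tuples {1..t} {g}" by blast
      have "{g} \<union> x ` {1..t} \<subseteq> carrier G"
        using assms(5) tuple_image[OF generating_tuplesD(1)[OF x]] by blast
      then have "d \<le> card ({g} \<union> x ` {1..t})" by (rule dmin[OF _ generating_tuplesD(2)[OF x]])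
      also have "\<dots> \<le> card {g} + card (x ` {1..t})" by (rule card_Un_le)
      also have "\<dots> \<le> 1 + card {1..t}" by (intro add_mono card_image_le) simp_all
      finally show False using t by simp
    qed
    then show ?thesis unfolding generation_prob_def by simp
  qed
  have sum_le: "(\<Sum>t<T. ?\<delta> t) \<le> 7" for T
  proof (rule telescoping_sum_bound[where d = d and p = ?p])
    show "?\<delta> t \<le> 1" for t
      using bounds[of t "{}"] bounds[of t "{g}"] by (simp add: survival_prob_def)
    show "?\<delta> t \<le> 0" if "t + 1 < d" for t
      using q0[OF that] bounds(1)[of t "{}"] by (simp add: survival_prob_def)
    show "?\<delta> (d + 3 + i) \<le> ?p (Suc (d + 3 + i)) - ?p (d + 3 + i) + (1 / 2) ^ i" for i
    proof -
      let ?t = "d + 3 + i"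
      have "?q ?t \<le> ?p (Suc ?t) + (1 - generation_prob {1..Suc ?t} E)"
        by (rule generation_prob_comparison[OF assms(5) E compl]) simp_all
      also have "1 - generation_prob {1..Suc ?t} E \<le>
          (\<Sum>k = 2..card (carrier G). 2 * real k ^ Suc d * (1 / real k) ^ Suc ?t)"
        using generation_prob_tail_bound[OF E a gen finZ Z(1,3), of "{1..Suc ?t}"] Z(2)
        by (simp only: finite_atLeastAtMost card_atLeastAtMost diff_Suc_1)
      also have "\<dots> \<le> (1 / 2) ^ i" by (rule sum_power_tail_le)
      finally show ?thesis by (simp add: survival_prob_def)
    qed
  qed (rule bounds)+
  \<comment> \<open>Stated for partial sums and without subtraction, so that it passes to the limit
    in the extended reals. The bound 7 is relaxed to 11.\<close>
  have part: "(\<Sum>t<T. survival_prob {} t) \<le> 11 + (\<Sum>t<T. survival_prob {g} t)" for T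
    using sum_le[of T] by (simp add: sum_subtractf)
  let ?e = "\<Sum>t. ennreal (survival_prob {} t)" and ?eg = "\<Sum>t. ennreal (survival_prob {g} t)"
  have le: "?e \<le> 11 + ?eg"
  proof (rule suminf_le_const[OF summableI])
    fix T
    have "(\<Sum>t<T. ennreal (survival_prob {} t)) = ennreal (\<Sum>t<T. survival_prob {} t)"
      by (rule sum_ennreal) (rule survival_prob_nonneg)
    also have "\<dots> \<le> ennreal (11 + (\<Sum>t<T. survival_prob {g} t))" by (rule ennreal_leI[OF part])
    also have "\<dots> = 11 + (\<Sum>t<T. ennreal (survival_prob {g} t))"
      by (simp add: ennreal_plus sum_nonneg survival_prob_nonneg)
    also have "\<dots> \<le> 11 + ?eg" by (intro add_left_mono sum_le_suminf summableI) simp_all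
    finally show "(\<Sum>t<T. ennreal (survival_prob {} t)) \<le> 11 + ?eg" .
  qed
  have "?eg \<noteq> top_class.top" "?e \<noteq> top_class.top" by (rule survival_prob_suminf_finite, use assms(5) in simp)+
  then obtain s r where s: "0 \<le> s" "?e = ennreal s" and r: "0 \<le> r" "?eg = ennreal r"
    by (metis ennreal_cases)
  have "ennreal s \<le> ennreal (11 + r)" using le s r by (simp add: ennreal_plus)
  then have "s \<le> 11 + r" by (subst (asm) ennreal_le_iff) (use r(1) in simp_all)
  then have "ereal s - ereal r \<le> 11" by simp
  then show ?thesis
    using s r assms(5) by (simp add: expected_generation_time_eq_suminf enn2ereal_ennreal)
qed

end
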